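(* Let $q$ be a positive integer, let $r$ be the largest integer such that $r^2\mid q$, let $\lambda\in\mathbb{Q}$, let $I=[c,d]$ be a compact interval, let $\delta\in(0,\frac12)$ and let $\alpha\in(0,1/2]$. Then for any $\varepsilon>0$, $$\sum_{\substack{a\in\mathbb{Z},\ a/q\in I\\ \|\lambda a^2/q\|<\delta}}1\ll \delta q+r^{1+\varepsilon}+\delta^{\frac12}q^{\frac{11}{16}+\varepsilon}$$ and $$\sum_{\substack{a\in\mathbb{Z},\ a/q\in I\\ \|\lambda a^2/q\|\ge\delta}}\left\|\lambda \frac{a^2}{q}\right\|^{-\alpha}\ll q+\delta^{-\alpha}r^{1+\varepsilon},$$ where the implied constants may depend on $\varepsilon,\lambda,I,\alpha$ but not on $q$ or $\delta$.
   Context: $\|\cdot\|$ denotes the distance to the nearest integer.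
   Formalization: The first estimate is stated only for λ ≠ 0; it is false for λ = 0 (take I = [0,1], q prime, δ = 1/q: the left side is q+1, the right side is of order q^{3/16+ε}). The second estimate is stated for all rational λ. *)

theory Defs
  imports Complex_Main
begin

definition dist_int :: "real \<Rightarrow> real" where
  "dist_int x = \<bar>x - of_int (round x)\<bar>"

text \<open>Meaningful for positive \<open>q\<close> only: every natural number squared divides \<open>0\<close>.\<close>

definition max_square_root_divisor :: "nat \<Rightarrow> nat" where
  "max_square_root_divisor q = (GREATEST r. r ^ 2 dvd q)"

end

theory Submission
  imports Defs "HOL-Number_Theory.Number_Theory" "HOL-Computational_Algebra.Squarefree" "HOL-Analysis.Convex"
begin

text \<open>
  Writing \<open>lam = u / v\<close> and \<open>Q = v q\<close>, the integers \<open>b = u a\<close> satisfy \<open>b\<^sup>2 \<equiv> m (mod Q)\<close> with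
  \<open>\<bar>m\<bar> \<le> M = \<bar>u\<bar> \<delta> Q\<close>, so the task is to bound the number of residues modulo \<open>Q\<close> whose square lies
  in \<open>[-M, M]\<close>. The contribution of \<open>m = 0\<close> is the square part of \<open>Q\<close>, and the number of square roots of
  the other \<open>m\<close> is on average \<open>O(Q\<^sup>\<epsilon>)\<close>. This suffices when \<open>M \<le> Q\<^bsup>3/8\<^esup>\<close>, where
  \<open>M \<le> M\<^bsup>1/2\<^esup> Q\<^bsup>3/16\<^esup>\<close>. For \<open>M \<ge> Q\<^bsup>3/8\<^esup>\<close> the loss of \<open>Q\<^sup>\<epsilon>\<close> must be removed.

  Only an upper bound is needed, so no Burgess bound enters: at most \<open>100\<close> prime factors of \<open>Q\<close> exceed
  \<open>Q\<^bsup>1/100\<^esup>\<close>, and dropping the condition that \<open>m\<close> is a square modulo these primes costs a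
  constant factor. What remains are sums of Jacobi symbols to smooth moduli over intervals of length about
  \<open>Q\<^bsup>3/8\<^esup>\<close>. Such a modulus splits as \<open>s\<^sub>1 s\<^sub>2 s\<^sub>3 g\<close> with all \<open>s\<^sub>i\<close> of size about
  \<open>Q\<^bsup>1/3\<^esup>\<close> and \<open>g\<close> a tiny power of \<open>Q\<close>; two van der Corput steps with shifts divisible by
  \<open>s\<^sub>1\<close> and \<open>s\<^sub>2\<close> remove \<open>s\<^sub>1\<close> and \<open>s\<^sub>2\<close>, the factor modulo \<open>s\<^sub>3\<close> is estimated trivially, and
  the resulting four-term correlations modulo \<open>g\<close> are small on average over the shifts by an
  elementary second moment computation.
\<close>

subsection \<open>Sums of periodic functions\<close>

text \<open>The exponent 11/16 is 1/2 + 3/16, since M has size \<delta> q in the term M^(1/2)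
  Q^(3/16). A given m coprime to the modulus may have about 2^\<omega> square roots, \<omega> being
  the number of prime factors; this is balanced by the density 1/2^\<omega> of those m that are
  squares modulo every prime factor. Each prime left out of the detection of squares therefore costs
  a factor 2, which is affordable for a bounded number of primes. Coprimality of m to the modulus
  must be detected as well: without the density \<open>totient n / n\<close>, the summation over g =
  gcd(b^2, Q) would involve sums such as that of 1 / g over the divisors of Q, which are unbounded.
  The error terms carry fixed powers of 2^\<omega> and of the divisor function, so any fixed power
  of Q saved in the character sums is enough. The second bound follows from the first by dyadic
  summation over the size of the distance.\<close>

definition periodic_mod :: "int \<Rightarrow> (int \<Rightarrow> 'a) \<Rightarrow> bool" where
  "periodic_mod n F \<longleftrightarrow> (\<forall>x y. [x = y] (mod n) \<longrightarrow> F x = F y)"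

definition complete_sum :: "int \<Rightarrow> (int \<Rightarrow> real) \<Rightarrow> real" where
  "complete_sum n F = (\<Sum>x\<in>{0..<n}. F x)"

lemma periodic_modD: "periodic_mod n F \<Longrightarrow> [x = y] (mod n) \<Longrightarrow> F x = F y"
  by (simp add: periodic_mod_def)

lemma periodic_mod_mod: "periodic_mod n F \<Longrightarrow> F (x mod n) = F x"
  by (erule periodic_modD) (simp add: Cong.cong_def)

lemma periodic_mod_comp_affine:
  assumes "periodic_mod n F"
  shows "periodic_mod n (\<lambda>x. F (c * x + d))"
  unfolding periodic_mod_def
  using assms by (auto intro!: periodic_modD cong_add cong_mult)

lemma periodic_mod_mult:
  assumes "periodic_mod n (F :: int \<Rightarrow> real)" "periodic_mod n G"
  shows "periodic_mod n (\<lambda>x. F x * G x)"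
  using assms unfolding periodic_mod_def by metis

lemma periodic_mod_dvd:
  assumes "periodic_mod m F" "m dvd n"
  shows "periodic_mod n F"
  using assms unfolding periodic_mod_def by (metis cong_dvd_modulus)

lemma bij_betw_affine_mod:
  fixes n c d :: int
  assumes "n > 0" "coprime c n"
  shows "bij_betw (\<lambda>x. (c * x + d) mod n) {0..<n} {0..<n}"
proof -
  have "inj_on (\<lambda>x. (c * x + d) mod n) {0..<n}"
  proof (rule inj_onI)
    fix x y assume xy: "x \<in> {0..<n}" "y \<in> {0..<n}" and "(c * x + d) mod n = (c * y + d) mod n"
    hence "[c * x + d = c * y + d] (mod n)" by (simp only: Cong.cong_def)
    hence "[c * x = c * y] (mod n)" by (simp add: cong_add_rcancel)
    hence "[x = y] (mod n)" using assms(2) by (simp add: cong_mult_lcancel)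
    thus "x = y" using xy by (simp add: Cong.cong_def)
  qed
  moreover have "(\<lambda>x. (c * x + d) mod n) ` {0..<n} \<subseteq> {0..<n}" using assms(1) by auto
  ultimately show ?thesis
    by (metis bij_betw_def card_image card_subset_eq finite_atLeastLessThan_int)
qed

lemma complete_sum_affine:
  assumes "n > 0" "coprime c n" "periodic_mod n F"
  shows "complete_sum n (\<lambda>x. F (c * x + d)) = complete_sum n F"
proof -
  have "complete_sum n (\<lambda>x. F (c * x + d)) = (\<Sum>x\<in>{0..<n}. F ((c * x + d) mod n))"
    unfolding complete_sum_def using periodic_mod_mod[OF assms(3)] by simp
  also have "\<dots> = complete_sum n F"
    unfolding complete_sum_def
    using sum.reindex_bij_betw[OF bij_betw_affine_mod[OF assms(1,2), of d], of F] by simp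
  finally show ?thesis .
qed

lemma complete_sum_shift:
  assumes "n > 0" "periodic_mod n F"
  shows "complete_sum n (\<lambda>x. F (x + d)) = complete_sum n F"
  using complete_sum_affine[OF assms(1) _ assms(2), of 1 d] by simp

lemma sum_interval_split:
  fixes F :: "int \<Rightarrow> real" and n :: int
  assumes "n > 0"
  shows "(\<Sum>x\<in>{N..<N + int k * n}. F x) = (\<Sum>t\<in>{0..<int k}. \<Sum>r\<in>{0..<n}. F (N + r + n * t))"
proof (induction k)
  case 0
  then show ?case by simp
next
  case (Suc k)
  have "{N..<N + int (Suc k) * n} = {N..<N + int k * n} \<union> {N + int k * n..<N + int (Suc k) * n}"
    using assms by (intro ivl_disj_un_two(3)[symmetric]) (auto simp: algebra_simps)
  hence "(\<Sum>x\<in>{N..<N + int (Suc k) * n}. F x) =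
      (\<Sum>x\<in>{N..<N + int k * n}. F x) + (\<Sum>x\<in>{N + int k * n..<N + int (Suc k) * n}. F x)"
    by (simp add: sum.union_disjoint)
  also have "(\<Sum>x\<in>{N + int k * n..<N + int (Suc k) * n}. F x) = (\<Sum>r\<in>{0..<n}. F (N + r + n * int k))"
    by (rule sum.reindex_bij_witness[of _ "\<lambda>r. N + r + n * int k" "\<lambda>x. x - N - n * int k"])
       (auto simp: algebra_simps)
  moreover have "{0..<int (Suc k)} = insert (int k) {0..<int k}" by auto
  ultimately show ?case using Suc.IH by simp
qed

text \<open>Write x = r + m * t with r < m and t < n: F sees only r, and for fixed r the argument of
  G runs once through the residues modulo n because m is a unit there.\<close>

lemma complete_sum_mult_coprime:
  assumes "m > 0" "n > 0" "coprime m n" "periodic_mod m F" "periodic_mod n G"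
  shows "complete_sum (m * n) (\<lambda>x. F x * G x) = complete_sum m F * complete_sum n G"
proof -
  have "complete_sum (m * n) (\<lambda>x. F x * G x) =
      (\<Sum>t\<in>{0..<n}. \<Sum>r\<in>{0..<m}. F (r + m * t) * G (r + m * t))"
    using sum_interval_split[OF assms(1), of "\<lambda>x. F x * G x" 0 "nat n"] assms(1,2)
    by (simp add: complete_sum_def mult.commute)
  also have "\<dots> = (\<Sum>t\<in>{0..<n}. \<Sum>r\<in>{0..<m}. F r * G (r + m * t))"
    by (intro sum.cong refl arg_cong2[where f="(*)"] periodic_modD[OF assms(4)])
      (simp_all only: Cong.cong_def mod_mult_self2)
  also have "\<dots> = (\<Sum>r\<in>{0..<m}. \<Sum>t\<in>{0..<n}. F r * G (r + m * t))" by (rule sum.swap)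
  also have "\<dots> = (\<Sum>r\<in>{0..<m}. F r * complete_sum n (\<lambda>t. G (m * t + r)))"
    by (simp add: complete_sum_def sum_distrib_left add.commute)
  also have "\<dots> = (\<Sum>r\<in>{0..<m}. F r * complete_sum n G)"
    using assms by (simp add: complete_sum_affine)
  finally show ?thesis by (simp add: complete_sum_def sum_distrib_right)
qed

lemma sum_interval_periodic:
  assumes "n > 0" "periodic_mod n F"
  shows "(\<Sum>x\<in>{N..<N + int k * n}. F x) = real k * complete_sum n F"
proof -
  have "F (N + r + n * t) = F (r + N)" for r t
    by (rule periodic_modD[OF assms(2)]) (simp only: Cong.cong_def mod_mult_self2 add.commute[of r])
  hence "(\<Sum>x\<in>{N..<N + int k * n}. F x) = real k * complete_sum n (\<lambda>r. F (r + N))"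
    unfolding sum_interval_split[OF assms(1)] complete_sum_def by simp
  thus ?thesis using complete_sum_shift[OF assms] by simp
qed

text \<open>Full periods contribute at most L / n complete sums; the tail is shorter than one period
  and is bounded term by term.\<close>

lemma abs_sum_interval_periodic_le:
  fixes L :: nat
  assumes "n > 0" "periodic_mod n F" "\<And>x. \<bar>F x\<bar> \<le> 1"
  shows "\<bar>\<Sum>x\<in>{N..<N + int L}. F x\<bar> \<le> real L / real_of_int n * \<bar>complete_sum n F\<bar> + real_of_int n"
proof -
  define k where "k = L div nat n"
  have k: "int k * n \<le> int L" "int L < int k * n + n"
  proof -
    have "int L = int k * n + int L mod n"
      using assms(1) by (simp add: k_def zdiv_int div_mult_mod_eq)
    moreover have "0 \<le> int L mod n" "int L mod n < n" using assms(1) by auto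
    ultimately show "int k * n \<le> int L" "int L < int k * n + n" by linarith+
  qed
  have "{N..<N + int L} = {N..<N + int k * n} \<union> {N + int k * n..<N + int L}"
    using k assms(1) by (intro ivl_disj_un_two(3)[symmetric]) auto
  hence "(\<Sum>x\<in>{N..<N + int L}. F x) = (\<Sum>x\<in>{N..<N + int k * n}. F x) + (\<Sum>x\<in>{N + int k * n..<N + int L}. F x)"
    by (simp add: sum.union_disjoint)
  also have "\<dots> = real k * complete_sum n F + (\<Sum>x\<in>{N + int k * n..<N + int L}. F x)"
    using sum_interval_periodic[OF assms(1,2)] by simp
  finally have "\<bar>\<Sum>x\<in>{N..<N + int L}. F x\<bar> \<le> real k * \<bar>complete_sum n F\<bar> + \<bar>\<Sum>x\<in>{N + int k * n..<N + int L}. F x\<bar>"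
    using abs_triangle_ineq[of "real k * complete_sum n F"] by (simp add: abs_mult)
  also have "\<bar>\<Sum>x\<in>{N + int k * n..<N + int L}. F x\<bar> \<le> (\<Sum>x\<in>{N + int k * n..<N + int L}. 1)"
    using assms(3) by (intro order.trans[OF sum_abs] sum_mono) auto
  also have "\<dots> \<le> real_of_int n"
  proof -
    have "int L - int k * n \<le> n" using k by simp
    thus ?thesis using k assms(1) unfolding of_int_le_iff[where 'a=real, symmetric] by simp
  qed
  also have "real k \<le> real L / real_of_int n"
    using k(1)[folded of_int_le_iff[where 'a=real]] assms(1) by (simp add: pos_le_divide_eq)
  finally show ?thesis by (simp add: mult_right_mono)
qed

lemma sum_nonneg_periodic_le:
  fixes H :: nat
  assumes "n > 0" "periodic_mod n F" "\<And>x. 0 \<le> F x" "n \<le> int H"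
  shows "(\<Sum>x\<in>{N..<N + int H}. F x) \<le> 2 * real H / real_of_int n * complete_sum n F"
proof -
  \<comment> \<open>Rounding up to whole periods at most doubles the length, since n <= H;
    nonnegativity makes the extra terms harmless.\<close>
  define k where "k = H div nat n + 1"
  have k: "int H \<le> int k * n" "int k * n \<le> int H + n"
  proof -
    have "int H = int (H div nat n) * n + int H mod n"
      using assms(1) by (simp add: zdiv_int div_mult_mod_eq)
    moreover have "0 \<le> int H mod n" "int H mod n < n" using assms(1) by auto
    ultimately show "int H \<le> int k * n" "int k * n \<le> int H + n"
      by (auto simp: k_def algebra_simps)
  qed
  have "(\<Sum>x\<in>{N..<N + int H}. F x) \<le> (\<Sum>x\<in>{N..<N + int k * n}. F x)"
    using k assms(3) by (intro sum_mono2) auto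
  also have "\<dots> = real k * complete_sum n F" by (rule sum_interval_periodic[OF assms(1,2)])
  also have "\<dots> \<le> 2 * real H / real_of_int n * complete_sum n F"
  proof (rule mult_right_mono)
    have "int k * n \<le> 2 * int H" using k assms(4) by simp
    hence "real k * real_of_int n \<le> 2 * real H"
      unfolding of_int_le_iff[where 'a=real, symmetric] by simp
    thus "real k \<le> 2 * real H / real_of_int n" using assms(1) by (simp add: pos_le_divide_eq)
    show "0 \<le> complete_sum n F" using assms(3) by (simp add: complete_sum_def sum_nonneg)
  qed
  finally show ?thesis .
qed

subsection \<open>The Legendre symbol\<close>

definition leg :: "nat \<Rightarrow> int \<Rightarrow> real" where
  "leg p x = real_of_int (Legendre x (int p))"

lemma abs_leg_le: "\<bar>leg p x\<bar> \<le> 1"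
  by (simp add: leg_def Legendre_def)

lemma leg_eq_0_iff: "leg p x = 0 \<longleftrightarrow> int p dvd x"
  by (simp add: leg_def Legendre_def cong_0_iff)

lemma leg_square: "\<not> int p dvd x \<Longrightarrow> leg p x * leg p x = 1"
  by (simp add: leg_def Legendre_def cong_0_iff)

lemma periodic_mod_leg: "periodic_mod (int p) (leg p)"
proof -
  have "Legendre x p = Legendre y p" if "[x = y] (mod int p)" for x y
  proof -
    have "[z = x] (mod int p) \<longleftrightarrow> [z = y] (mod int p)"
      "[x = z] (mod int p) \<longleftrightarrow> [y = z] (mod int p)" for z
      using that by (auto simp: Cong.cong_def)
    thus ?thesis by (simp add: Legendre_def QuadRes_def)
  qed
  thus ?thesis by (simp add: periodic_mod_def leg_def)
qed

lemma leg_eq_1: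
  assumes "[y ^ 2 = x] (mod int p)" "\<not> int p dvd x"
  shows "leg p x = 1"
  using assms by (auto simp: leg_def Legendre_def QuadRes_def cong_0_iff)

context
  fixes p :: nat
  assumes prime_p: "prime p" and odd_p: "p > 2"
begin

lemma coprime_prime_int: "\<not> int p dvd c \<Longrightarrow> coprime c (int p)"
  using prime_imp_coprime[of "int p" c] prime_p by (simp add: coprime_commute)

text \<open>By Euler's criterion both sides agree modulo p, and two values in {-1, 0, 1} differ by
  at most 2 < p.\<close>

lemma leg_mult: "leg p (x * y) = leg p x * leg p y"
proof -
  let ?e = "(p - 1) div 2"
  have "[Legendre (x * y) p = (x * y) ^ ?e] (mod int p)"
    by (rule euler_criterion[OF prime_p odd_p])
  also have "(x * y) ^ ?e = x ^ ?e * y ^ ?e" by (rule power_mult_distrib)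
  also have "[\<dots> = Legendre x p * Legendre y p] (mod int p)"
    using euler_criterion[OF prime_p odd_p] by (intro cong_mult) (auto intro: cong_sym)
  finally have "int p dvd Legendre (x * y) p - Legendre x p * Legendre y p"
    by (simp add: cong_iff_dvd_diff)
  moreover have "\<bar>Legendre (x * y) p - Legendre x p * Legendre y p\<bar> < int p"
  proof -
    have "\<bar>Legendre z p\<bar> \<le> 1" for z by (simp add: Legendre_def)
    from this[of "x * y"] mult_mono[OF this[of x] this[of y]]
    show ?thesis using odd_p by (simp add: abs_mult[symmetric])
  qed
  ultimately have "Legendre (x * y) p = Legendre x p * Legendre y p"
    using dvd_imp_le_int[of "Legendre (x * y) p - Legendre x p * Legendre y p" "int p"] by linarith
  thus ?thesis by (simp add: leg_def)
qed

lemma card_sqrt_mod_prime_le: "card {x\<in>{0..<int p}. [x ^ 2 = a] (mod int p)} \<le> 2"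
proof (cases "{x\<in>{0..<int p}. [x ^ 2 = a] (mod int p)} = {}")
  case False
  then obtain y where y: "[y ^ 2 = a] (mod int p)" by blast
  have "{x\<in>{0..<int p}. [x ^ 2 = a] (mod int p)} \<subseteq> {y mod int p, (-y) mod int p}"
  proof
    fix x assume x: "x \<in> {x\<in>{0..<int p}. [x ^ 2 = a] (mod int p)}"
    hence "[x ^ 2 = y ^ 2] (mod int p)" using y by (simp add: Cong.cong_def)
    hence "int p dvd (x - y) * (x + y)"
      by (simp add: cong_iff_dvd_diff power2_eq_square algebra_simps)
    hence "int p dvd x - y \<or> int p dvd x - (- y)"
      using prime_p by (simp add: prime_dvd_mult_iff)
    hence "x mod int p = y mod int p \<or> x mod int p = (-y) mod int p"
      by (simp only: mod_eq_dvd_iff)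
    thus "x \<in> {y mod int p, (-y) mod int p}" using x by auto
  qed
  hence "card {x\<in>{0..<int p}. [x ^ 2 = a] (mod int p)} \<le> card {y mod int p, (-y) mod int p}"
    by (intro card_mono) auto
  also have "\<dots> \<le> 2" by (simp add: card_insert_if)
  finally show ?thesis .
qed (simp only: card.empty)

text \<open>A quadratic nonresidue c gives the substitution x -> c x, which reverses the sign of the
  sum. Without a nonresidue, squaring would permute the residues, but 1 and p - 1 have the same
  square.\<close>

lemma complete_sum_leg: "complete_sum (int p) (leg p) = 0"
proof -
  have "\<exists>c\<in>{0..<int p}. leg p c = -1"
  proof (rule ccontr)
    assume none: "\<not> ?thesis"
    let ?f = "\<lambda>x. x ^ 2 mod int p"
    have "{0..<int p} \<subseteq> ?f ` {0..<int p}"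
    proof
      fix c assume c: "c \<in> {0..<int p}"
      show "c \<in> ?f ` {0..<int p}"
      proof (cases "int p dvd c")
        case True
        hence "c = 0" using c by (auto dest: zdvd_imp_le)
        thus ?thesis using c by (intro image_eqI[of _ _ 0]) auto
      next
        case False
        have "leg p c \<noteq> -1" using none c by blast
        with False have "QuadRes (int p) c"
          by (simp add: leg_def Legendre_def cong_0_iff split: if_splits)
        then obtain y where y: "[y ^ 2 = c] (mod int p)" unfolding QuadRes_def by blast
        hence "c = ?f (y mod int p)" using c by (simp add: Cong.cong_def power_mod)
        thus ?thesis using c by (intro image_eqI[of _ _ "y mod int p"]) auto
      qed
    qed
    hence "?f ` {0..<int p} = {0..<int p}"
      using odd_p by (intro equalityI) auto
    hence "inj_on ?f {0..<int p}"
      using eq_card_imp_inj_on[of "{0..<int p}" ?f] by (simp only: finite_atLeastLessThan_int)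
    moreover have "?f 1 = ?f (int p - 1)"
    proof -
      have "(int p - 1) ^ 2 = 1 + int p * (int p - 2)" by (simp add: power2_eq_square algebra_simps)
      thus ?thesis by simp
    qed
    ultimately have "1 = int p - 1"
      by (rule inj_onD) (use odd_p in simp_all)
    thus False using odd_p by simp
  qed
  then obtain c where c: "leg p c = -1" by auto
  hence "\<not> int p dvd c" by (auto simp: leg_eq_0_iff[symmetric])
  hence "coprime c (int p)"
    by (rule coprime_prime_int)
  hence "complete_sum (int p) (\<lambda>x. leg p (c * x + 0)) = complete_sum (int p) (leg p)"
    using odd_p by (intro complete_sum_affine periodic_mod_leg) auto
  moreover have "complete_sum (int p) (\<lambda>x. leg p (c * x + 0)) = - complete_sum (int p) (leg p)"
    using c by (simp add: complete_sum_def leg_mult sum_negf)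
  ultimately show ?thesis by simp
qed

text \<open>Substituting h x for x shows that the sum takes one common value for all h not divisible
  by p. The total over all h is 0 and h = 0 contributes p - 1, so the common value is -1.\<close>

lemma complete_sum_leg_shift:
  "\<bar>complete_sum (int p) (\<lambda>x. leg p x * leg p (x + h))\<bar> \<le> (if int p dvd h then real p else 1)"
proof -
  define J where "J h = complete_sum (int p) (\<lambda>x. leg p x * leg p (x + h))" for h
  have per: "periodic_mod (int p) (\<lambda>x. leg p x * leg p (x + h))" for h
    using periodic_mod_comp_affine[OF periodic_mod_leg[of p], of 1 h]
    by (intro periodic_mod_mult periodic_mod_leg) auto
  have triv: "\<bar>J h\<bar> \<le> real p" for h
  proof -
    have "\<bar>J h\<bar> \<le> (\<Sum>x\<in>{0..<int p}. 1)"
      unfolding J_def complete_sum_def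
      by (intro order.trans[OF sum_abs] sum_mono) (simp add: abs_mult mult_le_one abs_leg_le)
    thus ?thesis by simp
  qed
  have scale: "J h = J 1" if h: "\<not> int p dvd h" for h
  proof -
    have "coprime h (int p)" using h by (rule coprime_prime_int)
    hence "J h = complete_sum (int p) (\<lambda>x. leg p (h * x + 0) * leg p (h * x + 0 + h))"
      using complete_sum_affine[OF _ _ per[of h], of h 0] odd_p by (simp add: J_def)
    also have "\<dots> = complete_sum (int p) (\<lambda>x. (leg p h * leg p h) * (leg p x * leg p (x + 1)))"
    proof -
      have "leg p (h * x + 0) * leg p (h * x + 0 + h) = (leg p h * leg p h) * (leg p x * leg p (x + 1))" for x
        using leg_mult[of h x] leg_mult[of h "x + 1"] by (simp add: algebra_simps)
      thus ?thesis by simp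
    qed
    finally show ?thesis using leg_square[OF h] by (simp add: J_def)
  qed
  have "(\<Sum>h\<in>{0..<int p}. J h) = 0"
  proof -
    have "(\<Sum>h\<in>{0..<int p}. J h) = (\<Sum>x\<in>{0..<int p}. leg p x * complete_sum (int p) (\<lambda>h. leg p (h + x)))"
      unfolding J_def complete_sum_def by (subst sum.swap) (simp add: sum_distrib_left add.commute)
    also have "\<dots> = 0"
      using complete_sum_shift[OF _ periodic_mod_leg] complete_sum_leg odd_p by simp
    finally show ?thesis .
  qed
  moreover have "(\<Sum>h\<in>{0..<int p}. J h) = J 0 + (real p - 1) * J 1"
  proof -
    have "{0..<int p} = insert 0 {1..<int p}" using odd_p by auto
    moreover have "(\<Sum>h\<in>{1..<int p}. J h) = (\<Sum>h\<in>{1..<int p}. J 1)"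
      by (intro sum.cong refl scale) (auto dest: zdvd_imp_le)
    ultimately show ?thesis using odd_p by (simp add: of_nat_diff)
  qed
  moreover have "J 0 = real p - 1"
  proof -
    have "{0..<int p} = insert 0 {1..<int p}" using odd_p by auto
    hence "J 0 = (\<Sum>x\<in>insert 0 {1..<int p}. leg p x * leg p x)" by (simp add: J_def complete_sum_def)
    also have "\<dots> = (\<Sum>h\<in>{1..<int p}. leg p h * leg p h)"
      by (simp add: leg_eq_0_iff)
    also have "\<dots> = (\<Sum>h\<in>{1..<int p}. 1)"
      by (intro sum.cong refl leg_square) (auto dest: zdvd_imp_le)
    finally show ?thesis using odd_p by (simp add: of_nat_diff)
  qed
  ultimately have "(real p - 1) * (1 + J 1) = 0" by (simp add: algebra_simps)
  hence "J 1 = -1" using odd_p by simp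
  hence "\<bar>J h\<bar> \<le> (if int p dvd h then real p else 1)" using triv[of h] scale[of h] by auto
  thus ?thesis by (simp only: J_def)
qed

end

subsection \<open>Second moment of four-term correlations\<close>

text \<open>The correlation over the corners x, x + a, x + b, x + a + b of a parallelogram, as
  produced by two differencing steps with shifts a and b.\<close>

definition corner_sum :: "int \<Rightarrow> (int \<Rightarrow> real) \<Rightarrow> int \<Rightarrow> int \<Rightarrow> real" where
  "corner_sum n F a b = complete_sum n (\<lambda>x. F x * F (x + a) * F (x + b) * F (x + a + b))"

definition corner_moment :: "int \<Rightarrow> (int \<Rightarrow> real) \<Rightarrow> real" where
  "corner_moment n F = complete_sum n (\<lambda>a. complete_sum n (\<lambda>b. (corner_sum n F a b)\<^sup>2))"

lemma periodic_corner_sum: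
  assumes "periodic_mod n F"
  shows "periodic_mod n (\<lambda>a. corner_sum n F a b)" "periodic_mod n (\<lambda>b. corner_sum n F a b)"
proof -
  have F: "F (x + y) = F (x + z)" "F (x + y + w) = F (x + z + w)" "F (w + x + y) = F (w + x + z)"
    if "[y = z] (mod n)" for x y z w
    using that by (auto intro!: periodic_modD[OF assms] cong_add)
  show "periodic_mod n (\<lambda>a. corner_sum n F a b)" "periodic_mod n (\<lambda>b. corner_sum n F a b)"
    unfolding periodic_mod_def corner_sum_def
    by (intro allI impI arg_cong[where f = "complete_sum n"] ext; simp add: F)+
qed

text \<open>The map (a, b) -> (a + b, a - b) has determinant -2, a unit for odd n. It is carried out
  as two substitutions in one variable: c = a + b for fixed a, then 2 * a - c for fixed c.\<close>

lemma complete_sum_diag: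
  assumes "n > 0" "odd n" "\<And>a. periodic_mod n (\<lambda>b. G a b)" "\<And>b. periodic_mod n (\<lambda>a. G a b)"
  shows "complete_sum n (\<lambda>a. complete_sum n (\<lambda>b. G (a + b) (a - b))) =
         complete_sum n (\<lambda>a. complete_sum n (\<lambda>b. G a b))"
proof -
  have "complete_sum n (\<lambda>b. G (a + b) (a - b)) = complete_sum n (\<lambda>c. G c (2 * a + - c))" for a
  proof -
    have "periodic_mod n (\<lambda>c. G c (2 * a + - c))"
      unfolding periodic_mod_def
    proof (intro allI impI)
      fix x y assume xy: "[x = y] (mod n)"
      hence "[2 * a + - x = 2 * a + - y] (mod n)" by (intro cong_add cong_refl cong_uminus)
      thus "G x (2 * a + - x) = G y (2 * a + - y)"
        using periodic_modD[OF assms(3)[of x], of "2 * a + - x" "2 * a + - y"]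
          periodic_modD[OF assms(4)[of "2 * a + - y"] xy] by simp
    qed
    from complete_sum_shift[OF assms(1) this, of a] show ?thesis by (simp add: algebra_simps)
  qed
  hence "complete_sum n (\<lambda>a. complete_sum n (\<lambda>b. G (a + b) (a - b))) =
      complete_sum n (\<lambda>c. complete_sum n (\<lambda>a. G c (2 * a + - c)))"
    unfolding complete_sum_def by (simp only:) (rule sum.swap)
  also have "\<dots> = complete_sum n (\<lambda>c. complete_sum n (\<lambda>b. G c b))"
  proof -
    have "complete_sum n (\<lambda>a. G c (2 * a + - c)) = complete_sum n (\<lambda>b. G c b)" for c
      by (rule complete_sum_affine[OF assms(1) _ assms(3)]) (use assms(2) in simp)
    thus ?thesis by simp
  qed
  finally show ?thesis .
qed

lemma square_sum_eq_sum_pairs: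
  "(\<Sum>x\<in>X. u x)\<^sup>2 = (\<Sum>xx\<in>X \<times> X. u (fst xx) * u (snd xx :: 'a) :: real)"
  unfolding power2_eq_square sum_product sum.cartesian_product by (simp add: split_def)

lemma sum_sum_eq_sum_pairs:
  "(\<Sum>x\<in>X. \<Sum>y\<in>Y. h x y) = (\<Sum>xy\<in>X \<times> Y. h (fst xy) (snd xy))"
  unfolding sum.cartesian_product by (simp add: split_def)

text \<open>For the matrix f the two sides are the squared Frobenius norms of the Gram matrices of
  its columns and of its rows; opening the squares gives the same fourfold sum.\<close>

lemma sum_product_square_swap:
  fixes f :: "'a \<Rightarrow> 'b \<Rightarrow> real"
  shows "(\<Sum>a\<in>A. \<Sum>b\<in>A. (\<Sum>y\<in>Y. f y a * f y b)\<^sup>2) = (\<Sum>y\<in>Y. \<Sum>z\<in>Y. (\<Sum>a\<in>A. f y a * f z a)\<^sup>2)"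
proof -
  show ?thesis
    unfolding sum_sum_eq_sum_pairs[of _ A A] sum_sum_eq_sum_pairs[of _ Y Y] square_sum_eq_sum_pairs by (subst sum.swap) (simp add: mult_ac)
qed

context
  fixes p :: nat
  assumes prime_p: "prime p" and odd_p: "p > 2"
begin

lemma complete_sum_squares_le:
  assumes "periodic_mod (int p) F" "\<And>x. 0 \<le> F x"
  shows "complete_sum (int p) (\<lambda>x. F (x ^ 2)) \<le> 2 * complete_sum (int p) F"
proof -
  have "complete_sum (int p) (\<lambda>x. F (x ^ 2)) = (\<Sum>x\<in>{0..<int p}. F (x ^ 2 mod int p))"
    using periodic_mod_mod[OF assms(1)] by (simp add: complete_sum_def)
  also have "\<dots> = (\<Sum>y\<in>{0..<int p}. \<Sum>x\<in>{x\<in>{0..<int p}. x ^ 2 mod int p = y}. F (x ^ 2 mod int p))"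
    using odd_p by (intro sum.group[symmetric]) auto
  also have "\<dots> = (\<Sum>y\<in>{0..<int p}. real (card {x\<in>{0..<int p}. x ^ 2 mod int p = y}) * F y)"
    by (intro sum.cong refl) simp
  also have "\<dots> \<le> (\<Sum>y\<in>{0..<int p}. 2 * F y)"
  proof (intro sum_mono mult_right_mono assms(2))
    fix y assume "y \<in> {0..<int p}"
    hence "{x\<in>{0..<int p}. x ^ 2 mod int p = y} = {x\<in>{0..<int p}. [x ^ 2 = y] (mod int p)}"
      by (intro Collect_cong conj_cong refl) (simp add: Cong.cong_def)
    thus "real (card {x\<in>{0..<int p}. x ^ 2 mod int p = y}) \<le> 2"
      using card_sqrt_mod_prime_le[OF prime_p odd_p, of y] by simp
  qed
  finally show ?thesis by (simp add: complete_sum_def sum_distrib_left)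
qed

text \<open>
  With shifts \<open>a + b\<close> and \<open>a - b\<close> and \<open>x = y - a\<close> the summand becomes
  \<open>leg p (y\<^sup>2 - a\<^sup>2) * leg p (y\<^sup>2 - b\<^sup>2)\<close>. By positivity \<open>a\<^sup>2\<close> and \<open>b\<^sup>2\<close> may be replaced by free residues
  at the cost of a factor \<open>4\<close>; opening the square then leaves only sums over one residue of a product of two
  Legendre symbols, so that Weil's bound is not needed.
\<close>

lemma corner_moment_leg_le: "corner_moment (int p) (leg p) \<le> 12 * real p ^ 3"
proof -
  let ?P = "{0..<int p}"
  have pos: "int p > 0" using odd_p by simp
  have oddp: "odd (int p)" using prime_p odd_p prime_odd_nat by simp
  define \<psi> where "\<psi> y a = leg p (y ^ 2 - a)" for y a
  define G where "G a b = (complete_sum p (\<lambda>y. \<psi> y a * \<psi> y b))\<^sup>2" for a b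
  have per_\<psi>: "periodic_mod p (\<psi> y)" for y
    using periodic_mod_comp_affine[OF periodic_mod_leg[of p], of "-1" "y ^ 2"] by (simp add: \<psi>_def[abs_def])
  have perG: "periodic_mod p (\<lambda>b. G a b)" "periodic_mod p (\<lambda>b. G b a)" for a
    unfolding periodic_mod_def G_def using periodic_modD[OF per_\<psi>] by (simp_all cong: sum.cong)
  have "corner_moment p (leg p) =
      complete_sum p (\<lambda>a. complete_sum p (\<lambda>b. (corner_sum p (leg p) (a + b) (a - b))\<^sup>2))"
    unfolding corner_moment_def
  proof (rule complete_sum_diag[OF pos oddp, symmetric])
    show "periodic_mod (int p) (\<lambda>b. (corner_sum (int p) (leg p) a b)\<^sup>2)"
      "periodic_mod (int p) (\<lambda>a. (corner_sum (int p) (leg p) a b)\<^sup>2)" for a b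
      unfolding power2_eq_square
      by (intro periodic_mod_mult periodic_corner_sum periodic_mod_leg)+
  qed
  also have "\<dots> = complete_sum p (\<lambda>a. complete_sum p (\<lambda>b. G (a ^ 2) (b ^ 2)))"
  proof -
    have "corner_sum p (leg p) (a + b) (a - b) = complete_sum p (\<lambda>y. \<psi> y (a ^ 2) * \<psi> y (b ^ 2))" for a b
    proof -
      let ?F = "\<lambda>x. leg p x * leg p (x + (a + b)) * leg p (x + (a - b)) * leg p (x + (a + b) + (a - b))"
      have "leg p (y ^ 2 - a ^ 2) * leg p (y ^ 2 - b ^ 2) = ?F (y + - a)" for y
      proof -
        have "leg p (y ^ 2 - a ^ 2) = leg p (y - a) * leg p (y + a)"
          "leg p (y ^ 2 - b ^ 2) = leg p (y - b) * leg p (y + b)"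
          by (simp_all add: leg_mult[OF prime_p odd_p, symmetric] power2_eq_square algebra_simps)
        thus ?thesis by (simp add: algebra_simps)
      qed
      moreover have "periodic_mod p ?F"
        using periodic_mod_comp_affine[OF periodic_mod_leg[of p], of 1]
        by (intro periodic_mod_mult periodic_mod_leg) (simp_all add: add.assoc)
      ultimately show ?thesis
        using complete_sum_shift[OF pos, of ?F "-a"] by (simp add: \<psi>_def corner_sum_def)
    qed
    thus ?thesis by (simp add: G_def)
  qed
  also have "\<dots> \<le> complete_sum p (\<lambda>a. 2 * complete_sum p (\<lambda>b. G (a ^ 2) b))"
    unfolding complete_sum_def[of _ "\<lambda>a. complete_sum p (\<lambda>b. G (a ^ 2) (b ^ 2))"]
      complete_sum_def[of _ "\<lambda>a. 2 * complete_sum p (\<lambda>b. G (a ^ 2) b)"]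
    by (intro sum_mono complete_sum_squares_le perG) (simp add: G_def)
  also have "\<dots> = 2 * complete_sum p (\<lambda>a. complete_sum p (\<lambda>b. G (a ^ 2) b))"
    by (simp add: complete_sum_def sum_distrib_left)
  also have "\<dots> \<le> 2 * (2 * complete_sum p (\<lambda>a. complete_sum p (\<lambda>b. G a b)))"
  proof (intro mult_left_mono complete_sum_squares_le)
    show "periodic_mod p (\<lambda>a. complete_sum p (\<lambda>b. G a b))"
      unfolding periodic_mod_def using periodic_modD[OF perG(2)] by (metis (no_types, lifting) ext)
    show "0 \<le> complete_sum p (\<lambda>b. G a b)" for a
      unfolding complete_sum_def G_def by (intro sum_nonneg) simp
  qed simp
  also have "complete_sum p (\<lambda>a. complete_sum p (\<lambda>b. G a b)) =
      (\<Sum>y\<in>?P. \<Sum>z\<in>?P. (\<Sum>a\<in>?P. \<psi> y a * \<psi> z a)\<^sup>2)"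
    unfolding complete_sum_def G_def by (rule sum_product_square_swap)
  also have "\<dots> \<le> (\<Sum>y\<in>?P. \<Sum>z\<in>?P. (if [z ^ 2 = y ^ 2] (mod p) then real p ^ 2 else 0) + 1)"
  proof (intro sum_mono)
    fix y z assume "y \<in> ?P" "z \<in> ?P"
    have per: "periodic_mod p (\<lambda>x. leg p x * leg p (x + (z ^ 2 - y ^ 2)))"
      using periodic_mod_comp_affine[OF periodic_mod_leg[of p], of 1]
      by (intro periodic_mod_mult periodic_mod_leg) simp_all
    have "(\<Sum>a\<in>?P. \<psi> y a * \<psi> z a) = complete_sum p (\<lambda>a. leg p (- 1 * a + y ^ 2) * leg p (- 1 * a + y ^ 2 + (z ^ 2 - y ^ 2)))"
      by (simp add: complete_sum_def \<psi>_def)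
    also have "\<dots> = complete_sum p (\<lambda>x. leg p x * leg p (x + (z ^ 2 - y ^ 2)))"
      by (rule complete_sum_affine[OF pos _ per]) simp
    finally have "\<bar>\<Sum>a\<in>?P. \<psi> y a * \<psi> z a\<bar> \<le> (if int p dvd z ^ 2 - y ^ 2 then real p else 1)"
      using complete_sum_leg_shift[OF prime_p odd_p, of "z ^ 2 - y ^ 2"] by simp
    hence "(\<Sum>a\<in>?P. \<psi> y a * \<psi> z a)\<^sup>2 \<le> (if int p dvd z ^ 2 - y ^ 2 then real p else 1)\<^sup>2"
      by (rule power2_le_iff_abs_le[THEN iffD2, rotated]) simp
    thus "(\<Sum>a\<in>?P. \<psi> y a * \<psi> z a)\<^sup>2 \<le> (if [z ^ 2 = y ^ 2] (mod p) then real p ^ 2 else 0) + 1"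
      by (simp add: cong_iff_dvd_diff split: if_splits)
  qed
  \<comment> \<open>For fixed y at most two z satisfy z^2 = y^2 modulo p, each costing p^2; the
    summands 1 add p in total. With the factor 4 collected above the constant becomes 12.\<close>
  also have "\<dots> \<le> (\<Sum>y\<in>?P. 3 * real p ^ 2)"
  proof (intro sum_mono)
    fix y assume "y \<in> ?P"
    have "(\<Sum>z\<in>?P. (if [z ^ 2 = y ^ 2] (mod p) then real p ^ 2 else 0)) =
        real (card {z\<in>?P. [z ^ 2 = y ^ 2] (mod p)}) * real p ^ 2"
      by (simp only: sum.inter_filter[symmetric] finite_atLeastLessThan_int sum_constant)
    hence "(\<Sum>z\<in>?P. (if [z ^ 2 = y ^ 2] (mod p) then real p ^ 2 else 0) + 1) =
        real (card {z\<in>?P. [z ^ 2 = y ^ 2] (mod p)}) * real p ^ 2 + real p"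
      by (simp only: sum.distrib) simp
    also have "\<dots> \<le> 2 * real p ^ 2 + real p ^ 2"
      using card_sqrt_mod_prime_le[OF prime_p odd_p, of "y ^ 2"] odd_p
      by (intro add_mono mult_right_mono) (simp_all only: of_nat_le_iff, simp_all add: power2_eq_square)
    finally show "(\<Sum>z\<in>?P. (if [z ^ 2 = y ^ 2] (mod p) then real p ^ 2 else 0) + 1) \<le> 3 * real p ^ 2"
      by simp
  qed
  finally show ?thesis by (simp add: power2_eq_square power3_eq_cube)
qed

end

subsection \<open>Van der Corput differencing\<close>

lemma sum_square_le_card_mult:
  fixes f :: "'a \<Rightarrow> real"
  shows "(\<Sum>x\<in>X. f x)\<^sup>2 \<le> real (card X) * (\<Sum>x\<in>X. (f x)\<^sup>2)"
  using Cauchy_Schwarz_ineq_sum[of "\<lambda>_. 1" f X] by simp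

text \<open>The sum is averaged over its translates by h * s with 0 <= h < H. These do not change u,
  which can therefore be pulled out and removed by Cauchy-Schwarz, leaving correlations of w alone.
  Since w vanishes off the interval, there are no boundary terms.\<close>

lemma van_der_Corput_shift:
  fixes w u :: "int \<Rightarrow> real" and N s :: int and L H :: nat
  assumes "s > 0" "H > 0" "int H * s \<le> int L"
    and u: "periodic_mod s u" "\<And>x. \<bar>u x\<bar> \<le> 1"
    and w: "\<And>m. m \<notin> {N..<N + int L} \<Longrightarrow> w m = 0"
  shows "(\<Sum>m\<in>{N..<N + int L}. u m * w m)\<^sup>2 \<le>
    2 * real L / real H ^ 2 * (\<Sum>h\<in>{0..<int H}. \<Sum>k\<in>{0..<int H}.
      \<Sum>m\<in>{N..<N + int L}. w m * w (m + (k - h) * s))"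
proof -
  let ?J = "{N..<N + int L}" and ?H = "{0..<int H}"
  \<comment> \<open>The window is extended to the left so that it contains the interval translated
    by each -h * s; its length is at most 2 * L.\<close>
  define J' where "J' = {N - int H * s..<N + int L}"
  define S where "S = (\<Sum>m\<in>?J. u m * w m)"
  have shift: "(\<Sum>m\<in>J'. f (m + h * s)) = (\<Sum>m\<in>?J. f m)"
    if h: "h \<in> ?H" and f: "\<And>m. m \<notin> ?J \<Longrightarrow> f m = 0" for f :: "int \<Rightarrow> real" and h
  proof -
    have hs: "0 \<le> h * s" "h * s \<le> int H * s" using h assms(1) by simp_all
    have "(\<Sum>m\<in>J'. f (m + h * s)) = (\<Sum>m\<in>{N - int H * s + h * s..<N + int L + h * s}. f m)"
      unfolding J'_def
      by (rule sum.reindex_bij_witness[of _ "\<lambda>m. m - h * s" "\<lambda>m. m + h * s"]) auto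
    also have "\<dots> = (\<Sum>m\<in>?J. f m)"
      using hs f by (intro sum.mono_neutral_right) auto
    finally show ?thesis .
  qed
  have uper: "u (m + h * s) = u m" for m h
    by (rule periodic_modD[OF u(1)]) (simp add: Cong.cong_def)
  have "real H * S = (\<Sum>h\<in>?H. \<Sum>m\<in>J'. u (m + h * s) * w (m + h * s))"
  proof -
    have "(\<Sum>m\<in>J'. u (m + h * s) * w (m + h * s)) = S" if "h \<in> ?H" for h
      unfolding S_def by (rule shift[OF that, of "\<lambda>m. u m * w m"]) (simp add: w)
    thus ?thesis by simp
  qed
  also have "\<dots> = (\<Sum>m\<in>J'. u m * (\<Sum>h\<in>?H. w (m + h * s)))"
    by (subst sum.swap) (simp add: uper sum_distrib_left)
  finally have "(real H * S)\<^sup>2 \<le> (\<Sum>m\<in>J'. (u m)\<^sup>2) * (\<Sum>m\<in>J'. (\<Sum>h\<in>?H. w (m + h * s))\<^sup>2)"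
    by (simp only:) (rule Cauchy_Schwarz_ineq_sum)
  also have "\<dots> \<le> (2 * real L) * (\<Sum>m\<in>J'. (\<Sum>h\<in>?H. w (m + h * s))\<^sup>2)"
  proof (rule mult_right_mono)
    have "(\<Sum>m\<in>J'. (u m)\<^sup>2) \<le> (\<Sum>m\<in>J'. 1)"
      using u(2) by (intro sum_mono) (simp add: abs_square_le_1)
    also have "\<dots> = real (nat (int L + int H * s))" by (simp add: J'_def)
    also have "\<dots> \<le> 2 * real L"
      using assms(3) by simp
    finally show "(\<Sum>m\<in>J'. (u m)\<^sup>2) \<le> 2 * real L" .
  qed (simp add: sum_nonneg)
  also have "(\<Sum>m\<in>J'. (\<Sum>h\<in>?H. w (m + h * s))\<^sup>2) =
      (\<Sum>m\<in>J'. \<Sum>hk\<in>?H \<times> ?H. w (m + fst hk * s) * w (m + snd hk * s))"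
    by (simp only: square_sum_eq_sum_pairs)
  also have "\<dots> = (\<Sum>hk\<in>?H \<times> ?H. \<Sum>m\<in>J'. w (m + fst hk * s) * w (m + snd hk * s))"
    by (rule sum.swap)
  also have "\<dots> = (\<Sum>h\<in>?H. \<Sum>k\<in>?H. \<Sum>m\<in>J'. w (m + h * s) * w (m + k * s))"
    by (rule sum_sum_eq_sum_pairs[symmetric])
  also have "\<dots> = (\<Sum>h\<in>?H. \<Sum>k\<in>?H. \<Sum>m\<in>?J. w m * w (m + (k - h) * s))"
  proof (intro sum.cong[OF refl])
    fix h k assume "h \<in> ?H"
    from shift[OF this, of "\<lambda>m. w m * w (m + (k - h) * s)"]
    show "(\<Sum>m\<in>J'. w (m + h * s) * w (m + k * s)) = (\<Sum>m\<in>?J. w m * w (m + (k - h) * s))"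
      by (simp add: w algebra_simps)
  qed
  finally show ?thesis
    using assms(2) by (simp add: S_def[symmetric] power_mult_distrib field_simps)
qed

text \<open>For fixed h the numbers (k - h) * s meet each residue modulo n at most 2 * H / n times,
  as s is a unit modulo n and H covers at least one period.\<close>

lemma sum_differences_le:
  fixes F :: "int \<Rightarrow> real" and n s :: int and H :: nat
  assumes "n > 0" "periodic_mod n F" "\<And>x. 0 \<le> F x" "n \<le> int H" "coprime s n"
  shows "(\<Sum>h\<in>{0..<int H}. \<Sum>k\<in>{0..<int H}. F ((k - h) * s)) \<le> 2 * real H ^ 2 / real_of_int n * complete_sum n F"
proof -
  have "(\<Sum>k\<in>{0..<int H}. F ((k - h) * s)) \<le> 2 * real H / real_of_int n * complete_sum n F" for h
  proof -
    let ?F = "\<lambda>k. F (s * k + - (h * s))"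
    have "(\<Sum>k\<in>{0..<0 + int H}. ?F k) \<le> 2 * real H / real_of_int n * complete_sum n ?F"
      using assms by (intro sum_nonneg_periodic_le periodic_mod_comp_affine) auto
    also have "complete_sum n ?F = complete_sum n F"
      using assms by (intro complete_sum_affine)
    finally show ?thesis by (simp add: algebra_simps)
  qed
  hence "(\<Sum>h\<in>{0..<int H}. \<Sum>k\<in>{0..<int H}. F ((k - h) * s)) \<le>
      (\<Sum>h\<in>{0..<int H}. 2 * real H / real_of_int n * complete_sum n F)"
    by (intro sum_mono)
  thus ?thesis by (simp add: power2_eq_square algebra_simps)
qed

lemma Int_translates_interval:
  fixes N a b :: int and L :: nat
  obtains N' L' where "L' \<le> L"
    "{m\<in>{N..<N + int L}. m + a \<in> {N..<N + int L} \<and> m + b \<in> {N..<N + int L} \<and> m + a + b \<in> {N..<N + int L}} =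
      {N'..<N' + int L'}"
proof -
  define N' where "N' = max (max N (N - a)) (max (N - b) (N - a - b))"
  define M' where "M' = min (min (N + int L) (N + int L - a)) (min (N + int L - b) (N + int L - a - b))"
  show ?thesis
  proof
    have "N \<le> N'" "M' \<le> N + int L" unfolding N'_def M'_def by (meson max.cobounded1 min.cobounded1 order.trans)+
    thus "nat (M' - N') \<le> L" by simp
    show "{m\<in>{N..<N + int L}. m + a \<in> {N..<N + int L} \<and> m + b \<in> {N..<N + int L} \<and> m + a + b \<in> {N..<N + int L}} =
      {N'..<N' + int (nat (M' - N'))}"
    proof -
      have "N' \<le> x \<longleftrightarrow> N \<le> x \<and> N \<le> x + a \<and> N \<le> x + b \<and> N \<le> x + a + b" for x
        by (simp only: N'_def max.bounded_iff diff_le_eq ac_simps)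
      moreover have "x < M' \<longleftrightarrow> x < N + int L \<and> x + a < N + int L \<and> x + b < N + int L \<and> x + a + b < N + int L" for x
        by (simp only: M'_def min_less_iff_conj less_diff_eq ac_simps)
      moreover have "{N'..<N' + int (nat (M' - N'))} = {N'..<M'}" by auto
      ultimately show ?thesis by auto
    qed
  qed
qed

text \<open>The four cutoffs leave a shorter interval. On it the summand has period s * g, and its
  complete sum splits into a factor modulo s, bounded trivially by s, and the corner sum of G. The
  last term accounts for the incomplete period.\<close>

lemma sum_four_shifts_le:
  fixes u G w :: "int \<Rightarrow> real" and N s g a b :: int and L :: nat
  assumes "s > 0" "g > 0" "coprime s g"
    and u: "periodic_mod s u" "\<And>x. \<bar>u x\<bar> \<le> 1"
    and G: "periodic_mod g G" "\<And>x. \<bar>G x\<bar> \<le> 1"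
  defines "w \<equiv> (\<lambda>m. if m \<in> {N..<N + int L} then u m * G m else 0)"
  shows "\<bar>\<Sum>m\<in>{N..<N + int L}. w m * w (m + a) * w (m + b) * w (m + a + b)\<bar> \<le>
    real L / real_of_int g * \<bar>corner_sum g G a b\<bar> + real_of_int (s * g)"
proof -
  let ?J = "{N..<N + int L}"
  define U where "U m = u m * u (m + a) * u (m + b) * u (m + a + b)" for m
  define K where "K m = G m * G (m + a) * G (m + b) * G (m + a + b)" for m
  have perU: "periodic_mod s U"
    unfolding U_def[abs_def] using periodic_mod_comp_affine[OF u(1), of 1]
    by (intro periodic_mod_mult u) (simp_all add: add.assoc)
  have perK: "periodic_mod g K"
    unfolding K_def[abs_def] using periodic_mod_comp_affine[OF G(1), of 1]
    by (intro periodic_mod_mult G) (simp_all add: add.assoc)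
  have bU: "\<bar>U m\<bar> \<le> 1" for m unfolding U_def abs_mult by (intro mult_le_one u) simp_all
  have bK: "\<bar>K m\<bar> \<le> 1" for m unfolding K_def abs_mult by (intro mult_le_one G) simp_all
  obtain N' L' where L': "L' \<le> L" and
    J': "{m\<in>?J. m + a \<in> ?J \<and> m + b \<in> ?J \<and> m + a + b \<in> ?J} = {N'..<N' + int L'}"
    by (rule Int_translates_interval)
  have "(\<Sum>m\<in>?J. w m * w (m + a) * w (m + b) * w (m + a + b)) =
      (\<Sum>m\<in>?J. if m + a \<in> ?J \<and> m + b \<in> ?J \<and> m + a + b \<in> ?J then U m * K m else 0)"
    by (intro sum.cong refl) (simp add: w_def U_def K_def)
  also have "\<dots> = (\<Sum>m\<in>{N'..<N' + int L'}. U m * K m)"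
    by (simp only: sum.inter_filter[symmetric] finite_atLeastLessThan_int J')
  also have "\<bar>\<dots>\<bar> \<le> real L' / real_of_int (s * g) * \<bar>complete_sum (s * g) (\<lambda>m. U m * K m)\<bar> + real_of_int (s * g)"
  proof (rule abs_sum_interval_periodic_le)
    show "periodic_mod (s * g) (\<lambda>m. U m * K m)"
      by (intro periodic_mod_mult periodic_mod_dvd[OF perU] periodic_mod_dvd[OF perK]) simp_all
    show "\<bar>U m * K m\<bar> \<le> 1" for m unfolding abs_mult by (intro mult_le_one bU bK) simp
  qed (use assms(1,2) in simp)
  finally have "\<bar>\<Sum>m\<in>?J. w m * w (m + a) * w (m + b) * w (m + a + b)\<bar> \<le>
      real L' / real_of_int (s * g) * \<bar>complete_sum (s * g) (\<lambda>m. U m * K m)\<bar> + real_of_int (s * g)" .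
  also have "complete_sum (s * g) (\<lambda>m. U m * K m) = complete_sum s U * corner_sum g G a b"
    unfolding corner_sum_def K_def[symmetric, abs_def]
    by (rule complete_sum_mult_coprime[OF assms(1-3) perU perK])
  also have "real L' / real_of_int (s * g) * \<bar>complete_sum s U * corner_sum g G a b\<bar> \<le>
      real L / real_of_int (s * g) * (real_of_int s * \<bar>corner_sum g G a b\<bar>)"
  proof -
    have "\<bar>complete_sum s U\<bar> \<le> (\<Sum>x\<in>{0..<s}. 1)"
      unfolding complete_sum_def using bU by (intro order.trans[OF sum_abs] sum_mono)
    hence "\<bar>complete_sum s U\<bar> \<le> real_of_int s" using assms(1) by simp
    thus ?thesis unfolding abs_mult
      using L' assms(1,2) by (intro mult_mono divide_right_mono mult_right_mono) auto
  qed
  finally show ?thesis using assms(1) by simp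
qed

lemma four_fold_sum_affine:
  fixes f :: "'a \<Rightarrow> 'a \<Rightarrow> 'a \<Rightarrow> 'a \<Rightarrow> real"
  shows "(\<Sum>h\<in>A. \<Sum>k\<in>A. c * (\<Sum>h'\<in>A. \<Sum>k'\<in>A. d * f h k h' k' + e)) =
    c * (d * (\<Sum>h\<in>A. \<Sum>k\<in>A. \<Sum>h'\<in>A. \<Sum>k'\<in>A. f h k h' k') + real (card A) ^ 4 * e)"
  by (simp add: sum.distrib sum_distrib_left[symmetric] power_numeral_reduce distrib_left)

text \<open>Differencing by multiples of s1 removes u1; differencing the resulting correlations by
  multiples of s2 removes u2. Each step squares the sum, hence the fourth power. The corner sums of
  G then occur averaged over both shifts, and Cauchy-Schwarz reduces the average to the second
  moment.\<close>

lemma sum_four_factors_le: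
  fixes u1 u2 u3 G :: "int \<Rightarrow> real" and N s1 s2 s3 g :: int and L :: nat
  assumes pos: "s1 > 0" "s2 > 0" "s3 > 0" "g > 0"
    and cop: "coprime s1 g" "coprime s2 g" "coprime s3 g"
    and len: "g * s1 \<le> int L" "g * s2 \<le> int L"
    and per: "periodic_mod s1 u1" "periodic_mod s2 u2" "periodic_mod s3 u3" "periodic_mod g G"
    and bd: "\<And>x. \<bar>u1 x\<bar> \<le> 1" "\<And>x. \<bar>u2 x\<bar> \<le> 1" "\<And>x. \<bar>u3 x\<bar> \<le> 1" "\<And>x. \<bar>G x\<bar> \<le> 1"
  shows "(\<Sum>m\<in>{N..<N + int L}. u1 m * (u2 m * (u3 m * G m))) ^ 4 \<le>
    8 * real L ^ 4 * (4 * sqrt (corner_moment g G) / real_of_int g ^ 2) + 8 * real L ^ 3 * real_of_int (s3 * g)"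
proof -
  let ?J = "{N..<N + int L}"
  \<comment> \<open>With g shifts in each step, the differences (k - h) * s1 and (k' - h') * s2 run
    evenly through the residues modulo g.\<close>
  define H where "H = nat g"
  let ?H = "{0..<int H}"
  have H: "H > 0" "int H = g" using pos by (simp_all add: H_def)
  define w where "w = (\<lambda>m. if m \<in> ?J then u3 m * G m else 0)"
  define w1 where "w1 m = u2 m * w m" for m
  define S where "S = (\<Sum>m\<in>?J. u1 m * w1 m)"
  define T where "T a = (\<Sum>m\<in>?J. w1 m * w1 (m + a))" for a
  define C where "C a b = \<bar>corner_sum g G a b\<bar>" for a b
  define R where "R a b = (\<Sum>m\<in>?J. w m * w (m + a) * w (m + b) * w (m + a + b))" for a b
  have perC: "periodic_mod g (\<lambda>b. C a b)" "periodic_mod g (\<lambda>a. C a b)" for a b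
    using periodic_corner_sum[OF per(4)] unfolding C_def periodic_mod_def by metis+
  have R_le: "R a b \<le> real L / g * C a b + real_of_int (s3 * g)" for a b
    using sum_four_shifts_le[OF pos(3,4) cop(3) per(3) bd(3) per(4) bd(4), of N L a b]
    by (simp add: R_def w_def C_def)
  have step2: "(T a)\<^sup>2 \<le> 2 * real L / real H ^ 2 * (\<Sum>h\<in>?H. \<Sum>k\<in>?H. R a ((k - h) * s2))" for a
  proof -
    have "(\<Sum>m\<in>?J. (u2 m * u2 (m + a)) * (w m * w (m + a)))\<^sup>2 \<le> 2 * real L / real H ^ 2 * (\<Sum>h\<in>?H. \<Sum>k\<in>?H.
      \<Sum>m\<in>?J. (w m * w (m + a)) * (w (m + (k - h) * s2) * w (m + (k - h) * s2 + a)))"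
    proof (rule van_der_Corput_shift[OF pos(2) H(1)])
      show "int H * s2 \<le> int L" using len H by simp
      show "periodic_mod s2 (\<lambda>m. u2 m * u2 (m + a))"
        using periodic_mod_comp_affine[OF per(2), of 1 a] by (intro periodic_mod_mult per) simp
      show "\<bar>u2 x * u2 (x + a)\<bar> \<le> 1" for x unfolding abs_mult by (intro mult_le_one bd) simp
    qed (auto simp: w_def)
    thus ?thesis by (simp add: T_def R_def w1_def mult_ac add_ac)
  qed
  have CC: "(\<Sum>h\<in>?H. \<Sum>k\<in>?H. \<Sum>h'\<in>?H. \<Sum>k'\<in>?H. C ((k - h) * s1) ((k' - h') * s2)) \<le>
     4 * real H ^ 2 * (real_of_int g * sqrt (corner_moment g G))"
  proof -
    have "(\<Sum>h\<in>?H. \<Sum>k\<in>?H. \<Sum>h'\<in>?H. \<Sum>k'\<in>?H. C ((k - h) * s1) ((k' - h') * s2)) \<le>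
       (\<Sum>h\<in>?H. \<Sum>k\<in>?H. 2 * real H ^ 2 / g * complete_sum g (\<lambda>b. C ((k - h) * s1) b))"
      using pos cop perC H by (intro sum_mono sum_differences_le) (auto simp: C_def)
    also have "\<dots> \<le> 2 * real H ^ 2 / g * complete_sum g (\<lambda>a. 2 * real H ^ 2 / g * complete_sum g (\<lambda>b. C a b))"
    proof (rule sum_differences_le[OF pos(4) _ _ _ cop(1)])
      show "periodic_mod g (\<lambda>a. 2 * real H ^ 2 / g * complete_sum g (\<lambda>b. C a b))"
        unfolding periodic_mod_def
      proof (intro allI impI)
        fix x y :: int assume "[x = y] (mod g)"
        hence "C x b = C y b" for b by (rule periodic_modD[OF perC(2)])
        thus "2 * real H ^ 2 / g * complete_sum g (\<lambda>b. C x b) = 2 * real H ^ 2 / g * complete_sum g (\<lambda>b. C y b)"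
          by simp
      qed
      show "0 \<le> 2 * real H ^ 2 / g * complete_sum g (\<lambda>b. C a b)" for a
        using pos unfolding complete_sum_def C_def by (intro mult_nonneg_nonneg sum_nonneg) auto
    qed (use H in simp)
    also have "\<dots> = 4 * real H ^ 2 * (complete_sum g (\<lambda>a. complete_sum g (\<lambda>b. C a b)))"
    proof -
      define Z where "Z = complete_sum g (\<lambda>a. complete_sum g (\<lambda>b. C a b))"
      have "complete_sum g (\<lambda>a. 2 * real H ^ 2 / g * complete_sum g (\<lambda>b. C a b)) = 2 * real H ^ 2 / g * Z"
        unfolding Z_def by (simp add: complete_sum_def sum_distrib_left)
      moreover have "2 * real H ^ 2 / g * (2 * real H ^ 2 / g * Z) = 4 * real H ^ 2 * Z"
      proof -
        have "real H = real_of_int g" using H(2) by (metis of_int_of_nat_eq)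
        thus ?thesis using pos by (simp add: power2_eq_square)
      qed
      ultimately show ?thesis by (simp only: Z_def)
    qed
    also have "\<dots> \<le> 4 * real H ^ 2 * (real_of_int g * sqrt (corner_moment g G))"
    proof (rule mult_left_mono)
      let ?X = "{0..<g} \<times> {0..<g}"
      have "(complete_sum g (\<lambda>a. complete_sum g (\<lambda>b. C a b)))\<^sup>2 = (\<Sum>x\<in>?X. C (fst x) (snd x))\<^sup>2"
        unfolding complete_sum_def sum_sum_eq_sum_pairs ..
      also have "\<dots> \<le> real (card ?X) * (\<Sum>x\<in>?X. (C (fst x) (snd x))\<^sup>2)"
        by (rule sum_square_le_card_mult)
      also have "(\<Sum>x\<in>?X. (C (fst x) (snd x))\<^sup>2) = corner_moment g G"
        unfolding corner_moment_def complete_sum_def sum_sum_eq_sum_pairs C_def by simp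
      also have "real (card ?X) = (real_of_int g)\<^sup>2" using pos by (simp add: card_cartesian_product power2_eq_square)
      finally have "complete_sum g (\<lambda>a. complete_sum g (\<lambda>b. C a b)) \<le> sqrt ((real_of_int g)\<^sup>2 * corner_moment g G)"
        by (rule real_le_rsqrt)
      thus "complete_sum g (\<lambda>a. complete_sum g (\<lambda>b. C a b)) \<le> real_of_int g * sqrt (corner_moment g G)"
        using pos by (simp add: real_sqrt_mult)
    qed simp
    finally show ?thesis .
  qed
  have "S\<^sup>2 \<le> 2 * real L / real H ^ 2 * (\<Sum>h\<in>?H. \<Sum>k\<in>?H. T ((k - h) * s1))"
    unfolding S_def T_def
    by (rule van_der_Corput_shift[OF pos(1) H(1)]) (use len H per bd in \<open>auto simp: w1_def w_def\<close>)
  hence "(S\<^sup>2)\<^sup>2 \<le> (2 * real L / real H ^ 2 * (\<Sum>h\<in>?H. \<Sum>k\<in>?H. T ((k - h) * s1)))\<^sup>2"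
    by (intro power_mono) auto
  also have "\<dots> = (2 * real L / real H ^ 2)\<^sup>2 * (\<Sum>x\<in>?H \<times> ?H. T ((snd x - fst x) * s1))\<^sup>2"
    by (simp only: power_mult_distrib sum_sum_eq_sum_pairs)
  also have "\<dots> \<le> (2 * real L / real H ^ 2)\<^sup>2 * (real (card (?H \<times> ?H)) * (\<Sum>x\<in>?H \<times> ?H. (T ((snd x - fst x) * s1))\<^sup>2))"
    by (intro mult_left_mono sum_square_le_card_mult) simp
  also have "\<dots> = 4 * real L ^ 2 / real H ^ 2 * (\<Sum>h\<in>?H. \<Sum>k\<in>?H. (T ((k - h) * s1))\<^sup>2)"
  proof -
    have "real (card (?H \<times> ?H)) = real H ^ 2" by (simp add: card_cartesian_product power2_eq_square)
    thus ?thesis unfolding sum_sum_eq_sum_pairs using H(1)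
      by (simp only:) (simp add: power2_eq_square)
  qed
  also have "\<dots> \<le> 4 * real L ^ 2 / real H ^ 2 * (\<Sum>h\<in>?H. \<Sum>k\<in>?H.
      2 * real L / real H ^ 2 * (\<Sum>h'\<in>?H. \<Sum>k'\<in>?H. real L / g * C ((k - h) * s1) ((k' - h') * s2) + real_of_int (s3 * g)))"
    by (intro mult_left_mono sum_mono order.trans[OF step2] R_le) auto
  also have "\<dots> = 8 * real L ^ 3 / real H ^ 4 * (real L / g *
      (\<Sum>h\<in>?H. \<Sum>k\<in>?H. \<Sum>h'\<in>?H. \<Sum>k'\<in>?H. C ((k - h) * s1) ((k' - h') * s2)) + real H ^ 4 * real_of_int (s3 * g))"
    unfolding four_fold_sum_affine by (simp add: field_simps power_numeral_reduce)
  also have "\<dots> \<le> 8 * real L ^ 3 / real H ^ 4 * (real L / g *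
      (4 * real H ^ 2 * (real_of_int g * sqrt (corner_moment g G))) + real H ^ 4 * real_of_int (s3 * g))"
    using pos by (intro mult_left_mono add_mono CC) auto
  also have "\<dots> = 8 * real L ^ 4 * (4 * sqrt (corner_moment g G) / real_of_int g ^ 2) + 8 * real L ^ 3 * real_of_int (s3 * g)"
  proof -
    have "real H = real_of_int g" using H(2) by (metis of_int_of_nat_eq)
    thus ?thesis using pos by (simp add: field_simps power_numeral_reduce)
  qed
  also have "(S\<^sup>2)\<^sup>2 = S ^ 4" by simp
  also have "S = (\<Sum>m\<in>?J. u1 m * (u2 m * (u3 m * G m)))"
    by (simp add: S_def w1_def w_def)
  finally show ?thesis .
qed

declare of_nat_prod [simp del]

subsection \<open>Character sums to smooth moduli\<close>

text \<open>Factors are added one at a time until Y is reached; the last one overshoots by a factor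
  of at most B. This is how smoothness of the modulus yields divisors of prescribed size.\<close>

lemma exists_subset_prod_between:
  fixes P :: "nat set" and B Y :: real
  assumes "finite P" "\<And>p. p \<in> P \<Longrightarrow> real p \<le> B" "B \<ge> 1" "Y \<ge> 1"
  shows "\<exists>A\<subseteq>P. real (\<Prod>A) \<le> Y * B \<and> (A = P \<or> Y \<le> real (\<Prod>A))"
  using assms(1,2)
proof (induction P)
  case empty
  have "1 * 1 \<le> Y * B" using assms(3,4) by (intro mult_mono) auto
  thus ?case by auto
next
  case (insert p P)
  then obtain A where A: "A \<subseteq> P" "real (\<Prod>A) \<le> Y * B" "A = P \<or> Y \<le> real (\<Prod>A)" by auto
  show ?case
  proof (cases "Y \<le> real (\<Prod>A)")
    case True
    thus ?thesis using A by blast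
  next
    case False
    hence "A = P" "real (\<Prod>P) \<le> Y" using A by auto
    hence "real p * real (\<Prod>P) \<le> B * Y" using insert.prems[of p] assms(3) by (intro mult_mono) auto
    hence "real (\<Prod>(insert p P)) \<le> Y * B"
      using insert.hyps by (simp add: mult.commute)
    thus ?thesis by blast
  qed
qed

text \<open>For a set of odd primes this is the Jacobi symbol modulo \<open>\<Prod>P\<close>.
  Indexing by the set turns factorisations of the modulus into partitions of
  \<open>P\<close>.\<close>

definition chi :: "nat set \<Rightarrow> int \<Rightarrow> real" where
  "chi P x = (\<Prod>p\<in>P. leg p x)"

lemma abs_chi_le: "\<bar>chi P x\<bar> \<le> 1"
  unfolding chi_def abs_prod by (intro prod_le_1) (simp add: abs_leg_le)

lemma chi_Un_disjoint: "finite P \<Longrightarrow> finite Q \<Longrightarrow> P \<inter> Q = {} \<Longrightarrow> chi (P \<union> Q) x = chi P x * chi Q x"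
  unfolding chi_def by (rule prod.union_disjoint)

lemma periodic_mod_chi: "finite P \<Longrightarrow> periodic_mod (int (\<Prod>P)) (chi P)"
proof -
  assume P: "finite P"
  have "leg p x = leg p y" if "p \<in> P" "[x = y] (mod int (\<Prod>P))" for p x y
  proof (rule periodic_modD[OF periodic_mod_leg])
    have "p dvd \<Prod>P" using that(1) P by (rule dvd_prodI[rotated])
    thus "[x = y] (mod int p)" using that(2) by (meson cong_dvd_modulus of_nat_dvd_iff)
  qed
  thus ?thesis unfolding periodic_mod_def chi_def by (auto intro: prod.cong)
qed

lemma chi_mult:
  assumes "\<And>p. p \<in> P \<Longrightarrow> prime p \<and> p > 2"
  shows "chi P (x * y) = chi P x * chi P y"
  unfolding chi_def prod.distrib[symmetric] using assms by (intro prod.cong refl leg_mult) auto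

lemma coprime_prod_primes_disjoint:
  assumes "finite P" "finite Q" "P \<inter> Q = {}" "\<And>p. p \<in> P \<union> Q \<Longrightarrow> prime (p :: nat)"
  shows "coprime (int (\<Prod>P)) (int (\<Prod>Q))"
  unfolding coprime_int_iff using assms
  by (intro prod_coprime_left prod_coprime_right primes_coprime) auto

lemma prod_primes_pos:
  assumes "\<And>p. p \<in> P \<Longrightarrow> prime (p :: nat)"
  shows "\<Prod>P > 0"
  using assms by (intro prod_pos) (auto simp: prime_gt_0_nat)

lemma complete_sum_chi:
  assumes "finite P" "P \<noteq> {}" "\<And>p. p \<in> P \<Longrightarrow> prime p \<and> p > 2"
  shows "complete_sum (int (\<Prod>P)) (chi P) = 0"
proof -
  obtain p where p: "p \<in> P" using assms(2) by auto
  let ?Q = "P - {p}"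
  have P: "P = insert p ?Q" and fin: "finite ?Q" using p assms(1) by auto
  have "complete_sum (int p * int (\<Prod>?Q)) (\<lambda>x. leg p x * chi ?Q x) =
      complete_sum (int p) (leg p) * complete_sum (int (\<Prod>?Q)) (chi ?Q)"
  proof (rule complete_sum_mult_coprime)
    show "coprime (int p) (int (\<Prod>?Q))"
      using coprime_prod_primes_disjoint[of "{p}" ?Q] assms p by auto
    show "int (\<Prod>?Q) > 0" "int p > 0" using prod_primes_pos[of ?Q] assms p by (auto simp: prime_gt_0_nat)
  qed (use fin in \<open>simp_all add: periodic_mod_leg periodic_mod_chi\<close>)
  moreover have "complete_sum (int p) (leg p) = 0" using assms(3)[OF p] by (intro complete_sum_leg) auto
  moreover have "chi P = (\<lambda>x. leg p x * chi ?Q x)"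
    unfolding chi_def using p assms(1) by (simp add: prod.remove[of P p])
  moreover have "int (\<Prod>P) = int p * int (\<Prod>?Q)"
    using p assms(1) by (simp add: prod.remove[of P p])
  ultimately show ?thesis by simp
qed

text \<open>The splitting over coprime moduli is applied in turn to the variables x, b and a; after
  each summation the result is again a product of periodic functions.\<close>

lemma corner_moment_mult_coprime:
  assumes "m > 0" "n > 0" "coprime m n" "periodic_mod m F" "periodic_mod n G"
  shows "corner_moment (m * n) (\<lambda>x. F x * G x) = corner_moment m F * corner_moment n G"
proof -
  have *: "corner_sum (m * n) (\<lambda>x. F x * G x) a b = corner_sum m F a b * corner_sum n G a b" for a b
  proof -
    let ?F = "\<lambda>x. F x * F (x + a) * F (x + b) * F (x + a + b)"
      and ?G = "\<lambda>x. G x * G (x + a) * G (x + b) * G (x + a + b)"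
    have "complete_sum (m * n) (\<lambda>x. ?F x * ?G x) = complete_sum m ?F * complete_sum n ?G"
      using periodic_mod_comp_affine[OF assms(4), of 1] periodic_mod_comp_affine[OF assms(5), of 1]
      by (intro complete_sum_mult_coprime[OF assms(1-3)] periodic_mod_mult assms)
         (simp_all add: add.assoc)
    thus ?thesis by (simp add: corner_sum_def mult_ac)
  qed
  have sq: "periodic_mod k (\<lambda>x. (h x)\<^sup>2)" if "periodic_mod k h" for k and h :: "int \<Rightarrow> real"
    using periodic_mod_mult[OF that that] by (simp add: power2_eq_square)
  have **: "complete_sum (m * n) (\<lambda>b. (corner_sum (m * n) (\<lambda>x. F x * G x) a b)\<^sup>2) =
      complete_sum m (\<lambda>b. (corner_sum m F a b)\<^sup>2) * complete_sum n (\<lambda>b. (corner_sum n G a b)\<^sup>2)" for a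
    unfolding * power_mult_distrib
    by (intro complete_sum_mult_coprime[OF assms(1-3)] sq periodic_corner_sum assms)
  have per: "periodic_mod k (\<lambda>a. complete_sum k (\<lambda>b. (corner_sum k H a b)\<^sup>2))"
    if "periodic_mod k H" for k H
    unfolding periodic_mod_def
  proof (intro allI impI)
    fix x y assume "[x = y] (mod k)"
    hence "corner_sum k H x b = corner_sum k H y b" for b
      using periodic_modD[OF periodic_corner_sum(1)[OF that]] by blast
    thus "complete_sum k (\<lambda>b. (corner_sum k H x b)\<^sup>2) = complete_sum k (\<lambda>b. (corner_sum k H y b)\<^sup>2)" by simp
  qed
  show ?thesis
    unfolding corner_moment_def ** by (intro complete_sum_mult_coprime[OF assms(1-3)] per assms)
qed

lemma corner_moment_nonneg: "0 \<le> corner_moment n F"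
  unfolding corner_moment_def complete_sum_def by (intro sum_nonneg) auto

lemma corner_moment_chi_le:
  assumes "finite P" "\<And>p. p \<in> P \<Longrightarrow> prime p \<and> p > 2"
  shows "corner_moment (int (\<Prod>P)) (chi P) \<le> 12 ^ card P * real (\<Prod>P) ^ 3"
  using assms
proof (induction P)
  case empty
  show ?case by (simp add: corner_moment_def corner_sum_def chi_def complete_sum_def)
next
  case (insert p P)
  have "corner_moment (int p * int (\<Prod>P)) (\<lambda>x. leg p x * chi P x) =
      corner_moment (int p) (leg p) * corner_moment (int (\<Prod>P)) (chi P)"
  proof (rule corner_moment_mult_coprime)
    show "coprime (int p) (int (\<Prod>P))"
      using coprime_prod_primes_disjoint[of "{p}" P] insert by auto
    show "int (\<Prod>P) > 0" "int p > 0" using prod_primes_pos[of P] insert by (auto simp: prime_gt_0_nat)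
  qed (use insert in \<open>simp_all add: periodic_mod_leg periodic_mod_chi\<close>)
  also have "\<dots> \<le> (12 * real p ^ 3) * (12 ^ card P * real (\<Prod>P) ^ 3)"
    using insert by (intro mult_mono corner_moment_leg_le corner_moment_nonneg) auto
  also have "(\<lambda>x. leg p x * chi P x) = chi (insert p P)"
    unfolding chi_def using insert by (simp add: fun_eq_iff)
  also have "int p * int (\<Prod>P) = int (\<Prod>(insert p P))" using insert by simp
  finally show ?case using insert by (simp add: power_mult_distrib mult_ac)
qed

text \<open>
  To be read with \<open>z = Q\<^bsup>1/1000\<^esup>\<close>, which keeps all exponents integral. The point is that
  \<open>3 * 334 + 10 \<ge> 1000\<close> while \<open>344 + 20 < 373\<close>.
\<close>

lemma sum_chi_interval_le:
  fixes z :: real and N :: int and L :: nat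
  assumes "finite P" "P \<noteq> {}" "\<And>p. p \<in> P \<Longrightarrow> prime p \<and> p > 2 \<and> real p \<le> z ^ 10"
    and z: "z \<ge> 1" "real (\<Prod>P) \<le> z ^ 1000" "z ^ 373 \<le> real L"
  shows "\<bar>\<Sum>m\<in>{N..<N + int L}. chi P m\<bar> \<le> 3 * 2 ^ card P * real L / z"
proof (cases "real (\<Prod>P) \<le> z ^ 370")
  case True
  have pos: "int (\<Prod>P) > 0" using prod_primes_pos[of P] assms(3) by simp
  have "\<bar>\<Sum>m\<in>{N..<N + int L}. chi P m\<bar> \<le> real_of_int (int (\<Prod>P))"
    using abs_sum_interval_periodic_le[OF pos periodic_mod_chi[OF assms(1)] abs_chi_le, of N L]
      complete_sum_chi[OF assms(1,2)] assms(3) by (simp)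
  also have "\<dots> \<le> z ^ 370" using True by simp
  also have "\<dots> \<le> z ^ 372" using z(1) by (intro power_increasing) auto
  also have "\<dots> = z ^ 373 / z" using z(1) by (simp add: power_numeral_reduce)
  also have "\<dots> \<le> real L / z" using z by (intro divide_right_mono) auto
  also have "\<dots> \<le> 3 * 2 ^ card P * real L / z"
  proof -
    have "(1::real) * 1 \<le> 3 * 2 ^ card P" by (intro mult_mono) auto
    from mult_right_mono[OF this, of "real L / z"] show ?thesis using z(1) by simp
  qed
  finally show ?thesis .
next
  case False
  have B: "z ^ 10 \<ge> 1" using z(1) by simp
  have mono: "z ^ i \<le> z ^ j" if "i \<le> j" for i j using z(1) that by (rule power_increasing[rotated])
  have pp: "prime p" if "p \<in> P" for p using assms(3) that by auto
  have pos: "real (\<Prod>A) > 0" if "A \<subseteq> P" for A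
    using prod_primes_pos[of A] pp that by auto
  have split: "real (\<Prod>A) = real (\<Prod>B) * real (\<Prod>(A - B))" if "A \<subseteq> P" "B \<subseteq> A" for A B
    using prod.subset_diff[OF that(2), of id] assms(1) that
    by (simp add: finite_subset[of A P] mult.commute)
  have sel: "\<exists>A\<subseteq>R. real (\<Prod>A) \<le> z ^ (i + 10) \<and> (A = R \<or> z ^ i \<le> real (\<Prod>A))" if "R \<subseteq> P" for R i
    using exists_subset_prod_between[of R "z ^ 10" "z ^ i"] B z(1) that assms(1,3)
    by (auto simp: power_add intro: finite_subset)
  \<comment> \<open>The lower bound z^10 on the modulus of \<open>G\<close> produces the saving, and
    the upper bound z^20 keeps the shifts within the length: 20 + 344 <= 373. The alternative
    \<open>G = P\<close> is ruled out by the size of \<open>\<Prod>P\<close>.\<close>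
  obtain G where G: "G \<subseteq> P" "real (\<Prod>G) \<le> z ^ 20" "G = P \<or> z ^ 10 \<le> real (\<Prod>G)"
    using sel[of P 10] by auto
  have G10: "z ^ 10 \<le> real (\<Prod>G)"
    using G False mono[of 20 370] by auto
  define R where "R = P - G"
  have R: "R \<subseteq> P" "real (\<Prod>R) \<le> z ^ 990"
  proof -
    have "z ^ 10 * real (\<Prod>R) \<le> real (\<Prod>G) * real (\<Prod>R)" using G10 by (intro mult_right_mono) auto
    also have "\<dots> = real (\<Prod>P)" using split[of P G] G by (simp add: R_def)
    also have "\<dots> \<le> z ^ 10 * z ^ 990" using z(2) by (simp add: power_add[symmetric])
    finally show "real (\<Prod>R) \<le> z ^ 990" by (rule mult_left_le_imp_le) (use z(1) in simp)
  qed (simp add: R_def)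
  have cut: "\<exists>A\<subseteq>R. real (\<Prod>A) \<le> z ^ 344 \<and> real (\<Prod>(R - A)) \<le> z ^ j"
    if RP: "R \<subseteq> P" "real (\<Prod>R) \<le> z ^ (334 + j)" for R j
  proof -
    obtain A where A: "A \<subseteq> R" "real (\<Prod>A) \<le> z ^ 344" "A = R \<or> z ^ 334 \<le> real (\<Prod>A)"
      using sel[OF RP(1), of 334] by auto
    have "real (\<Prod>(R - A)) \<le> z ^ j"
    proof (cases "A = R")
      case True
      thus ?thesis using z(1) by simp
    next
      case False
      hence "z ^ 334 * real (\<Prod>(R - A)) \<le> real (\<Prod>A) * real (\<Prod>(R - A))"
        using A by (intro mult_right_mono) auto
      also have "\<dots> \<le> z ^ 334 * z ^ j"
        using split[OF RP(1) A(1)] RP(2) by (simp add: power_add)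
      finally show ?thesis by (rule mult_left_le_imp_le) (use z(1) in simp)
    qed
    thus ?thesis using A by blast
  qed
  \<comment> \<open>990 = 334 + 334 + 322: each cut either uses up the whole set or removes at least
    z^334, overshooting by at most z^10.\<close>
  obtain A1 where A1: "A1 \<subseteq> R" "real (\<Prod>A1) \<le> z ^ 344" "real (\<Prod>(R - A1)) \<le> z ^ 656"
    using cut[of R 656] R by auto
  obtain A2 where A2: "A2 \<subseteq> R - A1" "real (\<Prod>A2) \<le> z ^ 344" "real (\<Prod>(R - A1 - A2)) \<le> z ^ 322"
    using cut[of "R - A1" 322] R A1 by auto
  define A3 where "A3 = R - A1 - A2"
  have sub: "A1 \<subseteq> P" "A2 \<subseteq> P" "A3 \<subseteq> P" "G \<subseteq> P" using A1 A2 R G by (auto simp: A3_def)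
  have fin: "finite A1" "finite A2" "finite A3" "finite G"
    using sub assms(1) by (auto intro: finite_subset)
  have disj: "A1 \<inter> (A2 \<union> (A3 \<union> G)) = {}" "A2 \<inter> (A3 \<union> G) = {}" "A3 \<inter> G = {}"
    using A1 A2 by (auto simp: A3_def R_def)
  have union: "P = A1 \<union> (A2 \<union> (A3 \<union> G))" using A1 A2 sub by (auto simp: A3_def R_def)
  have chiP: "chi P m = chi A1 m * (chi A2 m * (chi A3 m * chi G m))" for m
    unfolding union using fin disj by (subst chi_Un_disjoint, simp_all)+
  let ?g = "real (\<Prod>G)" and ?S = "\<Sum>m\<in>{N..<N + int L}. chi P m"
  have len: "int (\<Prod>G) * int (\<Prod>A) \<le> int L" if "real (\<Prod>A) \<le> z ^ 344" for A
  proof -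
    have "?g * real (\<Prod>A) \<le> z ^ 20 * z ^ 344" using G that z(1) by (intro mult_mono) auto
    also have "\<dots> \<le> z ^ 373" unfolding power_add[symmetric] by (rule mono) simp
    finally have "?g * real (\<Prod>A) \<le> real L" using z(3) by simp
    thus ?thesis by (metis of_nat_le_iff of_nat_mult)
  qed
  have "?S ^ 4 \<le> 8 * real L ^ 4 * (4 * sqrt (corner_moment (int (\<Prod>G)) (chi G)) / real_of_int (int (\<Prod>G)) ^ 2) +
      8 * real L ^ 3 * real_of_int (int (\<Prod>A3) * int (\<Prod>G))"
    unfolding chiP
  proof (rule sum_four_factors_le[where ?s1.0 = "int (\<Prod>A1)" and ?s2.0 = "int (\<Prod>A2)"])
    show "int (\<Prod>A1) > 0" "int (\<Prod>A2) > 0" "int (\<Prod>A3) > 0" "int (\<Prod>G) > 0"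
      using pos sub by (simp_all)
    show "coprime (int (\<Prod>A1)) (int (\<Prod>G))" "coprime (int (\<Prod>A2)) (int (\<Prod>G))" "coprime (int (\<Prod>A3)) (int (\<Prod>G))"
      using fin disj sub pp by (intro coprime_prod_primes_disjoint; blast)+
  qed (use len A1 A2 fin in \<open>simp_all add: abs_chi_le periodic_mod_chi\<close>)
  \<comment> \<open>The moment is about g^3 and g >= z^10, which saves z^5 over the trivial g^2. The
    base 12 is raised to 16 to have an exact square root.\<close>
  also have "sqrt (corner_moment (int (\<Prod>G)) (chi G)) \<le> 4 ^ card P * ?g ^ 2 / z ^ 5"
  proof -
    have "corner_moment (int (\<Prod>G)) (chi G) \<le> 12 ^ card G * ?g ^ 3"
      using fin assms(3) G(1) by (intro corner_moment_chi_le) auto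
    also have "\<dots> \<le> 16 ^ card P * ?g ^ 3"
    proof (rule mult_right_mono)
      have "(12::real) ^ card G \<le> 16 ^ card G" by (intro power_mono) auto
      also have "\<dots> \<le> 16 ^ card P" using G(1) assms(1) by (intro power_increasing card_mono) auto
      finally show "(12::real) ^ card G \<le> 16 ^ card P" .
    qed simp
    also have "\<dots> \<le> 16 ^ card P * (?g ^ 4 / z ^ 10)"
    proof (rule mult_left_mono)
      have "?g ^ 3 * z ^ 10 \<le> ?g ^ 3 * ?g" using G10 by (intro mult_left_mono) auto
      thus "?g ^ 3 \<le> ?g ^ 4 / z ^ 10" using z(1) by (simp add: pos_le_divide_eq power_numeral_reduce mult_ac)
    qed simp
    also have "\<dots> = (4 ^ card P * ?g ^ 2 / z ^ 5)\<^sup>2"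
    proof -
      have "(16::real) ^ card P = (4 ^ card P)\<^sup>2" by (simp add: power2_eq_square flip: power_mult_distrib)
      thus ?thesis by (simp add: power_divide power_mult_distrib power_mult[symmetric])
    qed
    finally show ?thesis using z(1) by (intro real_le_lsqrt) auto
  qed
  also have "real_of_int (int (\<Prod>A3) * int (\<Prod>G)) \<le> real L / z ^ 4"
  proof -
    have "real (\<Prod>A3) * ?g * z ^ 4 \<le> z ^ 322 * z ^ 20 * z ^ 4"
      using A2 G z(1) by (intro mult_mono) (auto simp: A3_def)
    also have "\<dots> \<le> z ^ 373" unfolding power_add[symmetric] by (rule mono) simp
    finally show ?thesis using z by (simp add: pos_le_divide_eq)
  qed
  finally have "?S ^ 4 \<le> 8 * real L ^ 4 * (4 * (4 ^ card P * ?g ^ 2 / z ^ 5) / real_of_int (int (\<Prod>G)) ^ 2) +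
      8 * real L ^ 3 * (real L / z ^ 4)" by (simp add: mult_left_mono divide_right_mono)
  also have "\<dots> = real L ^ 4 * (32 * 4 ^ card P / z ^ 5 + 8 / z ^ 4)"
    using pos[OF G(1)] z(1) by (simp add: field_simps power_numeral_reduce)
  \<comment> \<open>32 + 8 is rounded up to 81 = 3^4, so that together with 16 = 2^4 a perfect
    fourth power results.\<close>
  also have "\<dots> \<le> real L ^ 4 * (81 * 16 ^ card P / z ^ 4)"
  proof (rule mult_left_mono)
    have "32 * 4 ^ card P / z ^ 5 \<le> 32 * 16 ^ card P / z ^ 4"
      using z(1) mono[of 4 5] by (intro frac_le mult_left_mono power_mono) auto
    moreover have "8 / z ^ 4 \<le> 8 * 16 ^ card P / z ^ 4" using z(1) by (intro divide_right_mono) auto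
    moreover have "32 * 16 ^ card P / z ^ 4 + 8 * 16 ^ card P / z ^ 4 \<le> 81 * 16 ^ card P / z ^ 4"
      unfolding add_divide_distrib[symmetric] using z(1) by (intro divide_right_mono) auto
    ultimately show "32 * 4 ^ card P / z ^ 5 + 8 / z ^ 4 \<le> 81 * 16 ^ card P / z ^ 4" by linarith
  qed simp
  also have "\<dots> = (3 * 2 ^ card P * real L / z) ^ 4"
    by (simp add: power_divide power_mult_distrib power_mult[symmetric] mult.commute[of _ 4] power_mult)
  finally have "\<bar>?S\<bar> ^ 4 \<le> (3 * 2 ^ card P * real L / z) ^ 4" by (simp add: power_even_abs)
  thus ?thesis by (rule power_mono_iff[THEN iffD1, rotated 3]) (use z(1) in auto)
qed

subsection \<open>Divisors and square roots modulo an integer\<close>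

lemma card_divisors_prime_power_mult:
  assumes "prime (p :: nat)" "\<not> p dvd m" "m > 0"
  shows "card {d. d dvd p ^ e * m} \<le> (e + 1) * card {d. d dvd m}"
proof -
  have "{d. d dvd p ^ e * m} \<subseteq> (\<lambda>(i, d). p ^ i * d) ` ({..e} \<times> {d. d dvd m})"
  proof
    fix d assume "d \<in> {d. d dvd p ^ e * m}"
    hence "d dvd p ^ e * m" by simp
    then obtain a b where d: "d = a * b" "a dvd p ^ e" "b dvd m" by (rule dvd_productE) auto
    then obtain i where "i \<le> e" "a = p ^ i" using divides_primepow_nat[OF assms(1)] by auto
    thus "d \<in> (\<lambda>(i, d). p ^ i * d) ` ({..e} \<times> {d. d dvd m})" using d by force
  qed
  hence "card {d. d dvd p ^ e * m} \<le> card ((\<lambda>(i, d). p ^ i * d) ` ({..e} \<times> {d. d dvd m}))"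
    using assms(3) by (intro card_mono finite_imageI finite_cartesian_product) auto
  also have "\<dots> \<le> card ({..e} \<times> {d. d dvd m})"
    using assms(3) by (intro card_image_le finite_cartesian_product) auto
  finally show ?thesis by (simp add: card_cartesian_product)
qed

text \<open>This is 1 + y <= exp y at y = e * \<epsilon> * ln 2. It serves the primes p that are too
  small for p^\<epsilon> >= 2.\<close>

lemma Suc_le_const_powr:
  fixes \<epsilon> :: real
  assumes "\<epsilon> > 0" "x \<ge> 2"
  shows "real (e + 1) \<le> (1 + 1 / (\<epsilon> * ln 2)) * (x powr \<epsilon>) ^ e"
proof -
  have l2: "ln (2::real) > 0" by simp
  have "1 + real e * (\<epsilon> * ln 2) \<le> exp (real e * (\<epsilon> * ln 2))" by (rule exp_ge_add_one_self)
  also have "\<dots> = (2 powr \<epsilon>) ^ e" by (simp add: powr_def exp_of_nat_mult)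
  also have "\<dots> \<le> (x powr \<epsilon>) ^ e" using assms by (intro power_mono powr_mono2) auto
  finally have "(1 + 1 / (\<epsilon> * ln 2)) * (1 + real e * (\<epsilon> * ln 2)) \<le> (1 + 1 / (\<epsilon> * ln 2)) * (x powr \<epsilon>) ^ e"
    using assms by (intro mult_left_mono) auto
  moreover have "(1 + 1 / (\<epsilon> * ln 2)) * (1 + real e * (\<epsilon> * ln 2)) = 1 + real e + (1 / (\<epsilon> * ln 2) + real e * (\<epsilon> * ln 2))"
    using assms(1) l2 by (simp add: field_simps)
  moreover have "0 \<le> 1 / (\<epsilon> * ln 2) + real e * (\<epsilon> * ln 2)"
    using assms(1) l2 by (intro add_nonneg_nonneg mult_nonneg_nonneg divide_nonneg_nonneg) auto
  ultimately show ?thesis by simp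
qed

text \<open>Primes p >= B = 2^(1/\<epsilon>) satisfy e + 1 <= 2^e <= p^(\<epsilon> e) without a
  constant. Only the boundedly many primes below B cost a factor K each.\<close>

lemma card_divisors_bound:
  fixes \<epsilon> :: real
  assumes "\<epsilon> > 0"
  shows "\<exists>C\<ge>1. \<forall>n>0. real (card {d. d dvd n}) \<le> C * real n powr \<epsilon>"
proof -
  define K where "K = 1 + 1 / (\<epsilon> * ln 2)"
  define B where "B = 2 powr (1 / \<epsilon>)"
  have K: "K \<ge> 1" unfolding K_def using assms by simp
  define s where "s n = {p\<in>prime_factors n. real p < B}" for n :: nat
  have main: "n > 0 \<Longrightarrow> real (card {d. d dvd n}) \<le> K ^ card (s n) * real n powr \<epsilon>" for n
  proof (induction n rule: less_induct)
    case (less n)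
    show ?case
    proof (cases "n = 1")
      case True
      thus ?thesis by (simp add: s_def)
    next
      case False
      then obtain p where p: "prime p" "p dvd n" using prime_factor_nat by blast
      define e where "e = multiplicity p n"
      obtain m where m: "n = p ^ e * m" "\<not> p dvd m"
        using multiplicity_decompose'[of n p] less.prems prime_gt_1_nat[OF p(1)] unfolding e_def by auto
      have e: "e > 0" unfolding e_def using p less.prems by (simp add: prime_multiplicity_gt_zero_iff)
      have m0: "m > 0" using m less.prems by (cases "m = 0") auto
      have p2: "p \<ge> 2" using p by (simp add: prime_ge_2_nat)
      have "1 < p ^ e" using one_less_power[of p e] p2 e by linarith
      hence "m < n" using m m0 by simp
      have pf: "prime_factors n = insert p (prime_factors m)"
        unfolding m(1) using p e m0 by (auto simp: prime_factors_product prime_factors_power prime_prime_factors)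
      have pm: "p \<notin> prime_factors m" using m(2) by auto
      have card_s: "card (s n) = card (s m) + (if real p < B then 1 else 0)"
      proof -
        have "s n = (if real p < B then insert p (s m) else s m)" unfolding s_def pf by auto
        thus ?thesis using pm by (auto simp: s_def)
      qed
      have "real (card {d. d dvd n}) \<le> real ((e + 1) * card {d. d dvd m})"
        unfolding m(1) of_nat_le_iff by (rule card_divisors_prime_power_mult[OF p(1) m(2) m0])
      also have "\<dots> \<le> real (e + 1) * (K ^ card (s m) * real m powr \<epsilon>)"
        unfolding of_nat_mult by (intro mult_left_mono less.IH m0 \<open>m < n\<close>) auto
      also have "\<dots> \<le> K ^ (if real p < B then 1 else 0) * (real p powr \<epsilon>) ^ e * (K ^ card (s m) * real m powr \<epsilon>)"
      proof (rule mult_right_mono)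
        show "real (e + 1) \<le> K ^ (if real p < B then 1 else 0) * (real p powr \<epsilon>) ^ e"
      proof (cases "real p < B")
        case True
        thus ?thesis using Suc_le_const_powr[OF assms, of "real p" e] p2 by (simp add: K_def)
      next
        case False
        have "real (e + 1) \<le> 2 ^ e" by (metis Suc_eq_plus1 Suc_leI less_exp of_nat_le_iff of_nat_numeral of_nat_power)
        also have "2 = B powr \<epsilon>" using assms by (simp add: B_def powr_powr)
        also have "(B powr \<epsilon>) ^ e \<le> (real p powr \<epsilon>) ^ e"
          using False assms by (intro power_mono powr_mono2) (auto simp: B_def)
        finally show ?thesis using False by simp
      qed
      qed (use K in simp)
      also have "K ^ (if real p < B then 1 else 0) * (real p powr \<epsilon>) ^ e * (K ^ card (s m) * real m powr \<epsilon>) =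
          K ^ card (s n) * real n powr \<epsilon>"
      proof -
        have "(real p powr \<epsilon>) ^ e = (real p ^ e) powr \<epsilon>"
          using p2 by (simp add: powr_power powr_powr mult.commute flip: powr_realpow)
        thus ?thesis using card_s unfolding m(1) by (simp add: power_add powr_mult mult_ac)
      qed
      finally show ?thesis .
    qed
  qed
  show ?thesis
  proof (intro exI[of _ "K ^ nat \<lceil>B\<rceil>"] conjI allI impI)
    show "K ^ nat \<lceil>B\<rceil> \<ge> 1" using K by simp
    fix n :: nat assume n: "n > 0"
    have "s n \<subseteq> {..<nat \<lceil>B\<rceil>}" unfolding s_def by (auto simp: less_ceiling_iff zless_nat_eq_int_zless)
    hence "card (s n) \<le> nat \<lceil>B\<rceil>" using card_mono[of "{..<nat \<lceil>B\<rceil>}"] by fastforce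
    hence "K ^ card (s n) * real n powr \<epsilon> \<le> K ^ nat \<lceil>B\<rceil> * real n powr \<epsilon>"
      using K by (intro mult_right_mono power_increasing) auto
    thus "real (card {d. d dvd n}) \<le> K ^ nat \<lceil>B\<rceil> * real n powr \<epsilon>" using main[OF n] by linarith
  qed
qed

section \<open>Prime factors and square roots modulo an integer\<close>

lemma prod_prime_factors_dvd:
  assumes "n > 0" "P \<subseteq> prime_factors n"
  shows "\<Prod>P dvd (n :: nat)"
proof -
  have "\<Prod>P dvd \<Prod>(prime_factors n)" using assms(2) by (intro prod_dvd_prod_subset) auto
  also have "\<dots> dvd (\<Prod>p\<in>prime_factors n. p ^ multiplicity p n)"
    by (intro prod_dvd_prod) (auto simp: prime_factors_multiplicity)
  also have "\<dots> = n" using assms(1) by (rule prime_factorization_nat[symmetric])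
  finally show ?thesis .
qed

text \<open>The products over the subsets of P are distinct divisors of n.\<close>

lemma two_power_card_prime_factors_le:
  assumes "n > 0" "P \<subseteq> prime_factors n"
  shows "2 ^ card P \<le> card {d. d dvd (n :: nat)}"
proof -
  have fin: "finite P" using assms(2) by (rule finite_subset) simp
  have pp: "prime p" "p dvd n" if "p \<in> P" for p using assms(2) that by auto
  have "inj_on (\<lambda>A. \<Prod>A) (Pow P)"
  proof (rule inj_on_inverseI)
    fix A assume "A \<in> Pow P"
    hence A: "A \<subseteq> P" "finite A" using fin finite_subset by auto
    have "p dvd \<Prod>A \<longleftrightarrow> p \<in> A" if pP: "p \<in> P" for p
    proof
      assume "p dvd \<Prod>A"
      then obtain q where "q \<in> A" "p dvd q" using prime_dvd_prod_iff[OF A(2) pp(1)[OF pP], of id] by auto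
      thus "p \<in> A" using primes_dvd_imp_eq[of p q] pp A pP by blast
    qed (use A in \<open>auto intro: dvd_prodI\<close>)
    thus "{p\<in>P. p dvd \<Prod>A} = A" using A by auto
  qed
  moreover have "(\<lambda>A. \<Prod>A) ` Pow P \<subseteq> {d. d dvd n}"
  proof safe
    fix A assume "A \<subseteq> P"
    hence A: "A \<subseteq> P" "finite A" using fin finite_subset by auto
    show "\<Prod>A dvd n" using A(1) assms by (intro prod_prime_factors_dvd) auto
  qed
  ultimately have "card (Pow P) \<le> card {d. d dvd n}"
    using assms(1) by (intro card_inj_on_le[of "\<lambda>A. \<Prod>A"]) auto
  thus ?thesis using fin by (simp add: card_Pow)
qed

text \<open>For odd p not both A and B are divisible by p, as p does not divide 2 * y, so the whole
  power falls on one of them. For p = 2 and e > 0 both are even, with halves of opposite parity; the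
  factor 2 in the conclusion covers this case.\<close>

lemma prime_power_dvd_double:
  fixes A B y :: int
  assumes "prime p" "int p ^ e dvd A * B" "B - A = 2 * y" "\<not> int p dvd y"
  shows "int p ^ e dvd 2 * A \<or> int p ^ e dvd 2 * B"
proof (cases "p = 2 \<and> e > 0")
  case False
  show ?thesis
  proof (cases "e = 0")
    case e: False
    have p2: "\<not> int p dvd 2"
    proof
      assume "int p dvd 2"
      hence "int p \<le> 2" by (rule zdvd_imp_le) simp
      thus False using False e prime_ge_2_nat[OF assms(1)] by simp
    qed
    have "prime (int p)" using assms(1) by simp
    hence "\<not> int p dvd 2 * y" using p2 assms(4) by (simp add: prime_dvd_mult_iff)
    hence "\<not> (int p dvd A \<and> int p dvd B)" using assms(3) dvd_diff[of "int p" B A] by auto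
    hence "coprime (int p ^ e) A \<or> coprime (int p ^ e) B"
      using prime_imp_coprime[OF \<open>prime (int p)\<close>] coprime_power_left_iff by blast
    thus ?thesis using assms(2) by (auto simp: coprime_dvd_mult_left_iff coprime_dvd_mult_right_iff intro: dvd_mult)
  qed simp
next
  case True
  hence "2 dvd int p ^ e" by simp
  hence "even (A * B)" using assms(2) by (rule dvd_trans)
  moreover have "even (B - A)" unfolding assms(3) by simp
  ultimately have "even A" "even B" by auto
  then obtain a b where ab: "A = 2 * a" "B = 2 * b" by (auto elim!: evenE)
  hence "b - a = y" using assms(3) by simp
  hence "odd a \<or> odd b" using assms(4) True by auto
  hence "coprime ((2::int) ^ e) a \<or> coprime ((2::int) ^ e) b" by auto
  moreover have "(2::int) ^ e dvd a * (2 * B)" "(2::int) ^ e dvd b * (2 * A)"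
    using assms(2) True ab by (simp_all add: mult_ac)
  ultimately show ?thesis using True by (auto simp: coprime_dvd_mult_right_iff)
qed

lemma dvd_of_prime_powers_dvd:
  fixes x :: int
  assumes "n > 0" "\<And>p. p \<in> prime_factors n \<Longrightarrow> int p ^ multiplicity p n dvd x"
  shows "int n dvd x"
proof (cases "x = 0")
  case False
  have "n dvd nat \<bar>x\<bar>"
  proof (rule multiplicity_le_imp_dvd)
    fix p :: nat assume p: "prime p"
    show "multiplicity p n \<le> multiplicity p (nat \<bar>x\<bar>)"
    proof (cases "p dvd n")
      case True
      hence "int (p ^ multiplicity p n) dvd x" using assms p by (auto simp: prime_factors_dvd)
      hence "p ^ multiplicity p n dvd nat \<bar>x\<bar>" by (simp only: nat_abs_dvd_iff dvd_nat_abs_iff)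
      thus ?thesis using p False by (intro multiplicity_geI) auto
    qed (simp add: not_dvd_imp_multiplicity_0)
  qed (use assms in simp)
  thus ?thesis by (simp add: dvd_nat_abs_iff)
qed simp

text \<open>Fix one solution y and record for a solution x the primes whose full power divides 2 *
  (x - y); by \<open>prime_power_dvd_double\<close> the other prime powers divide 2 * (x + y). Two
  solutions with the same record satisfy n | 2 * (x - x0), which leaves three values in a range of
  length n. The factor 2 avoids a separate count for powers of 2.\<close>

lemma card_quadratic_congruence_le:
  fixes c m :: int and n :: nat
  assumes n: "n > 0" and m: "coprime m (int n)"
  shows "card {x\<in>{0..<int n}. [c * x ^ 2 = m] (mod int n)} \<le> 3 * 2 ^ card (prime_factors n)"
proof -
  define Z where "Z = {x\<in>{0..<int n}. [c * x ^ 2 = m] (mod int n)}"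
  have "card Z \<le> 3 * 2 ^ card (prime_factors n)"
  proof (cases "Z = {}")
    case False
    then obtain y where y: "y \<in> Z" by blast
    hence "[m = c * y ^ 2] (mod int n)" by (simp add: Z_def cong_sym)
    hence "coprime (c * y ^ 2) (int n)" using m by (rule cong_imp_coprime)
    hence cop: "coprime c (int n)" "coprime y (int n)" by (simp_all add: power2_eq_square)
    have py: "\<not> int p dvd y" if "p \<in> prime_factors n" for p
    proof
      assume "int p dvd y"
      moreover have "int p dvd int n" "prime p" using that by auto
      ultimately show False using cop(2) not_coprimeI[of "int p" y "int n"]
        by (simp add: prime_nat_iff)
    qed
    define S where "S x = {p\<in>prime_factors n. int p ^ multiplicity p n dvd 2 * (x - y)}" for x
    have notS: "int p ^ multiplicity p n dvd 2 * (x + y)" if "x \<in> Z" "p \<in> prime_factors n" "p \<notin> S x" for x p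
    proof -
      have "[c * x ^ 2 = c * y ^ 2] (mod int n)" using that(1) y by (simp add: Z_def Cong.cong_def)
      hence "[x ^ 2 = y ^ 2] (mod int n)" using cop(1) by (simp add: cong_mult_lcancel)
      hence "int n dvd (x - y) * (x + y)"
        by (simp add: cong_iff_dvd_diff power2_eq_square algebra_simps)
      moreover have "int p ^ multiplicity p n dvd int n"
        using multiplicity_dvd[of p n] by (simp flip: of_nat_power)
      ultimately have "int p ^ multiplicity p n dvd (x - y) * (x + y)" by (rule dvd_trans[rotated])
      from prime_power_dvd_double[OF _ this, of y] that(2,3) py show ?thesis
        by (auto simp: S_def)
    qed
    have fibre: "card {x\<in>Z. S x = T} \<le> 3" for T
    proof (cases "{x\<in>Z. S x = T} = {}")
      case False
      then obtain x0 where x0: "x0 \<in> Z" "S x0 = T" by blast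
      have "{x\<in>Z. S x = T} \<subseteq> {x0, x0 + int n div 2, x0 - int n div 2}"
      proof
        fix x assume "x \<in> {x\<in>Z. S x = T}"
        hence x: "x \<in> Z" "S x = T" by simp_all
        have "int n dvd 2 * (x - x0)"
        proof (rule dvd_of_prime_powers_dvd[OF n])
          fix p assume p: "p \<in> prime_factors n"
          show "int p ^ multiplicity p n dvd 2 * (x - x0)"
          proof (cases "p \<in> S x")
            case True
            hence "p \<in> S x0" using x0 x by simp
            with True have "int p ^ multiplicity p n dvd 2 * (x - y) - 2 * (x0 - y)"
              unfolding S_def by (intro dvd_diff) auto
            thus ?thesis by (simp add: algebra_simps)
          next
            case False
            hence "p \<notin> S x0" using x0 x by simp
            with False have "int p ^ multiplicity p n dvd 2 * (x + y) - 2 * (x0 + y)"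
              using x(1) x0(1) p by (intro dvd_diff notS)
            thus ?thesis by (simp add: algebra_simps)
          qed
        qed
        then obtain k where k: "2 * (x - x0) = int n * k" by (rule dvdE)
        have "\<bar>x - x0\<bar> < int n" using x(1) x0(1) by (auto simp: Z_def)
        moreover have "2 * \<bar>x - x0\<bar> = int n * \<bar>k\<bar>" using arg_cong[OF k, of abs] unfolding abs_mult by simp
        ultimately have "int n * \<bar>k\<bar> < int n * 2" by simp
        hence "\<bar>k\<bar> < 2" using n by simp
        hence "k = 0 \<or> k = 1 \<or> k = -1" by linarith
        thus "x \<in> {x0, x0 + int n div 2, x0 - int n div 2}" using k by auto
      qed
      hence "card {x\<in>Z. S x = T} \<le> card {x0, x0 + int n div 2, x0 - int n div 2}" by (intro card_mono) auto
      also have "\<dots> \<le> 3" by (simp add: card_insert_if)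
      finally show ?thesis .
    qed (simp only: card.empty)
    have "card Z = (\<Sum>T\<in>Pow (prime_factors n). card {x\<in>Z. S x = T})"
    proof -
      have "finite Z" unfolding Z_def by (rule finite_subset[of _ "{0..<int n}"]) auto
      moreover have "S ` Z \<subseteq> Pow (prime_factors n)" by (auto simp: S_def)
      ultimately show ?thesis
        using sum.group[of Z "Pow (prime_factors n)" S "\<lambda>_. 1 :: nat"] by simp
    qed
    also have "\<dots> \<le> (\<Sum>T\<in>Pow (prime_factors n). 3)" by (intro sum_mono fibre)
    finally show ?thesis by (simp add: card_Pow mult.commute)
  qed simp
  thus ?thesis by (simp only: Z_def)
qed

subsection \<open>Coprime solutions\<close>

text \<open>What remains of the problem after division by g = gcd(b^2, Q): it is used with n = Q /
  g, with c the squarefree part of g, and with X = M / g.\<close>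

definition coprime_solutions :: "nat \<Rightarrow> int \<Rightarrow> real \<Rightarrow> int set" where
  "coprime_solutions n c X = {x\<in>{0..<int n}. coprime x (int n) \<and>
     (\<exists>m. real_of_int \<bar>m\<bar> \<le> X \<and> [c * x ^ 2 = m] (mod int n))}"

definition represented :: "nat \<Rightarrow> int \<Rightarrow> real \<Rightarrow> int set" where
  "represented n c X = {m\<in>{- \<lfloor>X\<rfloor>..\<lfloor>X\<rfloor>}. coprime m (int n) \<and> (\<exists>x. [c * x ^ 2 = m] (mod int n))}"

lemma finite_represented [simp]: "finite (represented n c X)"
  unfolding represented_def by (rule finite_subset[of _ "{- \<lfloor>X\<rfloor>..\<lfloor>X\<rfloor>}"]) auto

lemma card_coprime_solutions_le:
  assumes n: "n > 0" and c: "coprime c (int n)"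
  shows "card (coprime_solutions n c X) \<le> 3 * 2 ^ card (prime_factors n) * card (represented n c X)"
proof -
  have "coprime_solutions n c X \<subseteq> (\<Union>m\<in>represented n c X. {x\<in>{0..<int n}. [c * x ^ 2 = m] (mod int n)})"
  proof
    fix x assume "x \<in> coprime_solutions n c X"
    then obtain m where x: "x \<in> {0..<int n}" "coprime x (int n)" and
      m: "real_of_int \<bar>m\<bar> \<le> X" "[c * x ^ 2 = m] (mod int n)"
      unfolding coprime_solutions_def by blast
    have "coprime (c * x ^ 2) (int n)" using c x(2) by (simp add: power2_eq_square)
    hence "coprime m (int n)" using m(2) cong_imp_coprime by blast
    moreover have "m \<in> {- \<lfloor>X\<rfloor>..\<lfloor>X\<rfloor>}" using m(1) by (simp add: abs_le_iff le_floor_iff minus_le_iff)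
    ultimately have "m \<in> represented n c X" using m(2) unfolding represented_def by blast
    thus "x \<in> (\<Union>m\<in>represented n c X. {x\<in>{0..<int n}. [c * x ^ 2 = m] (mod int n)})"
      using x(1) m(2) by blast
  qed
  hence "card (coprime_solutions n c X) \<le> card (\<Union>m\<in>represented n c X. {x\<in>{0..<int n}. [c * x ^ 2 = m] (mod int n)})"
    by (rule card_mono[rotated]) (auto intro: finite_subset[of _ "{0..<int n}"])
  also have "\<dots> \<le> (\<Sum>m\<in>represented n c X. card {x\<in>{0..<int n}. [c * x ^ 2 = m] (mod int n)})"
    by (rule card_UN_le) simp
  also have "\<dots> \<le> (\<Sum>m\<in>represented n c X. 3 * 2 ^ card (prime_factors n))"
    using n by (intro sum_mono card_quadratic_congruence_le) (simp_all add: represented_def)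
  finally show ?thesis by (simp add: mult_ac)
qed

text \<open>For X < 1 only m = 0 is left, which is not coprime to n > 1; this is why the bound has
  no additive constant. Otherwise 2 * X + 1 <= 3 * X.\<close>

lemma card_coprime_solutions_crude:
  assumes "n > 1" "coprime c (int n)" "X \<ge> 0"
  shows "real (card (coprime_solutions n c X)) \<le> 9 * 2 ^ card (prime_factors n) * X"
proof -
  have "real (card (represented n c X)) \<le> 3 * X"
  proof (cases "X < 1")
    case True
    hence "\<lfloor>X\<rfloor> = 0" using assms(3) by (simp add: floor_eq_iff)
    hence "represented n c X = {}" using assms(1) by (auto simp: represented_def)
    thus ?thesis using assms(3) by simp
  next
    case False
    have "card (represented n c X) \<le> card {- \<lfloor>X\<rfloor>..\<lfloor>X\<rfloor>}"
      unfolding represented_def by (intro card_mono) auto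
    hence "real (card (represented n c X)) \<le> real (nat (2 * \<lfloor>X\<rfloor> + 1))" by simp
    also have "\<dots> = 2 * real_of_int \<lfloor>X\<rfloor> + 1" using assms(3) by simp
    also have "\<dots> \<le> 3 * X" using False of_int_floor_le[of X] by linarith
    finally show ?thesis .
  qed
  hence *: "real (3 * 2 ^ card (prime_factors n)) * real (card (represented n c X)) \<le>
      real (3 * 2 ^ card (prime_factors n)) * (3 * X)" by (rule mult_left_mono) simp
  have "real (card (coprime_solutions n c X)) \<le> real (3 * 2 ^ card (prime_factors n) * card (represented n c X))"
    unfolding of_nat_le_iff using assms by (intro card_coprime_solutions_le) auto
  also note of_nat_mult
  also note *
  finally show ?thesis by simp
qed

text \<open>The factor at p is nonnegative because the Legendre symbol vanishes when p divides m.
  For a represented m it equals 2, since c * m is the square of c * x modulo p. The resulting 2^|P|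
  is what cancels the number of square roots in \<open>card_coprime_solutions_le\<close>.\<close>

lemma card_represented_le_sieve:
  assumes "n > 0" "P \<subseteq> prime_factors n" "\<And>p. p \<in> P \<Longrightarrow> p > 2"
  shows "2 ^ card P * real (card (represented n c X)) \<le>
    (\<Sum>m\<in>{- \<lfloor>X\<rfloor>..\<lfloor>X\<rfloor>}. \<Prod>p\<in>P. leg p c * leg p m + (1 - of_bool (int p dvd m)))"
    (is "_ \<le> (\<Sum>m\<in>_. ?f m)")
proof -
  have P: "prime p" "p > 2" "p dvd n" if "p \<in> P" for p using assms that by auto
  have nonneg: "?f m \<ge> 0" for m
  proof (intro prod_nonneg)
    fix p assume "p \<in> P"
    have "\<bar>leg p c * leg p m\<bar> \<le> 1" unfolding abs_mult by (intro mult_le_one abs_leg_le) simp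
    moreover have "leg p m = 0" if "int p dvd m" using that by (simp add: leg_eq_0_iff)
    ultimately show "0 \<le> leg p c * leg p m + (1 - of_bool (int p dvd m))" by (auto simp: abs_le_iff)
  qed
  have full: "?f m = 2 ^ card P" if m: "m \<in> represented n c X" for m
  proof -
    have "leg p c * leg p m + (1 - of_bool (int p dvd m)) = 2" if "p \<in> P" for p
    proof -
      note p = P[OF that]
      obtain x where x: "[c * x ^ 2 = m] (mod int n)" and cop: "coprime m (int n)"
        using m by (auto simp: represented_def)
      have pn: "int p dvd int n" using p by simp
      have pm: "\<not> int p dvd m"
      proof
        assume "int p dvd m"
        hence "is_unit (int p)" using cop pn by (intro coprime_common_divisor)
        thus False using p by simp
      qed
      have xp: "[c * x ^ 2 = m] (mod int p)" using x pn by (rule cong_dvd_modulus)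
      have pcx: "\<not> int p dvd c * x ^ 2" using cong_dvd_iff[OF xp] pm by simp
      have "[(c * x) ^ 2 = c * m] (mod int p)"
        using cong_mult[OF cong_refl[of c] xp] by (simp add: power2_eq_square mult_ac)
      moreover have "\<not> int p dvd c * m"
        using pm pcx p(1) by (auto simp: prime_dvd_mult_iff)
      ultimately have "leg p (c * m) = 1" by (rule leg_eq_1)
      thus ?thesis using pm leg_mult[OF p(1,2)] by simp
    qed
    hence "?f m = (\<Prod>p\<in>P. 2)" by (intro prod.cong refl)
    thus ?thesis by simp
  qed
  have "2 ^ card P * real (card (represented n c X)) = (\<Sum>m\<in>represented n c X. ?f m)"
    using full by simp
  also have "\<dots> \<le> (\<Sum>m\<in>{- \<lfloor>X\<rfloor>..\<lfloor>X\<rfloor>}. ?f m)"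
    using nonneg by (intro sum_mono2) (auto simp: represented_def)
  finally show ?thesis .
qed

section \<open>Expansion of the sieve weight into character sums\<close>

lemma of_bool_prod_primes_dvd:
  assumes "finite T" "\<And>p. p \<in> T \<Longrightarrow> prime (p :: nat)"
  shows "(\<Prod>p\<in>T. of_bool (int p dvd m)) = (of_bool (int (\<Prod>T) dvd m) :: real)"
  using assms
proof (induction T)
  case (insert p T)
  have "coprime (int p) (int (\<Prod>T))"
    using coprime_prod_primes_disjoint[of "{p}" T] insert by auto
  hence "int p * int (\<Prod>T) dvd m \<longleftrightarrow> int p dvd m \<and> int (\<Prod>T) dvd m"
    by (metis divides_mult dvd_mult_left dvd_mult_right)
  thus ?case using insert by simp
qed simp

lemma sum_chi_multiples:
  assumes "\<And>p. p \<in> S \<Longrightarrow> prime p \<and> p > 2" "e > 0" "K \<ge> 0"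
  shows "(\<Sum>m\<in>{-K..K}. chi S m * of_bool (e dvd m)) = chi S e * (\<Sum>m\<in>{-(K div e)..K div e}. chi S m)"
proof -
  have "(\<Sum>m\<in>{-K..K}. chi S m * of_bool (e dvd m)) = (\<Sum>m\<in>{m\<in>{-K..K}. e dvd m}. chi S m)"
    by (rule sum.mono_neutral_cong_right) auto
  also have "\<dots> = (\<Sum>m\<in>{-(K div e)..K div e}. chi S (e * m))"
  proof (rule sum.reindex_bij_witness[of _ "\<lambda>m. e * m" "\<lambda>m. m div e"])
    fix m assume m: "m \<in> {-(K div e)..K div e}"
    have "e * m \<le> e * (K div e)" "e * (- (K div e)) \<le> e * m" using m assms(2) by (intro mult_left_mono; simp)+
    moreover have "e * (K div e) \<le> K" using assms(2) by (metis mult.commute pos_mod_sign div_mult_mod_eq le_add_same_cancel1)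
    ultimately show "e * m \<in> {m\<in>{-K..K}. e dvd m}" by simp
  next
    fix m assume m: "m \<in> {m\<in>{-K..K}. e dvd m}"
    then obtain j where j: "m = e * j" by auto
    have "m div e \<le> K div e" "(-m) div e \<le> K div e" using m assms(2) by (auto intro!: zdiv_mono1)
    moreover have "m div e = j" "(-m) div e = -j"
      using assms(2) nonzero_mult_div_cancel_left[of e j] nonzero_mult_div_cancel_left[of e "-j"] by (simp_all add: j)
    ultimately show "m div e \<in> {-(K div e)..K div e}" by simp
  qed (use assms in auto)
  also have "\<dots> = chi S e * (\<Sum>m\<in>{-(K div e)..K div e}. chi S m)"
    using chi_mult[OF assms(1)] by (simp add: sum_distrib_left)
  finally show ?thesis .
qed

text \<open>
  Expanding the product over subsets \<open>S\<close> (characters) and \<open>T\<close> (Moebius inversion): the terms with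
  \<open>S = {}\<close> give the main term, all others are small by the character sum bound, or trivially if
  \<open>\<Prod>T\<close> is large.
\<close>

lemma sum_sieve_weight_le:
  fixes z X :: real
  assumes P: "finite P" "\<And>p. p \<in> P \<Longrightarrow> prime p \<and> p > 2 \<and> real p \<le> z ^ 10"
    and z: "z \<ge> 1" "real (\<Prod>P) \<le> z ^ 1000" "z ^ 374 \<le> X"
  shows "(\<Sum>m\<in>{- \<lfloor>X\<rfloor>..\<lfloor>X\<rfloor>}. \<Prod>p\<in>P. leg p c * leg p m + (1 - of_bool (int p dvd m))) \<le>
    2 * X * (\<Prod>p\<in>P. 1 - 1 / real p) + 10 * 8 ^ card P * X / z"
proof -
  define K where "K = \<lfloor>X\<rfloor>"
  define V where "V S T = (\<Sum>m\<in>{-(K div int (\<Prod>T))..K div int (\<Prod>T)}. chi S m)" for S T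
  have zX: "z \<le> X"
  proof -
    have "z ^ 1 \<le> z ^ 374" using z(1) by (intro power_increasing) auto
    thus ?thesis using z(3) by simp
  qed
  have K: "K \<ge> 0" unfolding K_def using zX z(1) by simp
  have fin: "finite S" if "S \<subseteq> P" for S using that P(1) finite_subset by blast
  have pp: "prime p" if "p \<in> P" for p using P(2) that by blast
  have pos: "\<Prod>T > 0" if "T \<subseteq> P" for T using prod_primes_pos[of T] pp that by blast
  have expand: "(\<Prod>p\<in>P. leg p c * leg p m + (1 - of_bool (int p dvd m))) =
      (\<Sum>S\<in>Pow P. \<Sum>T\<in>Pow (P - S). chi S c * (-1) ^ card T * (chi S m * of_bool (int (\<Prod>T) dvd m)))" for m
  proof -
    have "(\<Prod>p\<in>P. leg p c * leg p m + (1 - of_bool (int p dvd m))) =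
      (\<Sum>S\<in>Pow P. (\<Prod>p\<in>S. leg p c * leg p m) * (\<Prod>p\<in>P - S. 1 - of_bool (int p dvd m)))"
      by (rule prod_add[OF P(1)])
    also have "\<dots> = (\<Sum>S\<in>Pow P. \<Sum>T\<in>Pow (P - S). chi S c * (-1) ^ card T * (chi S m * of_bool (int (\<Prod>T) dvd m)))"
    proof (intro sum.cong refl)
      fix S assume S: "S \<in> Pow P"
      have "(\<Prod>p\<in>P - S. 1 - of_bool (int p dvd m) :: real) =
          (\<Sum>T\<in>Pow (P - S). (-1) ^ card T * (\<Prod>p\<in>T. of_bool (int p dvd m)) * (\<Prod>p\<in>P - S - T. 1))"
        by (rule prod_diff_conv_sum) (use P(1) in simp)
      also have "\<dots> = (\<Sum>T\<in>Pow (P - S). (-1) ^ card T * of_bool (int (\<Prod>T) dvd m))"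
      proof (intro sum.cong refl)
        fix T assume "T \<in> Pow (P - S)"
        hence T: "T \<subseteq> P" by blast
        have "(\<Prod>p\<in>T. of_bool (int p dvd m)) = (of_bool (int (\<Prod>T) dvd m) :: real)"
          using T pp by (intro of_bool_prod_primes_dvd fin) auto
        thus "(-1) ^ card T * (\<Prod>p\<in>T. of_bool (int p dvd m)) * (\<Prod>p\<in>P - S - T. 1) =
           (-1) ^ card T * (of_bool (int (\<Prod>T) dvd m) :: real)"
          by simp
      qed
      finally show "(\<Prod>p\<in>S. leg p c * leg p m) * (\<Prod>p\<in>P - S. 1 - of_bool (int p dvd m)) =
        (\<Sum>T\<in>Pow (P - S). chi S c * (-1) ^ card T * (chi S m * of_bool (int (\<Prod>T) dvd m)))"
        by (simp add: chi_def prod.distrib sum_distrib_left mult_ac)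
    qed
    finally show ?thesis .
  qed
  have "(\<Sum>m\<in>{-K..K}. \<Prod>p\<in>P. leg p c * leg p m + (1 - of_bool (int p dvd m))) =
      (\<Sum>S\<in>Pow P. \<Sum>T\<in>Pow (P - S). chi S c * (-1) ^ card T * (\<Sum>m\<in>{-K..K}. chi S m * of_bool (int (\<Prod>T) dvd m)))"
    unfolding expand sum_distrib_left
    by (subst sum.swap, intro sum.cong refl, subst sum.swap) (rule refl)
  also have "\<dots> = (\<Sum>S\<in>Pow P. \<Sum>T\<in>Pow (P - S). chi S c * (-1) ^ card T * (chi S (int (\<Prod>T)) * V S T))"
  proof (intro sum.cong refl arg_cong2[of _ _ _ _ "(*)"])
    fix S T assume "S \<in> Pow P" "T \<in> Pow (P - S)"
    hence "S \<subseteq> P" "T \<subseteq> P" by auto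
    thus "(\<Sum>m\<in>{-K..K}. chi S m * of_bool (int (\<Prod>T) dvd m)) = chi S (int (\<Prod>T)) * V S T"
      unfolding V_def using P(2) pos[of T] K by (intro sum_chi_multiples) auto
  qed
  also have "\<dots> = (\<Sum>T\<in>Pow P. (-1) ^ card T * V {} T) +
      (\<Sum>S\<in>Pow P - {{}}. \<Sum>T\<in>Pow (P - S). chi S c * (-1) ^ card T * (chi S (int (\<Prod>T)) * V S T))"
    using P(1) by (subst sum.remove[of _ "{}"]) (auto simp: chi_def)
  \<comment> \<open>The first 2^|P| collects the rounding errors of the main terms; 4^|P| bounds the
    number of pairs of subsets.\<close>
  also have "\<dots> \<le> (2 * X * (\<Prod>p\<in>P. 1 - 1 / real p) + 2 ^ card P) + 4 ^ card P * (9 * 2 ^ card P * X / z)"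
  proof (rule add_mono)
    \<comment> \<open>The symmetric interval has 2 \<lfloor>y\<rfloor> + 1 elements with y = X /
      \<Prod>T, which differs from 2 * y by at most 1.\<close>
    have V0: "\<bar>V {} T - 2 * X / real (\<Prod>T)\<bar> \<le> 1" if "T \<subseteq> P" for T
    proof -
      have kd: "K div int (\<Prod>T) = \<lfloor>X / real_of_int (int (\<Prod>T))\<rfloor>"
        unfolding K_def by (rule floor_divide_real_eq_div[symmetric]) simp
      have k0: "K div int (\<Prod>T) \<ge> 0" using K pos[OF that] by (simp add: pos_imp_zdiv_nonneg_iff)
      have "V {} T = real (nat (2 * (K div int (\<Prod>T)) + 1))" by (simp add: V_def chi_def)
      also have "\<dots> = 2 * real_of_int (K div int (\<Prod>T)) + 1" using k0 by simp
      finally have V: "V {} T = 2 * real_of_int \<lfloor>X / real (\<Prod>T)\<rfloor> + 1" by (simp add: kd)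
      have "real_of_int \<lfloor>X / real (\<Prod>T)\<rfloor> \<le> X / real (\<Prod>T)" "X / real (\<Prod>T) < real_of_int \<lfloor>X / real (\<Prod>T)\<rfloor> + 1"
        by linarith+
      moreover have "2 * X / real (\<Prod>T) = 2 * (X / real (\<Prod>T))" by simp
      ultimately show ?thesis unfolding V abs_le_iff by linarith
    qed
    have "(\<Sum>T\<in>Pow P. (-1) ^ card T * V {} T) \<le> (\<Sum>T\<in>Pow P. (-1) ^ card T * (2 * X / real (\<Prod>T)) + 1)"
    proof (intro sum_mono)
      fix T assume "T \<in> Pow P"
      hence "\<bar>(-1) ^ card T * (V {} T - 2 * X / real (\<Prod>T))\<bar> \<le> 1" using V0[of T] by (simp add: abs_mult)
      thus "(-1) ^ card T * V {} T \<le> (-1) ^ card T * (2 * X / real (\<Prod>T)) + 1"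
        unfolding right_diff_distrib abs_le_iff by linarith
    qed
    also have "\<dots> = 2 * X * (\<Sum>T\<in>Pow P. (-1) ^ card T * (1 / real (\<Prod>T))) + 2 ^ card P"
      using P(1) by (simp add: sum.distrib card_Pow sum_distrib_left mult_ac)
    also have "(\<Sum>T\<in>Pow P. (-1) ^ card T * (1 / real (\<Prod>T))) = (\<Prod>p\<in>P. 1 - 1 / real p)"
      unfolding prod_diff_conv_sum[OF P(1)] by (simp add: prod_dividef of_nat_prod)
    finally show "(\<Sum>T\<in>Pow P. (-1) ^ card T * V {} T) \<le> 2 * X * (\<Prod>p\<in>P. 1 - 1 / real p) + 2 ^ card P" .
  next
    have V1: "\<bar>V S T\<bar> \<le> 9 * 2 ^ card P * X / z" if S: "S \<subseteq> P" "S \<noteq> {}" and T: "T \<subseteq> P" for S T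
    proof -
      define k where "k = K div int (\<Prod>T)"
      define L where "L = nat (2 * k + 1)"
      have k: "k \<ge> 0" unfolding k_def using K pos[OF T] by (simp add: pos_imp_zdiv_nonneg_iff)
      have "{-k..k} = {-k..<-k + int L}" using k by (auto simp: L_def)
      hence V: "V S T = (\<Sum>m\<in>{-k..<-k + int L}. chi S m)" by (simp add: V_def k_def)
      have kd: "k = \<lfloor>X / real (\<Prod>T)\<rfloor>"
        unfolding K_def k_def using floor_divide_real_eq_div[of "int (\<Prod>T)" X] by simp
      have L: "real L = 2 * real_of_int k + 1" using k by (simp add: L_def)
      have kX: "real_of_int k \<le> X / real (\<Prod>T)" "X / real (\<Prod>T) < real_of_int k + 1"
        unfolding kd by linarith+
      have one: "(1::real) \<le> 2 ^ card P" by simp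
      show ?thesis
      proof (cases "real (\<Prod>T) \<le> z")
        \<comment> \<open>After division by \<Prod>T <= z the interval still has length at least
          z^373; this is why the hypothesis asks for z^374.\<close>
        case True
        have "z ^ 373 * z \<le> X" using z(3) by (simp add: power_numeral_reduce)
        hence "z ^ 373 \<le> X / z" using z(1) by (simp add: pos_le_divide_eq)
        also have "\<dots> \<le> X / real (\<Prod>T)" using True pos[OF T] zX z(1) by (intro divide_left_mono) auto
        finally have big: "z ^ 373 \<le> X / real (\<Prod>T)" .
        have "1 \<le> z ^ 373" using z(1) by simp
        hence "X / real (\<Prod>T) \<le> real L" "real L \<le> 3 * (X / real (\<Prod>T))" using kX big unfolding L by linarith+
        moreover have "X / real (\<Prod>T) \<le> X / 1" using zX z(1) pos[OF T] by (intro divide_left_mono) auto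
        ultimately have LX: "z ^ 373 \<le> real L" "real L \<le> 3 * X" using big by simp_all
        have "real (\<Prod>S) \<le> z ^ 1000"
        proof -
          have "\<Prod>S \<le> \<Prod>P" using S(1) P(1) pos[of P] by (intro dvd_imp_le prod_dvd_prod_subset) auto
          thus ?thesis using z(2) by linarith
        qed
        hence "\<bar>V S T\<bar> \<le> 3 * 2 ^ card S * real L / z"
          unfolding V using S fin[OF S(1)] P(2) z(1) LX(1) by (intro sum_chi_interval_le) auto
        also have "\<dots> \<le> 3 * 2 ^ card P * (3 * X) / z"
          using z(1) LX P(1) S(1) by (intro divide_right_mono mult_mono power_increasing card_mono) auto
        finally show ?thesis by simp
      next
        \<comment> \<open>The interval may be too short for the character sum bound, but it has at
          most 3 * X / z elements.\<close>
        case False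
        have "\<bar>V S T\<bar> \<le> (\<Sum>m\<in>{-k..<-k + int L}. 1)"
          unfolding V by (intro order.trans[OF sum_abs] sum_mono abs_chi_le)
        also have "\<dots> = real L" by simp
        also have "\<dots> \<le> 2 * (X / real (\<Prod>T)) + 1" using kX unfolding L by simp
        also have "\<dots> \<le> 2 * (X / z) + X / z"
          using False z(1) zX by (intro add_mono mult_left_mono divide_left_mono) (auto simp: pos_le_divide_eq)
        also have "\<dots> \<le> 9 * 2 ^ card P * (X / z)"
        proof -
          have "3 \<le> 9 * (2::real) ^ card P" using one by linarith
          hence "3 * (X / z) \<le> (9 * 2 ^ card P) * (X / z)" using zX z(1) by (intro mult_right_mono) auto
          thus ?thesis by simp
        qed
        finally show ?thesis by simp
      qed
    qed
    let ?E = "9 * 2 ^ card P * X / z"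
    have E: "?E \<ge> 0" using zX z(1) by simp
    have "(\<Sum>S\<in>Pow P - {{}}. \<Sum>T\<in>Pow (P - S). chi S c * (-1) ^ card T * (chi S (int (\<Prod>T)) * V S T)) \<le>
      (\<Sum>S\<in>Pow P - {{}}. \<Sum>T\<in>Pow (P - S). ?E)"
    proof (intro sum_mono)
      fix S T assume "S \<in> Pow P - {{}}" "T \<in> Pow (P - S)"
      hence "\<bar>V S T\<bar> \<le> ?E" using V1[of S T] by auto
      moreover have "\<bar>chi S c * (-1) ^ card T * (chi S (int (\<Prod>T)) * V S T)\<bar> \<le> 1 * 1 * (1 * \<bar>V S T\<bar>)"
        unfolding abs_mult by (intro mult_mono abs_chi_le mult_nonneg_nonneg) auto
      ultimately show "chi S c * (-1) ^ card T * (chi S (int (\<Prod>T)) * V S T) \<le> ?E" by linarith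
    qed
    also have "\<dots> \<le> (\<Sum>S\<in>Pow P. \<Sum>T\<in>Pow P. ?E)"
      using P(1) E by (intro order.trans[OF sum_mono sum_mono2] sum_mono2 sum_nonneg) auto
    also have "\<dots> = 4 ^ card P * ?E"
      using P(1) by (simp add: card_Pow power_mult_distrib[symmetric] mult.assoc[symmetric])
    finally show "(\<Sum>S\<in>Pow P - {{}}. \<Sum>T\<in>Pow (P - S). chi S c * (-1) ^ card T * (chi S (int (\<Prod>T)) * V S T)) \<le> 4 ^ card P * ?E" .
  qed
  also have "\<dots> \<le> 2 * X * (\<Prod>p\<in>P. 1 - 1 / real p) + 10 * 8 ^ card P * X / z"
  proof -
    have "(2::real) ^ card P * 1 \<le> 8 ^ card P * (X / z)"
      using zX z(1) by (intro mult_mono power_mono) (auto simp: pos_le_divide_eq)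
    moreover have "(4::real) ^ card P * (9 * 2 ^ card P * X / z) = 9 * (8 ^ card P * (X / z))"
    proof -
      have "(8::real) ^ card P = 4 ^ card P * 2 ^ card P" by (simp flip: power_mult_distrib)
      thus ?thesis by simp
    qed
    moreover have "10 * 8 ^ card P * X / z = 10 * (8 ^ card P * (X / z))" by simp
    ultimately show ?thesis by linarith
  qed
  finally show ?thesis by (simp only: K_def)
qed

lemma card_large_prime_factors_le:
  assumes "z \<ge> 1" "n > 0" "real n \<le> z ^ 1000"
  shows "card {p\<in>prime_factors n. z ^ 10 < real p} \<le> 100"
proof (rule ccontr)
  let ?W = "{p\<in>prime_factors n. z ^ 10 < real p}"
  assume "\<not> card ?W \<le> 100"
  hence W: "card ?W \<ge> 101" by simp
  hence "prime_factors n \<noteq> {}" by (metis (no_types, lifting) Collect_empty_eq card.empty empty_iff not_numeral_le_zero)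
  hence "n > 1" using assms(2) by (cases "n = 1") auto
  hence "z > 1" using assms(1,3) by (cases "z = 1") auto
  hence "z ^ 1000 < z ^ (10 * 101)" by (intro power_strict_increasing) auto
  also have "\<dots> = (z ^ 10) ^ 101" by (rule power_mult)
  also have "\<dots> \<le> (z ^ 10) ^ card ?W" using W assms(1) by (intro power_increasing) auto
  also have "\<dots> = (\<Prod>p\<in>?W. z ^ 10)" by simp
  also have "\<dots> \<le> (\<Prod>p\<in>?W. real p)" using assms(1) by (intro prod_mono) auto
  also have "\<dots> = real (\<Prod>?W)" by (simp add: of_nat_prod)
  also have "\<dots> \<le> real n"
  proof -
    have "\<Prod>?W \<le> n" using assms(2) by (intro dvd_imp_le prod_prime_factors_dvd) auto
    thus ?thesis by simp
  qed
  finally show False using assms(3) by simp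
qed

text \<open>The sieve uses the odd primes up to z^10. At most 101 prime factors are left out, the
  large ones and possibly 2. Each costs a factor 2 in the number of square roots and at most another
  2 in passing from the product of 1 - 1 / p over P to \<open>totient n / n\<close>. The constant
  2^210 exceeds 3 * 2^101 * 2^102.\<close>

lemma card_coprime_solutions_refined:
  assumes n: "n > 0" and c: "coprime c (int n)" and z: "z \<ge> 1" "real n \<le> z ^ 1000" "z ^ 374 \<le> X"
  shows "real (card (coprime_solutions n c X)) \<le>
    2 ^ 210 * (X * (real (totient n) / real n) + 8 ^ card (prime_factors n) * X / z)"
proof -
  define P where "P = {p\<in>prime_factors n. p > 2 \<and> real p \<le> z ^ 10}"
  define W where "W = {p\<in>prime_factors n. z ^ 10 < real p}"
  have P: "P \<subseteq> prime_factors n" "finite P" by (auto simp: P_def)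
  have X: "X \<ge> 0" using z(3) z(1) by (meson dual_order.trans one_le_power zero_le_one)
  have card_rest: "card (prime_factors n - P) \<le> 101"
  proof -
    have "prime_factors n - P \<subseteq> insert 2 W"
    proof
      fix p assume p: "p \<in> prime_factors n - P"
      hence "prime p" by auto
      hence "p \<ge> 2" by (rule prime_ge_2_nat)
      thus "p \<in> insert 2 W" using p by (auto simp: P_def W_def)
    qed
    hence "card (prime_factors n - P) \<le> card (insert 2 W)" by (intro card_mono) (auto simp: W_def)
    also have "\<dots> \<le> Suc (card W)" by (simp add: card_insert_if W_def)
    finally show ?thesis using card_large_prime_factors_le[OF z(1) n z(2)] by (simp add: W_def)
  qed
  have card_split: "card (prime_factors n) = card P + card (prime_factors n - P)"
    using P by (simp add: card_Diff_subset card_mono)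
  define R where "R = real (card (represented n c X))"
  define T where "T = X * (real (totient n) / real n)"
  define E where "E = 8 ^ card (prime_factors n) * X / z"
  have TE: "T \<ge> 0" "E \<ge> 0" using X z(1) by (auto simp: T_def E_def)
  have prod_le: "(\<Prod>p\<in>P. 1 - 1 / real p) \<le> 2 ^ 101 * (real (totient n) / real n)"
  proof -
    have "(\<Prod>p\<in>prime_factors n - P. 1 / 2 :: real) \<le> (\<Prod>p\<in>prime_factors n - P. 1 - 1 / real p)"
    proof (intro prod_mono conjI)
      fix p assume "p \<in> prime_factors n - P"
      hence "p \<ge> 2" by (auto intro: prime_ge_2_nat)
      thus "1 / 2 \<le> 1 - 1 / real p" by (simp add: field_simps)
    qed simp
    hence "(1 / 2 :: real) ^ card (prime_factors n - P) \<le> (\<Prod>p\<in>prime_factors n - P. 1 - 1 / real p)"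
      by (simp only: prod_constant)
    moreover have "(1 / 2 :: real) ^ 101 \<le> (1 / 2) ^ card (prime_factors n - P)"
      using card_rest by (intro power_decreasing) auto
    ultimately have "(1 / 2 :: real) ^ 101 \<le> (\<Prod>p\<in>prime_factors n - P. 1 - 1 / real p)"
      by (rule order.trans[rotated])
    hence "(1 / 2 :: real) ^ 101 * (\<Prod>p\<in>P. 1 - 1 / real p) \<le>
        (\<Prod>p\<in>prime_factors n - P. 1 - 1 / real p) * (\<Prod>p\<in>P. 1 - 1 / real p)"
    proof (rule mult_right_mono)
      show "0 \<le> (\<Prod>p\<in>P. 1 - 1 / real p)" by (intro prod_nonneg) (auto simp: P_def field_simps)
    qed
    also have "\<dots> = (\<Prod>p\<in>prime_factors n. 1 - 1 / real p)"
      using P by (intro prod.subset_diff[symmetric]) auto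
    also have "\<dots> = real (totient n) / real n" using totient_formula2[of n] n by simp
    finally show ?thesis by (simp add: power_divide field_simps)
  qed
  have "2 ^ card P * R \<le> 2 * X * (\<Prod>p\<in>P. 1 - 1 / real p) + 10 * 8 ^ card P * X / z"
    unfolding R_def
  proof (rule order.trans[OF card_represented_le_sieve sum_sieve_weight_le])
    show "real (\<Prod>P) \<le> z ^ 1000"
    proof -
      have "\<Prod>P \<le> n" using n P by (intro dvd_imp_le prod_prime_factors_dvd) auto
      thus ?thesis using z(2) by linarith
    qed
  qed (use n P z in \<open>auto simp: P_def\<close>)
  also have "\<dots> \<le> 2 * X * (2 ^ 101 * (real (totient n) / real n)) + 10 * 8 ^ card (prime_factors n) * X / z"
    using X z(1) P prod_le
    by (intro add_mono mult_left_mono divide_right_mono mult_right_mono power_increasing card_mono) auto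
  also have "\<dots> = 2 ^ 102 * T + 10 * E" by (simp add: T_def E_def)
  finally have R: "2 ^ card P * R \<le> 2 ^ 102 * T + 10 * E" .
  have "real (card (coprime_solutions n c X)) \<le> real (3 * 2 ^ card (prime_factors n) * card (represented n c X))"
    unfolding of_nat_le_iff by (rule card_coprime_solutions_le[OF n c])
  also have "\<dots> = 3 * 2 ^ card (prime_factors n - P) * (2 ^ card P * R)"
    unfolding card_split R_def by (simp add: power_add)
  also have "\<dots> \<le> 3 * 2 ^ 101 * (2 ^ 102 * T + 10 * E)"
    using R card_rest TE by (intro mult_mono power_increasing) (auto simp: R_def)
  also have "\<dots> \<le> 2 ^ 210 * (T + E)" using TE by simp
  finally show ?thesis by (simp add: T_def E_def)
qed

subsection \<open>Residues with small squares\<close>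

definition small_squares :: "nat \<Rightarrow> real \<Rightarrow> int set" where
  "small_squares Q M = {b\<in>{0..<int Q}. \<exists>m. real_of_int \<bar>m\<bar> \<le> M \<and> [b ^ 2 = m] (mod int Q)}"

definition gcd_class :: "nat \<Rightarrow> nat \<Rightarrow> int set" where
  "gcd_class Q g = {b\<in>{0..<int Q}. gcd (b ^ 2) (int Q) = int g}"

lemma card_periodic_subset:
  assumes "n > 0" "\<And>x y. [x = y] (mod int n) \<Longrightarrow> p x \<longleftrightarrow> p y"
  shows "card {x\<in>{0..<int (n * k)}. p x} = k * card {x\<in>{0..<int n}. p x}"
proof -
  have per: "periodic_mod (int n) (\<lambda>x. of_bool (p x) :: real)"
    unfolding periodic_mod_def using assms(2) by simp
  have cnt: "(\<Sum>x\<in>{0..<N}. of_bool (p x)) = real (card {x\<in>{0..<N}. p x})" for N :: int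
    by (simp add: sum.inter_filter[symmetric] of_bool_def)
  have "real (card {x\<in>{0..<int (n * k)}. p x}) = real (k * card {x\<in>{0..<int n}. p x})"
    using sum_interval_periodic[OF _ per, of 0 k] assms(1) cnt[of "int (n * k)"] cnt[of "int n"]
    by (simp add: complete_sum_def mult.commute)
  thus ?thesis by (simp only: of_nat_eq_iff)
qed

lemma card_coprime_residues:
  assumes "n > 0"
  shows "card {x\<in>{0..<int n}. coprime x (int n)} = totient n"
proof -
  have "bij_betw (\<lambda>k. int k mod int n) (totatives n) {x\<in>{0..<int n}. coprime x (int n)}"
  \<comment> \<open>\<open>totatives n\<close> uses the representatives 1 to n, so the residue 0
    corresponds to n; this matters only for n = 1.\<close>
  proof (rule bij_betwI[where g = "\<lambda>x. if x = 0 then n else nat x"])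
    show "(\<lambda>k. int k mod int n) \<in> totatives n \<rightarrow> {x\<in>{0..<int n}. coprime x (int n)}"
      using assms by (auto simp: totatives_def coprime_int_iff simp flip: of_nat_mod)
    show "(\<lambda>x. if x = 0 then n else nat x) \<in> {x\<in>{0..<int n}. coprime x (int n)} \<rightarrow> totatives n"
      using assms by (auto simp: totatives_def coprime_int_iff simp flip: coprime_int_iff)
    show "(if int x mod int n = 0 then n else nat (int x mod int n)) = x" if "x \<in> totatives n" for x
      using that by (cases "x = n") (auto simp: totatives_def simp flip: of_nat_mod)
    show "int (if y = 0 then n else nat y) mod int n = y" if "y \<in> {x\<in>{0..<int n}. coprime x (int n)}" for y
      using that by auto
  qed
  thus ?thesis unfolding totient_def by (simp add: bij_betw_same_card)
qed

lemma squarefree_dvd_of_dvd_square: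
  assumes "squarefree (m :: nat)" "m dvd j ^ 2"
  shows "m dvd j"
proof (cases "j = 0")
  case False
  have m0: "m \<noteq> 0" using assms(1) by (intro notI) simp
  show ?thesis
  proof (rule multiplicity_le_imp_dvd[OF m0])
    fix p :: nat assume p: "prime p"
    have "multiplicity p m \<le> 1" using assms(1) m0 p squarefree_factorial_semiring'' by blast
    moreover have "multiplicity p m = 0" if "\<not> p dvd m" using that by (rule not_dvd_imp_multiplicity_0)
    moreover have "multiplicity p j \<ge> 1" if "p dvd m"
    proof -
      have "p dvd j" using p that assms(2) prime_dvd_power by (metis dvd_trans)
      thus ?thesis using False p by (intro multiplicity_geI) auto
    qed
    ultimately show "multiplicity p m \<le> multiplicity p j" by (cases "p dvd m") auto
  qed
qed simp

context
  fixes Q g g1 k n :: nat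
  assumes Q: "Q > 0" and g: "g dvd Q"
    and g1_def: "g1 = squarefree_part g" and k_def: "k = square_part g" and n_def: "n = Q div g"
begin

lemma gcd_class_parameters:
  shows gk: "g = g1 * k ^ 2" and Qg: "Q = g * n" and pos: "g > 0" "n > 0" "k > 0" "g1 > 0"
proof -
  show "g = g1 * k ^ 2" unfolding g1_def k_def by (rule squarefree_decompose)
  show "Q = g * n" using g by (simp add: n_def)
  thus "g > 0" "n > 0" using Q by (auto intro: Nat.gr0I)
  thus "k > 0" "g1 > 0" by (auto simp: k_def g1_def simp flip: neq0_conv)
qed

text \<open>As g = g1 * k^2 with g1 squarefree, g divides b^2 iff g1 * k divides b. For b = g1 * k *
  b' one has b^2 = g * (g1 * b'^2), so the gcd equals g iff g1 * b'^2 is coprime to n. A nonempty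
  class thus forces g1 to be coprime to n.\<close>

lemma gcd_class_eq_image:
  assumes ne: "gcd_class Q g \<noteq> {}"
  shows "coprime (int g1) (int n)"
    and "gcd_class Q g = (\<lambda>b. int (g1 * k) * b) ` {b\<in>{0..<int (n * k)}. coprime b (int n)}"
proof -
  have dvd: "int (g1 * k) dvd b" if "int g dvd b ^ 2" for b
  proof -
    have "k ^ 2 dvd nat \<bar>b\<bar> ^ 2" "g1 * k ^ 2 dvd nat \<bar>b\<bar> ^ 2"
    proof -
      have "g dvd nat \<bar>b ^ 2\<bar>" using that by (simp only: dvd_nat_abs_iff)
      moreover have "nat \<bar>b ^ 2\<bar> = nat \<bar>b\<bar> ^ 2" by (simp only: power_abs nat_power_eq abs_ge_zero)
      ultimately have "g dvd nat \<bar>b\<bar> ^ 2" by (simp only:)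
      thus "g1 * k ^ 2 dvd nat \<bar>b\<bar> ^ 2" by (simp only: gk)
      thus "k ^ 2 dvd nat \<bar>b\<bar> ^ 2" by (rule dvd_mult_right)
    qed
    hence "k dvd nat \<bar>b\<bar>" by simp
    then obtain j where j: "nat \<bar>b\<bar> = k * j" by (rule dvdE)
    have "g1 * k ^ 2 dvd j ^ 2 * k ^ 2"
      using \<open>g1 * k ^ 2 dvd nat \<bar>b\<bar> ^ 2\<close> unfolding j by (simp add: power_mult_distrib mult.commute)
    hence "g1 dvd j ^ 2" using pos by simp
    moreover have "squarefree g1" using pos by (simp add: g1_def squarefree_squarefree_part)
    ultimately have "g1 dvd j" by (rule squarefree_dvd_of_dvd_square[rotated])
    hence "g1 * k dvd nat \<bar>b\<bar>" unfolding j by (simp add: mult.commute)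
    thus ?thesis by (simp only: dvd_nat_abs_iff)
  qed
  have gcd_eq: "gcd ((int (g1 * k) * b) ^ 2) (int Q) = int g * gcd (int g1 * b ^ 2) (int n)" for b
  proof -
    have "(int (g1 * k) * b) ^ 2 = int g * (int g1 * b ^ 2)" by (simp add: gk power2_eq_square mult_ac)
    moreover have "int Q = int g * int n" by (simp add: Qg)
    ultimately show ?thesis by (simp add: gcd_mult_left)
  qed
  have mem: "int (g1 * k) * b \<in> gcd_class Q g \<longleftrightarrow> b \<in> {0..<int (n * k)} \<and> coprime (int g1 * b ^ 2) (int n)" for b
  proof -
    have "int (g1 * k) * b \<in> {0..<int Q} \<longleftrightarrow> b \<in> {0..<int (n * k)}"
    proof -
      have "int Q = int (g1 * k) * int (n * k)" using Qg gk by (simp add: power2_eq_square mult_ac)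
      moreover have "int (g1 * k) > 0" using pos by simp
      ultimately show ?thesis by (simp only: atLeastLessThan_iff zero_le_mult_iff mult_less_cancel_left_pos) auto
    qed
    moreover have "gcd ((int (g1 * k) * b) ^ 2) (int Q) = int g \<longleftrightarrow> coprime (int g1 * b ^ 2) (int n)"
      unfolding gcd_eq coprime_iff_gcd_eq_1 using pos by simp
    ultimately show ?thesis by (simp only: gcd_class_def mem_Collect_eq)
  qed
  have ex: "\<exists>b'. b = int (g1 * k) * b'" if "b \<in> gcd_class Q g" for b
  proof -
    have "int g dvd b ^ 2" using that gcd_dvd1[of "b ^ 2" "int Q"] by (simp add: gcd_class_def)
    from dvd[OF this] show ?thesis by (auto elim!: dvdE)
  qed
  show cop: "coprime (int g1) (int n)"
  proof -
    obtain b where b: "b \<in> gcd_class Q g" using ne by blast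
    with ex obtain b' where "int (g1 * k) * b' \<in> gcd_class Q g" by blast
    hence "coprime (int g1 * b' ^ 2) (int n)" using mem by blast
    thus ?thesis by simp
  qed
  have "int (g1 * k) * b \<in> gcd_class Q g \<longleftrightarrow> b \<in> {b\<in>{0..<int (n * k)}. coprime b (int n)}" for b
    unfolding mem using cop by (auto simp: power2_eq_square)
  thus "gcd_class Q g = (\<lambda>b. int (g1 * k) * b) ` {b\<in>{0..<int (n * k)}. coprime b (int n)}"
    using ex by blast
qed

lemma card_gcd_class:
  assumes "gcd_class Q g \<noteq> {}"
  shows "card (gcd_class Q g) = k * totient n"
proof -
  have "card (gcd_class Q g) = card {b\<in>{0..<int (n * k)}. coprime b (int n)}"
    unfolding gcd_class_eq_image(2)[OF assms] using pos by (intro card_image inj_onI) simp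
  also have "\<dots> = k * card {b\<in>{0..<int n}. coprime b (int n)}"
    using pos by (intro card_periodic_subset) (auto dest: cong_imp_coprime cong_sym)
  finally show ?thesis using card_coprime_residues pos by simp
qed

text \<open>Since g divides b^2 and Q, it divides m, and b^2 = m modulo Q becomes g1 * b'^2 = m / g
  modulo n. This condition has period n, and b' runs over k periods.\<close>

lemma card_gcd_class_small_squares_le:
  assumes "gcd_class Q g \<noteq> {}"
  shows "card (gcd_class Q g \<inter> small_squares Q M) \<le> k * card (coprime_solutions n (int g1) (M / real g))"
proof -
  define p where "p b \<longleftrightarrow> coprime b (int n) \<and>
     (\<exists>m. real_of_int \<bar>m\<bar> \<le> M / real g \<and> [int g1 * b ^ 2 = m] (mod int n))" for b
  have per: "p x \<longleftrightarrow> p y" if "[x = y] (mod int n)" for x y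
  proof -
    have "coprime x (int n) \<longleftrightarrow> coprime y (int n)" using that cong_imp_coprime cong_sym by blast
    moreover have "[int g1 * x ^ 2 = int g1 * y ^ 2] (mod int n)"
      using that by (intro cong_mult cong_pow cong_refl)
    hence "[int g1 * x ^ 2 = m] (mod int n) \<longleftrightarrow> [int g1 * y ^ 2 = m] (mod int n)" for m
      by (simp only: Cong.cong_def)
    ultimately show ?thesis by (simp add: p_def)
  qed
  have fin: "finite {b\<in>{0..<int (n * k)}. p b}"
    by (rule finite_subset[of _ "{0..<int (n * k)}"]) auto
  have "gcd_class Q g \<inter> small_squares Q M \<subseteq> (\<lambda>b. int (g1 * k) * b) ` {b\<in>{0..<int (n * k)}. p b}"
  proof
    fix b assume b: "b \<in> gcd_class Q g \<inter> small_squares Q M"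
    then obtain b' where b': "b = int (g1 * k) * b'" "b' \<in> {0..<int (n * k)}" "coprime b' (int n)"
      using gcd_class_eq_image(2)[OF assms] by blast
    obtain m where m: "real_of_int \<bar>m\<bar> \<le> M" "[b ^ 2 = m] (mod int Q)"
      using b unfolding small_squares_def by blast
    have bsq: "b ^ 2 = int g * (int g1 * b' ^ 2)" unfolding b' by (simp add: gk power2_eq_square mult_ac)
    have "int g dvd int Q" using g by simp
    hence "[b ^ 2 = m] (mod int g)" using m(2) by (rule cong_dvd_modulus[rotated])
    moreover have "int g dvd b ^ 2" unfolding bsq by simp
    ultimately have "int g dvd m" by (simp add: cong_dvd_iff)
    then obtain m' where m': "m = int g * m'" by (rule dvdE)
    have "[int g * (int g1 * b' ^ 2) = int g * m'] (mod int g * int n)"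
      using m(2) unfolding bsq m' Qg by simp
    hence "int g * int n dvd int g * (int g1 * b' ^ 2 - m')"
      by (simp only: cong_iff_dvd_diff right_diff_distrib)
    hence "int n dvd int g1 * b' ^ 2 - m'"
      by (rule zdvd_mult_cancel) (use pos in simp)
    hence "[int g1 * b' ^ 2 = m'] (mod int n)" by (simp only: cong_iff_dvd_diff)
    moreover have "real_of_int \<bar>m'\<bar> \<le> M / real g"
      using m(1) pos unfolding m' by (simp add: abs_mult pos_le_divide_eq mult.commute)
    ultimately have "p b'" using b'(3) unfolding p_def by blast
    thus "b \<in> (\<lambda>b. int (g1 * k) * b) ` {b\<in>{0..<int (n * k)}. p b}" using b' by blast
  qed
  hence "card (gcd_class Q g \<inter> small_squares Q M) \<le> card ((\<lambda>b. int (g1 * k) * b) ` {b\<in>{0..<int (n * k)}. p b})"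
    by (rule card_mono[rotated]) (rule finite_imageI[OF fin])
  also have "\<dots> \<le> card {b\<in>{0..<int (n * k)}. p b}"
    by (rule card_image_le[OF fin])
  also have "\<dots> = k * card {b\<in>{0..<int n}. p b}" using pos per by (intro card_periodic_subset)
  also have "{b\<in>{0..<int n}. p b} = coprime_solutions n (int g1) (M / real g)"
    by (simp add: p_def coprime_solutions_def)
  finally show ?thesis .
qed

end

section \<open>Summation over the gcd classes\<close>

lemma finite_small_squares: "finite (small_squares Q M)"
  unfolding small_squares_def by (rule finite_subset[of _ "{0..<int Q}"]) auto

lemma sum_card_gcd_class:
  assumes "Q > 0"
  shows "(\<Sum>g | g dvd Q. card (gcd_class Q g)) = Q"
proof -
  let ?f = "\<lambda>b. nat (gcd (b ^ 2) (int Q))"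
  have "(\<Sum>g | g dvd Q. card {b\<in>{0..<int Q}. ?f b = g}) = card {0..<int Q}"
  proof -
    have "?f ` {0..<int Q} \<subseteq> {g. g dvd Q}"
    proof safe
      fix b :: int
      have "gcd (b ^ 2) (int Q) dvd int Q" by simp
      thus "?f b dvd Q" by (simp add: nat_dvd_iff)
    qed
    from sum.group[OF _ _ this, of "\<lambda>_. 1 :: nat"] assms show ?thesis by simp
  qed
  moreover have "{b\<in>{0..<int Q}. ?f b = g} = gcd_class Q g" for g
    unfolding gcd_class_def by (intro Collect_cong conj_cong refl) (auto simp: nat_eq_iff)
  ultimately show ?thesis by simp
qed

text \<open>The class g = Q consists of the solutions of b^2 = 0 modulo Q, which survive however
  small M >= 0 is. It gives the first term; for all other classes the modulus \<open>Q div g\<close>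
  exceeds 1.\<close>

lemma card_small_squares_le_sum:
  assumes Q: "Q > 0"
  shows "card (small_squares Q M) \<le> square_part Q +
    (\<Sum>g | g dvd Q \<and> g < Q \<and> gcd_class Q g \<noteq> {}.
      square_part g * card (coprime_solutions (Q div g) (int (squarefree_part g)) (M / real g)))"
proof -
  let ?D = "{g. g dvd Q \<and> g < Q \<and> gcd_class Q g \<noteq> {}}"
  have fin: "finite ?D" by (rule finite_subset[of _ "{..<Q}"]) auto
  have "small_squares Q M \<subseteq> gcd_class Q Q \<union> (\<Union>g\<in>?D. gcd_class Q g \<inter> small_squares Q M)"
  proof
    fix b assume b: "b \<in> small_squares Q M"
    define g where "g = nat (gcd (b ^ 2) (int Q))"
    have g: "int g = gcd (b ^ 2) (int Q)" by (simp add: g_def)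
    have "int g dvd int Q" unfolding g by simp
    hence gQ: "g dvd Q" by simp
    have bg: "b \<in> gcd_class Q g" using b g by (simp add: gcd_class_def small_squares_def)
    show "b \<in> gcd_class Q Q \<union> (\<Union>g\<in>?D. gcd_class Q g \<inter> small_squares Q M)"
    proof (cases "g = Q")
      case False
      hence "g < Q" using dvd_imp_le[OF gQ Q] by simp
      hence "g \<in> ?D" using gQ bg by blast
      thus ?thesis using bg b by blast
    qed (use bg in simp)
  qed
  hence "card (small_squares Q M) \<le> card (gcd_class Q Q \<union> (\<Union>g\<in>?D. gcd_class Q g \<inter> small_squares Q M))"
    by (rule card_mono[rotated]) (use fin finite_small_squares in \<open>auto simp: gcd_class_def intro: finite_subset[of _ "{0..<int Q}"]\<close>)
  also have "\<dots> \<le> card (gcd_class Q Q) + card (\<Union>g\<in>?D. gcd_class Q g \<inter> small_squares Q M)"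
    by (rule card_Un_le)
  also have "\<dots> \<le> square_part Q + (\<Sum>g\<in>?D. card (gcd_class Q g \<inter> small_squares Q M))"
  proof (rule add_mono)
    show "card (gcd_class Q Q) \<le> square_part Q"
    proof (cases "gcd_class Q Q = {}")
      case False
      from card_gcd_class[OF Q _ refl refl refl False] Q show ?thesis by simp
    qed simp
    show "card (\<Union>g\<in>?D. gcd_class Q g \<inter> small_squares Q M) \<le> (\<Sum>g\<in>?D. card (gcd_class Q g \<inter> small_squares Q M))"
      by (rule card_UN_le[OF fin])
  qed
  also have "(\<Sum>g\<in>?D. card (gcd_class Q g \<inter> small_squares Q M)) \<le>
      (\<Sum>g\<in>?D. square_part g * card (coprime_solutions (Q div g) (int (squarefree_part g)) (M / real g)))"
    by (intro sum_mono card_gcd_class_small_squares_le[OF Q _ refl refl refl]) auto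
  finally show ?thesis by simp
qed

lemma square_part_square_le: "g > 0 \<Longrightarrow> square_part g ^ 2 \<le> (g :: nat)"
  by (intro dvd_imp_le) auto

lemma square_part_le:
  assumes "g > 0"
  shows "square_part g \<le> (g :: nat)"
proof -
  have "square_part g \<noteq> 0" using assms by simp
  hence "square_part g \<le> square_part g ^ 2" by (simp add: power2_eq_square)
  thus ?thesis using square_part_square_le[OF assms] by linarith
qed

lemma gcd_class_term_le:
  assumes Q: "Q > 0" and g: "g dvd Q" "g < Q" "gcd_class Q g \<noteq> {}" and M: "M \<ge> 0"
  shows "real (square_part g * card (coprime_solutions (Q div g) (int (squarefree_part g)) (M / real g))) \<le>
    9 * real (card {d. d dvd Q}) * M * (real (square_part g) / real g)"
proof -
  define n where "n = Q div g"
  note aux = gcd_class_parameters[OF Q g(1) refl refl refl, folded n_def]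
  have n: "n > 1" using aux(2) aux(4) g(2) by (cases "n = 1") auto
  have nQ: "n dvd Q" using aux(2) by simp
  have "(2::real) ^ card (prime_factors n) \<le> 2 ^ card (prime_factors Q)"
    using nQ Q by (intro power_increasing card_mono dvd_prime_factors) auto
  also have "\<dots> = real (2 ^ card (prime_factors Q))" by simp
  also have "\<dots> \<le> real (card {d. d dvd Q})"
    unfolding of_nat_le_iff using Q by (intro two_power_card_prime_factors_le) auto
  finally have tau: "(2::real) ^ card (prime_factors n) \<le> real (card {d. d dvd Q})" .
  have "real (card (coprime_solutions n (int (squarefree_part g)) (M / real g))) \<le> 9 * 2 ^ card (prime_factors n) * (M / real g)"
    using gcd_class_eq_image(1)[OF Q g(1) refl refl n_def g(3)] n M aux(3)
    by (intro card_coprime_solutions_crude) auto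
  also have "\<dots> \<le> 9 * real (card {d. d dvd Q}) * (M / real g)"
    using tau M by (intro mult_right_mono mult_left_mono) auto
  finally have "real (square_part g) * real (card (coprime_solutions n (int (squarefree_part g)) (M / real g))) \<le>
      real (square_part g) * (9 * real (card {d. d dvd Q}) * (M / real g))" by (rule mult_left_mono) simp
  thus ?thesis by (simp add: n_def mult_ac)
qed

text \<open>One factor of the divisor function bounds the number of square roots of each m, the
  other the number of classes.\<close>

lemma card_small_squares_crude:
  assumes Q: "Q > 0" and M: "M \<ge> 0"
  shows "real (card (small_squares Q M)) \<le> real (square_part Q) + 9 * real (card {d. d dvd Q}) ^ 2 * M"
proof -
  let ?D = "{g. g dvd Q \<and> g < Q \<and> gcd_class Q g \<noteq> {}}" and ?\<tau> = "real (card {d. d dvd Q})"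
  let ?t = "\<lambda>g. square_part g * card (coprime_solutions (Q div g) (int (squarefree_part g)) (M / real g))"
  have "(\<Sum>g\<in>?D. real (?t g)) \<le> (\<Sum>g\<in>?D. 9 * ?\<tau> * M)"
  proof (intro sum_mono)
    fix g assume g: "g \<in> ?D"
    hence g0: "g > 0" using Q by (auto intro: Nat.gr0I)
    have "real (?t g) \<le> 9 * ?\<tau> * M * (real (square_part g) / real g)"
      using g by (intro gcd_class_term_le Q M) auto
    also have "\<dots> \<le> 9 * ?\<tau> * M * 1"
      using g0 M square_part_le[OF g0] by (intro mult_left_mono) auto
    finally show "real (?t g) \<le> 9 * ?\<tau> * M" by simp
  qed
  also have "\<dots> = real (card ?D) * (9 * ?\<tau> * M)" by simp
  also have "\<dots> \<le> ?\<tau> * (9 * ?\<tau> * M)"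
    using Q M by (intro mult_right_mono) (auto intro!: card_mono)
  finally have "(\<Sum>g\<in>?D. real (?t g)) \<le> 9 * ?\<tau> ^ 2 * M" by (simp add: power2_eq_square mult_ac)
  moreover have "real (card (small_squares Q M)) \<le> real (square_part Q + (\<Sum>g\<in>?D. ?t g))"
    unfolding of_nat_le_iff by (rule card_small_squares_le_sum[OF Q])
  ultimately show ?thesis by simp
qed

text \<open>
  The main terms add up exactly: the class of \<open>g\<close> has \<open>square_part g * totient (Q div g)\<close> elements, and
  the classes partition the residues modulo \<open>Q\<close>. Divisors \<open>g > z\<close> are treated crudely.
\<close>

lemma card_small_squares_refined:
  assumes Q: "Q > 0" and z: "z \<ge> 1" "real Q = z ^ 1000" and M: "z ^ 375 \<le> M"
  shows "real (card (small_squares Q M)) \<le> real (square_part Q) +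
    (2 ^ 210 + 2 ^ 211 * real (card {d. d dvd Q}) ^ 4 / sqrt z) * M"
proof -
  let ?D = "{g. g dvd Q \<and> g < Q \<and> gcd_class Q g \<noteq> {}}"
  define \<tau> where "\<tau> = real (card {d. d dvd Q})"
  let ?t = "\<lambda>g. square_part g * card (coprime_solutions (Q div g) (int (squarefree_part g)) (M / real g))"
  have M0: "M \<ge> 0" using M z(1) by (meson dual_order.trans one_le_power zero_le_one)
  have tau1: "\<tau> \<ge> 1"
  proof -
    have "card {1 :: nat} \<le> card {d. d dvd Q}" using Q by (intro card_mono) auto
    thus ?thesis by (simp add: \<tau>_def)
  qed
  have sz: "sqrt z \<ge> 1" "sqrt z \<le> z" using z(1) by (simp_all add: real_le_lsqrt power2_eq_square)
  define E where "E = 2 ^ 211 * \<tau> ^ 3 * M / sqrt z"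
  have E: "E \<ge> 0" using M0 z(1) tau1 by (simp add: E_def)
  have t_le: "real (?t g) \<le> 2 ^ 210 * M * (real (card (gcd_class Q g)) / real Q) + E" if g: "g \<in> ?D" for g
  proof -
    define n where "n = Q div g"
    have g': "g dvd Q" "g < Q" "gcd_class Q g \<noteq> {}" using g by auto
    note aux = gcd_class_parameters[OF Q g'(1) refl refl refl, folded n_def]
    have g0: "g > 0" by (rule aux(3))
    show ?thesis
    proof (cases "real g \<le> z")
      \<comment> \<open>The refined count needs M / g >= z^374, hence z^375 in the
        hypothesis.\<close>
      case True
      have "(2::nat) ^ card (prime_factors n) \<le> 2 ^ card (prime_factors Q)"
        using Q aux(2) by (intro power_increasing card_mono dvd_prime_factors) auto
      also have "\<dots> \<le> card {d. d dvd Q}" using Q by (intro two_power_card_prime_factors_le) auto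
      finally have "real (2 ^ card (prime_factors n)) \<le> \<tau>" unfolding \<tau>_def of_nat_le_iff .
      hence "real (2 ^ card (prime_factors n)) ^ 3 \<le> \<tau> ^ 3" by (intro power_mono) auto
      moreover have "real (2 ^ card (prime_factors n)) ^ 3 = 8 ^ card (prime_factors n)"
        by (simp add: power_mult[symmetric] mult.commute[of _ 3] power_mult)
      ultimately have tau3: "8 ^ card (prime_factors n) \<le> \<tau> ^ 3" by simp
      have "real (card (coprime_solutions n (int (squarefree_part g)) (M / real g))) \<le>
         2 ^ 210 * (M / real g * (real (totient n) / real n) + 8 ^ card (prime_factors n) * (M / real g) / z)"
      proof (rule card_coprime_solutions_refined[OF aux(4)])
        show "coprime (int (squarefree_part g)) (int n)"
          by (rule gcd_class_eq_image(1)[OF Q g'(1) refl refl n_def g'(3)])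
        have "n \<le> Q" using Q aux(2) g0 by (simp add: aux(2))
        thus "real n \<le> z ^ 1000" using z(2) by simp
        have "z ^ 374 * real g \<le> z ^ 374 * z" using True z(1) by (intro mult_left_mono) auto
        also have "\<dots> \<le> M" using M by (simp add: power_numeral_reduce mult_ac)
        finally show "z ^ 374 \<le> M / real g" using g0 by (simp add: pos_le_divide_eq)
      qed (rule z(1))
      hence "real (square_part g) * real (card (coprime_solutions n (int (squarefree_part g)) (M / real g))) \<le>
         real (square_part g) * (2 ^ 210 * (M / real g * (real (totient n) / real n) + 8 ^ card (prime_factors n) * (M / real g) / z))"
        by (rule mult_left_mono) simp
      hence "real (?t g) \<le> real (square_part g) * (2 ^ 210 * (M / real g * (real (totient n) / real n) + 8 ^ card (prime_factors n) * (M / real g) / z))"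
        by (simp only: of_nat_mult n_def)
      also have "\<dots> = 2 ^ 210 * M * (real (square_part g * totient n) / real (g * n)) +
           (real (square_part g) / real g) * (2 ^ 210 * 8 ^ card (prime_factors n) * M / z)"
        using g0 by (simp add: field_simps)
      also have "real (square_part g * totient n) / real (g * n) = real (card (gcd_class Q g)) / real Q"
        using card_gcd_class[OF Q g'(1) refl refl n_def g'(3)] aux(2) by simp
      also have "(real (square_part g) / real g) * (2 ^ 210 * 8 ^ card (prime_factors n) * M / z) \<le> 1 * E"
      proof (rule mult_mono)
        show "real (square_part g) / real g \<le> 1" using square_part_le[OF g0] g0 by simp
        show "2 ^ 210 * 8 ^ card (prime_factors n) * M / z \<le> E"
          unfolding E_def using tau3 M0 sz z(1) tau1
          by (intro frac_le mult_mono) auto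
      qed (use M0 z(1) in auto)
      finally show ?thesis by simp
    next
      case False
      have "real (?t g) \<le> 9 * \<tau> * M * (real (square_part g) / real g)"
        unfolding \<tau>_def by (rule gcd_class_term_le[OF Q g' M0])
      \<comment> \<open>The square of \<open>square_part g\<close> is at most g, so the weight is at
        most 1 / sqrt g. This is the origin of sqrt z in the error term.\<close>
      also have "\<dots> \<le> 9 * \<tau> * M * (1 / sqrt z)"
      proof (rule mult_left_mono)
        have "real (square_part g) ^ 2 \<le> real g"
          using square_part_square_le[OF g0] by (metis of_nat_le_iff of_nat_power)
        hence "real (square_part g) \<le> sqrt (real g)" by (rule real_le_rsqrt)
        hence "real (square_part g) / real g \<le> sqrt (real g) / real g" using g0 by (intro divide_right_mono) auto
        also have "\<dots> = 1 / sqrt (real g)" using g0 by (simp add: real_div_sqrt field_simps)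
        also have "\<dots> \<le> 1 / sqrt z" using False z(1) by (intro divide_left_mono) auto
        finally show "real (square_part g) / real g \<le> 1 / sqrt z" .
      qed (use M0 tau1 in auto)
      also have "\<dots> = 9 * \<tau> * M / sqrt z" by simp
      also have "\<dots> \<le> E"
        unfolding E_def using tau1 M0 z(1) power_increasing[of 1 3 \<tau>]
        by (intro divide_right_mono mult_right_mono mult_mono) auto
      also have "\<dots> \<le> 2 ^ 210 * M * (real (card (gcd_class Q g)) / real Q) + E" using M0 by simp
      finally show ?thesis .
    qed
  qed
  have fin: "finite {g. g dvd Q}" using Q by simp
  have "(\<Sum>g\<in>?D. real (?t g)) \<le> (\<Sum>g\<in>?D. 2 ^ 210 * M * (real (card (gcd_class Q g)) / real Q) + E)"
    by (intro sum_mono t_le)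
  also have "\<dots> \<le> (\<Sum>g | g dvd Q. 2 ^ 210 * M * (real (card (gcd_class Q g)) / real Q) + E)"
    using fin M0 E by (intro sum_mono2) auto
  also have "\<dots> = 2 ^ 210 * M * (real (\<Sum>g | g dvd Q. card (gcd_class Q g)) / real Q) + \<tau> * E"
    by (simp add: sum.distrib \<tau>_def sum_distrib_left sum_divide_distrib)
  also have "\<dots> = 2 ^ 210 * M + \<tau> * E" unfolding sum_card_gcd_class[OF Q] using Q by simp
  also have "\<dots> = (2 ^ 210 + 2 ^ 211 * \<tau> ^ 4 / sqrt z) * M"
    by (simp add: E_def power_numeral_reduce algebra_simps)
  finally have "(\<Sum>g\<in>?D. real (?t g)) \<le> (2 ^ 210 + 2 ^ 211 * \<tau> ^ 4 / sqrt z) * M" .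
  moreover have "real (card (small_squares Q M)) \<le> real (square_part Q + (\<Sum>g\<in>?D. ?t g))"
    unfolding of_nat_le_iff by (rule card_small_squares_le_sum[OF Q])
  ultimately show ?thesis by (simp add: \<tau>_def)
qed

lemma card_small_squares_bound:
  fixes \<epsilon> :: real
  assumes "\<epsilon> > 0"
  shows "\<exists>C\<ge>1. \<forall>Q>0. \<forall>M\<ge>0. real (card (small_squares Q M)) \<le>
    real (square_part Q) + C * (M + M powr (1/2) * real Q powr (3/16 + \<epsilon>))"
proof -
  obtain C1 where C1: "C1 \<ge> 1" "\<And>n. n > 0 \<Longrightarrow> real (card {d. d dvd n}) \<le> C1 * real n powr (\<epsilon> / 2)"
    using card_divisors_bound[of "\<epsilon> / 2"] assms by auto
  \<comment> \<open>The exponent makes the fourth power of the divisor function at most C2^4 *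
    Q^(1/2000) = C2^4 * sqrt z.\<close>
  obtain C2 where C2: "C2 \<ge> 1" "\<And>n. n > 0 \<Longrightarrow> real (card {d. d dvd n}) \<le> C2 * real n powr (1 / 8000)"
    using card_divisors_bound[of "1 / 8000"] by auto
  define C where "C = 9 * C1 ^ 2 + (2 ^ 210 + 2 ^ 211 * C2 ^ 4)"
  have Cge: "9 * C1 ^ 2 \<le> C" "2 ^ 210 + 2 ^ 211 * C2 ^ 4 \<le> C" "1 \<le> C"
  proof -
    have "0 \<le> 2 ^ 210 + 2 ^ 211 * C2 ^ 4" using C2(1) by (intro add_nonneg_nonneg mult_nonneg_nonneg) auto
    thus C: "9 * C1 ^ 2 \<le> C" by (simp add: C_def)
    show "2 ^ 210 + 2 ^ 211 * C2 ^ 4 \<le> C" by (simp add: C_def)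
    have "1 \<le> 9 * C1 ^ 2" using one_le_power[OF C1(1), of 2] by linarith
    thus "1 \<le> C" using C by (rule order.trans)
  qed
  have "real (card (small_squares Q M)) \<le>
    real (square_part Q) + C * (M + M powr (1/2) * real Q powr (3/16 + \<epsilon>))" if Q: "Q > 0" and M: "M \<ge> 0" for Q M
  proof (cases "M \<le> real Q powr (3/8)")
    case True
    have "real (card {d. d dvd Q}) ^ 2 \<le> (C1 * real Q powr (\<epsilon> / 2)) ^ 2"
      using C1(2)[OF Q] by (intro power_mono) auto
    also have "\<dots> = C1 ^ 2 * real Q powr \<epsilon>"
      using Q by (simp add: power_mult_distrib powr_power)
    finally have "9 * real (card {d. d dvd Q}) ^ 2 * M \<le> 9 * (C1 ^ 2 * real Q powr \<epsilon>) * M"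
      using M by (intro mult_right_mono mult_left_mono) auto
    also have "\<dots> = 9 * C1 ^ 2 * (real Q powr \<epsilon> * M)" by simp
    also have "\<dots> \<le> C * (real Q powr \<epsilon> * M)" using Cge(1) M by (intro mult_right_mono) auto
    also have "real Q powr \<epsilon> * M \<le> M powr (1/2) * real Q powr (3/16 + \<epsilon>)"
    proof -
      have "M = M powr (1/2) * M powr (1/2)" using M by (simp flip: powr_add)
      also have "\<dots> \<le> M powr (1/2) * (real Q powr (3/8)) powr (1/2)"
        using True M by (intro mult_left_mono powr_mono2) auto
      also have "(real Q powr (3/8)) powr (1/2) = real Q powr (3/16)" by (simp add: powr_powr)
      finally have "real Q powr \<epsilon> * M \<le> real Q powr \<epsilon> * (M powr (1/2) * real Q powr (3/16))"
        by (intro mult_left_mono) auto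
      thus ?thesis by (simp add: powr_add mult_ac)
    qed
    hence "C * (real Q powr \<epsilon> * M) \<le> C * (M + M powr (1/2) * real Q powr (3/16 + \<epsilon>))"
      using Cge(3) M by (intro mult_left_mono) auto
    finally show ?thesis using card_small_squares_crude[OF Q M] by linarith
  next
    case False
    \<comment> \<open>Then z^375 = Q^(3/8), exactly the threshold of the case distinction.\<close>
    define z where "z = real Q powr (1 / 1000)"
    have z: "z \<ge> 1" "real Q = z ^ 1000" "z ^ 375 = real Q powr (3/8)" "sqrt z = real Q powr (1 / 2000)"
      using Q by (simp_all add: z_def ge_one_powr_ge_zero powr_power powr_powr flip: powr_half_sqrt)
    have "real (card {d. d dvd Q}) ^ 4 \<le> (C2 * real Q powr (1 / 8000)) ^ 4"
      using C2(2)[OF Q] by (intro power_mono) auto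
    also have "\<dots> = C2 ^ 4 * sqrt z"
      using Q unfolding z(4) by (simp add: power_mult_distrib powr_power)
    finally have tau: "real (card {d. d dvd Q}) ^ 4 / sqrt z \<le> C2 ^ 4" using z(1) by (simp add: pos_divide_le_eq)
    have "real (card (small_squares Q M)) \<le> real (square_part Q) +
        (2 ^ 210 + 2 ^ 211 * real (card {d. d dvd Q}) ^ 4 / sqrt z) * M"
      using False z by (intro card_small_squares_refined[OF Q z(1,2)]) simp
    also have "(2 ^ 210 + 2 ^ 211 * real (card {d. d dvd Q}) ^ 4 / sqrt z) * M \<le> C * M"
    proof (rule mult_right_mono[OF _ M])
      have "2 ^ 211 * (real (card {d. d dvd Q}) ^ 4 / sqrt z) \<le> 2 ^ 211 * C2 ^ 4" using tau by (intro mult_left_mono) auto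
      thus "2 ^ 210 + 2 ^ 211 * real (card {d. d dvd Q}) ^ 4 / sqrt z \<le> C" using Cge(2) by simp
    qed
    also have "C * M \<le> C * (M + M powr (1/2) * real Q powr (3/16 + \<epsilon>))" using Cge(3) by (intro mult_left_mono) auto
    finally show ?thesis by simp
  qed
  thus ?thesis using Cge(3) by blast
qed

subsection \<open>Fractions near integers\<close>

lemma max_square_root_divisor_ge:
  assumes "q > 0" "r ^ 2 dvd q"
  shows "r \<le> max_square_root_divisor q"
  unfolding max_square_root_divisor_def
proof (rule Greatest_le_nat[where b = q])
  show "r ^ 2 dvd q" by (rule assms(2))
  fix y assume "y ^ 2 dvd q"
  hence "y ^ 2 \<le> q" using assms(1) by (rule dvd_imp_le)
  moreover have "y \<le> y ^ 2" by (simp add: power2_eq_square)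
  ultimately show "y \<le> q" by linarith
qed

text \<open>Split the square part of v * q as R' * w with w its gcd with v, and v = v' * w. Then
  R'^2 divides v' * q and is coprime to v', so R'^2 divides q, while w <= v. Passing from q to Q = v
  q thus costs only a factor depending on \<open>lam\<close>.\<close>

lemma square_part_mult_le:
  assumes "v > 0" "q > 0"
  shows "square_part (v * q) \<le> v * max_square_root_divisor q"
proof -
  define R where "R = square_part (v * q)"
  define w where "w = gcd R v"
  have w0: "w > 0" using assms by (simp add: w_def)
  obtain R' v' where Rv: "R = R' * w" "v = v' * w" "coprime R' v'"
    using gcd_coprime_exists[of R v] w0 unfolding w_def by auto
  have "R ^ 2 dvd v * q" unfolding R_def by (rule square_part_square_dvd)
  hence "w * (w * R' ^ 2) dvd w * (v' * q)" unfolding Rv by (simp add: power2_eq_square mult_ac)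
  hence "w * R' ^ 2 dvd v' * q" using w0 by simp
  hence "R' ^ 2 dvd v' * q" by (rule dvd_mult_right)
  moreover have "coprime (R' ^ 2) v'" using Rv(3) by simp
  ultimately have "R' ^ 2 dvd q" by (simp add: coprime_dvd_mult_right_iff)
  hence "R' \<le> max_square_root_divisor q" by (rule max_square_root_divisor_ge[OF assms(2)])
  moreover have "w \<le> v" using assms(1) unfolding w_def by (intro dvd_imp_le) auto
  ultimately show ?thesis unfolding R_def[symmetric] Rv(1) by (subst mult.commute) (rule mult_le_mono)
qed

lemma card_int_between_le:
  fixes x y :: real
  assumes "x \<le> y" "\<And>i. i \<in> A \<Longrightarrow> x \<le> real_of_int i \<and> real_of_int i \<le> y"
  shows "finite A" "real (card A) \<le> y - x + 1"
proof -
  have sub: "A \<subseteq> {\<lceil>x\<rceil>..\<lfloor>y\<rfloor>}" using assms(2) by (auto simp: ceiling_le_iff le_floor_iff)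
  show "finite A" by (rule finite_subset[OF sub]) simp
  have "card A \<le> card {\<lceil>x\<rceil>..\<lfloor>y\<rfloor>}" using sub by (rule card_mono[rotated]) simp
  hence "real (card A) \<le> real (nat (\<lfloor>y\<rfloor> - \<lceil>x\<rceil> + 1))" by simp
  also have "\<dots> \<le> y - x + 1"
    using assms(1) diff_mono[OF of_int_floor_le[of y] le_of_int_ceiling[of x]] by (cases "\<lfloor>y\<rfloor> - \<lceil>x\<rceil> + 1 \<ge> 0") auto
  finally show "real (card A) \<le> y - x + 1" .
qed

lemma finite_int_scaled_interval:
  assumes "q > 0"
  shows "finite {a :: int. real_of_int a / real q \<in> {c..d}}"
  by (rule card_int_between_le(1)[of "min (c * real q) (d * real q)" "max (c * real q) (d * real q)"])
     (use assms in \<open>auto simp: pos_le_divide_eq pos_divide_le_eq\<close>)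

text \<open>If the distance is below \<delta>, then u a^2 lies within \<delta> Q of a multiple of Q
  for Q = v q; one more factor u turns u a^2 into the square of u a, at the cost of |u| in the size.
  Each residue b is hit by few a: in u a = Q i + b the quotient i lies in an interval of length |u|
  (d - c) / v.\<close>

lemma card_near_integer_le:
  fixes u :: int and v q :: nat and c d \<delta> :: real
  assumes "u \<noteq> 0" "v > 0" "q > 0" "c \<le> d"
  shows "real (card {a. real_of_int a / real q \<in> {c..d} \<and> dist_int (real_of_int u / real v * (real_of_int a)\<^sup>2 / real q) < \<delta>})
    \<le> (\<bar>real_of_int u\<bar> * (d - c) / real v + 1) * real (card (small_squares (v * q) (\<bar>real_of_int u\<bar> * \<delta> * real (v * q))))"
proof -
  define Q where "Q = v * q"
  define S where "S = {a. real_of_int a / real q \<in> {c..d} \<and> dist_int (real_of_int u / real v * (real_of_int a)\<^sup>2 / real q) < \<delta>}"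
  let ?B = "small_squares Q (\<bar>real_of_int u\<bar> * \<delta> * real Q)"
  have Q0: "Q > 0" using assms by (simp add: Q_def)
  have finS: "finite S"
    unfolding S_def by (rule finite_subset[OF _ finite_int_scaled_interval[OF assms(3), of c d]]) auto
  have maps: "(u * a) mod int Q \<in> ?B" if a: "a \<in> S" for a
  proof -
    define t where "t = real_of_int u / real v * (real_of_int a)\<^sup>2 / real q"
    define m where "m = u * (u * a ^ 2 - round t * int Q)"
    have t: "t * real Q = real_of_int (u * a ^ 2)"
      using assms(2,3) by (simp add: t_def Q_def field_simps)
    have "\<bar>t - real_of_int (round t)\<bar> < \<delta>" using a by (simp add: S_def dist_int_def t_def)
    hence "\<bar>t - real_of_int (round t)\<bar> * real Q \<le> \<delta> * real Q" by (intro mult_right_mono) auto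
    moreover have "\<bar>t - real_of_int (round t)\<bar> * real Q = \<bar>t * real Q - real_of_int (round t) * real Q\<bar>"
      by (simp add: abs_mult_pos left_diff_distrib)
    ultimately have "\<bar>real_of_int (u * a ^ 2) - real_of_int (round t) * real Q\<bar> \<le> \<delta> * real Q"
      by (simp only: t)
    hence "\<bar>real_of_int u\<bar> * \<bar>real_of_int (u * a ^ 2) - real_of_int (round t) * real Q\<bar> \<le> \<bar>real_of_int u\<bar> * (\<delta> * real Q)"
      by (intro mult_left_mono) auto
    hence "real_of_int \<bar>m\<bar> \<le> \<bar>real_of_int u\<bar> * \<delta> * real Q"
      by (simp add: m_def abs_mult)
    moreover have "[((u * a) mod int Q) ^ 2 = m] (mod int Q)"
    proof -
      have "(u * a) ^ 2 = m + int Q * (u * round t)" by (simp add: m_def power2_eq_square algebra_simps)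
      hence "(u * a) ^ 2 mod int Q = m mod int Q" by simp
      thus ?thesis by (simp add: Cong.cong_def power_mod)
    qed
    ultimately show ?thesis unfolding small_squares_def using Q0 by auto
  qed
  have fibre: "real (card {a\<in>S. (u * a) mod int Q = b}) \<le> \<bar>real_of_int u\<bar> * (d - c) / real v + 1" for b
  proof -
    let ?F = "{a\<in>S. (u * a) mod int Q = b}" and ?i = "\<lambda>a. (u * a) div int Q"
    define x where "x = min (real_of_int u * c) (real_of_int u * d) / real v - real_of_int b / real Q"
    define y where "y = max (real_of_int u * c) (real_of_int u * d) / real v - real_of_int b / real Q"
    have inj: "inj_on ?i ?F"
    proof (rule inj_onI)
      fix a a' assume "a \<in> ?F" "a' \<in> ?F" "?i a = ?i a'"
      hence "u * a = u * a'" by (metis (mono_tags, lifting) mem_Collect_eq mult_div_mod_eq)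
      thus "a = a'" using assms(1) by simp
    qed
    have xy: "x \<le> y" unfolding x_def y_def using assms(2) by (intro diff_right_mono divide_right_mono) auto
    have "x \<le> real_of_int (?i a) \<and> real_of_int (?i a) \<le> y" if a: "a \<in> ?F" for a
    proof -
      have ab: "u * a = int Q * ?i a + b" using a mult_div_mod_eq[of "int Q" "u * a"] by simp
      hence "real_of_int u * real_of_int a = real Q * real_of_int (?i a) + real_of_int b"
        by (metis of_int_add of_int_mult of_int_of_nat_eq)
      hence i: "real_of_int (?i a) = real_of_int u * (real_of_int a / real q) / real v - real_of_int b / real Q"
        using Q0 assms(2,3) by (simp add: Q_def field_simps)
      have "real_of_int a / real q \<in> {c..d}" using a by (simp add: S_def)
      hence "min (real_of_int u * c) (real_of_int u * d) \<le> real_of_int u * (real_of_int a / real q) \<and>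
          real_of_int u * (real_of_int a / real q) \<le> max (real_of_int u * c) (real_of_int u * d)"
      proof (cases "u \<ge> 0")
        case True
        assume ad: "real_of_int a / real q \<in> {c..d}"
        have "real_of_int u * c \<le> real_of_int u * (real_of_int a / real q)"
             "real_of_int u * (real_of_int a / real q) \<le> real_of_int u * d"
          using ad True by (auto intro!: mult_left_mono simp del: times_divide_eq_right)
        thus ?thesis by linarith
      next
        case False
        assume ad: "real_of_int a / real q \<in> {c..d}"
        have "real_of_int u * d \<le> real_of_int u * (real_of_int a / real q)"
             "real_of_int u * (real_of_int a / real q) \<le> real_of_int u * c"
          using ad False by (auto intro!: mult_left_mono_neg simp del: times_divide_eq_right)
        thus ?thesis by linarith
      qed
      thus ?thesis unfolding i x_def y_def using assms(2)
        by (intro conjI diff_right_mono divide_right_mono) auto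
    qed
    hence "real (card (?i ` ?F)) \<le> y - x + 1" by (intro card_int_between_le(2)[OF xy]) blast
    moreover have "y - x = \<bar>real_of_int u\<bar> * (d - c) / real v"
    proof -
      have "max (real_of_int u * c) (real_of_int u * d) - min (real_of_int u * c) (real_of_int u * d) = \<bar>real_of_int u * d - real_of_int u * c\<bar>"
        by (simp add: max_def min_def abs_if)
      also have "\<dots> = \<bar>real_of_int u\<bar> * (d - c)"
        using assms(4) by (simp add: right_diff_distrib[symmetric] abs_mult)
      finally show ?thesis unfolding x_def y_def by (simp flip: diff_divide_distrib)
    qed
    ultimately show ?thesis using card_image[OF inj] by simp
  qed
  have "card S = (\<Sum>b\<in>?B. card {a\<in>S. (u * a) mod int Q = b})"
    using sum.group[OF finS finite_small_squares, of "\<lambda>a. (u * a) mod int Q" Q "\<bar>real_of_int u\<bar> * \<delta> * real Q" "\<lambda>_. 1 :: nat"]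
      maps by (simp add: image_subset_iff)
  hence "real (card S) = (\<Sum>b\<in>?B. real (card {a\<in>S. (u * a) mod int Q = b}))" by simp
  also have "\<dots> \<le> (\<Sum>b\<in>?B. \<bar>real_of_int u\<bar> * (d - c) / real v + 1)" by (intro sum_mono fibre)
  finally show ?thesis by (simp add: S_def Q_def mult.commute)
qed

lemma max_square_root_divisor_pos: "q > 0 \<Longrightarrow> max_square_root_divisor q \<ge> 1"
  by (rule max_square_root_divisor_ge) auto

text \<open>All \<delta> > 0 are covered because the dyadic summation in
  \<open>sum_dist_int_powr_bound\<close> applies the bound with \<delta> up to 2.\<close>

lemma card_near_integer_bound:
  fixes lam c d \<epsilon> :: real
  assumes "lam \<in> \<rat>" "lam \<noteq> 0" "c \<le> d" "\<epsilon> > 0"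
  shows "\<exists>K\<ge>0. \<forall>(q::nat) (\<delta>::real). 0 < q \<longrightarrow> 0 < \<delta> \<longrightarrow>
    real (card {a. real_of_int a / real q \<in> {c..d} \<and> dist_int (lam * (real_of_int a)\<^sup>2 / real q) < \<delta>}) \<le>
    K * (\<delta> * real q + real (max_square_root_divisor q) + \<delta> powr (1/2) * real q powr (11/16 + \<epsilon>))"
proof -
  obtain u v' where uv': "v' > 0" "lam = real_of_int u / real_of_int v'"
    using Rats_cases'[OF assms(1)] by metis
  define v where "v = nat v'"
  have v: "v > 0" "lam = real_of_int u / real v" using uv' by (simp_all add: v_def)
  have u: "u \<noteq> 0" using assms(2) v by auto
  obtain C where C: "C \<ge> 1" "\<And>Q M. Q > 0 \<Longrightarrow> M \<ge> 0 \<Longrightarrow> real (card (small_squares Q M)) \<le>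
      real (square_part Q) + C * (M + M powr (1/2) * real Q powr (3/16 + \<epsilon>))"
    using card_small_squares_bound[OF assms(4)] by metis
  define W where "W = \<bar>real_of_int u\<bar> * (d - c) / real v + 1"
  define A where "A = \<bar>real_of_int u\<bar> * real v"
  define D where "D = A powr (1/2) * real v powr (3/16 + \<epsilon>)"
  define K where "K = W * (real v + C * (A + D))"
  have pos: "W \<ge> 0" "A \<ge> 0" "D \<ge> 0" using assms(3) by (simp_all add: W_def A_def D_def)
  have "K \<ge> 0" unfolding K_def using pos C(1) by simp
  moreover have "real (card {a. real_of_int a / real q \<in> {c..d} \<and> dist_int (lam * (real_of_int a)\<^sup>2 / real q) < \<delta>}) \<le>
    K * (\<delta> * real q + real (max_square_root_divisor q) + \<delta> powr (1/2) * real q powr (11/16 + \<epsilon>))"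
    if q: "0 < q" and \<delta>: "0 < \<delta>" for q \<delta>
  proof -
    let ?r = "real (max_square_root_divisor q)" and ?E = "\<delta> powr (1/2) * real q powr (11/16 + \<epsilon>)"
    let ?T = "\<delta> * real q + ?r + ?E"
    have M: "\<bar>real_of_int u\<bar> * \<delta> * real (v * q) = A * (\<delta> * real q)" by (simp add: A_def)
    have "real (card {a. real_of_int a / real q \<in> {c..d} \<and> dist_int (lam * (real_of_int a)\<^sup>2 / real q) < \<delta>}) \<le>
        W * real (card (small_squares (v * q) (A * (\<delta> * real q))))"
      using card_near_integer_le[OF u v(1) q assms(3), of \<delta>] unfolding M v(2) W_def .
    also have "\<dots> \<le> W * (real (square_part (v * q)) + C * (A * (\<delta> * real q) + (A * (\<delta> * real q)) powr (1/2) * real (v * q) powr (3/16 + \<epsilon>)))"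
      using v q \<delta> pos by (intro mult_left_mono C(2)) auto
    \<comment> \<open>Here 1/2 + 3/16 = 11/16, and the dependence on \<open>lam\<close> is collected
      in \<open>D\<close>.\<close>
    also have "(A * (\<delta> * real q)) powr (1/2) * real (v * q) powr (3/16 + \<epsilon>) = D * ?E"
    proof -
      have "real q powr (1/2) * real q powr (3/16 + \<epsilon>) = real q powr (11/16 + \<epsilon>)"
        by (simp flip: powr_add)
      thus ?thesis using pos \<delta> by (simp add: D_def powr_mult mult_ac)
    qed
    also have "W * (real (square_part (v * q)) + C * (A * (\<delta> * real q) + D * ?E)) \<le> W * (real v * ?T + C * (A * ?T + D * ?T))"
    proof (intro mult_left_mono add_mono pos)
      have "real (square_part (v * q)) \<le> real v * ?r"
        using square_part_mult_le[OF v(1) q] by (metis of_nat_le_iff of_nat_mult)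
      also have "\<dots> \<le> real v * ?T" using \<delta> by (intro mult_left_mono) auto
      finally show "real (square_part (v * q)) \<le> real v * ?T" .
    qed (use \<delta> C(1) in auto)
    also have "\<dots> = K * ?T" by (simp add: K_def algebra_simps)
    finally show ?thesis .
  qed
  ultimately show ?thesis by blast
qed

section \<open>Dyadic summation of negative powers of the distance\<close>

lemma dist_int_le_half: "dist_int x \<le> 1 / 2"
  unfolding dist_int_def using of_int_round_abs_le[of x] by (simp add: abs_minus_commute)

text \<open>The condition on s is the induction step 4 <= 3 * s; it is applied to s = sqrt
  2.\<close>

lemma sum_geometric_le:
  fixes s :: real
  assumes "s \<ge> 4 / 3"
  shows "(\<Sum>j\<le>n. s ^ j) \<le> 4 * s ^ n"
proof (induction n)
  case (Suc n)
  have "4 * s ^ n \<le> 3 * s * s ^ n" using assms by (intro mult_right_mono) auto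
  thus ?case using Suc by simp
qed simp

text \<open>For one j the value D lies between 2^j * \<delta>0 and twice that, and this term alone
  suffices. The cutoffs are one-sided so that summation over a leads directly to the counts in
  \<open>card_near_integer_bound\<close>.\<close>

lemma dyadic_powr_le:
  fixes D \<delta>0 \<alpha> :: real
  assumes "0 < \<delta>0" "\<delta>0 \<le> D" "D \<le> 1" "0 \<le> \<alpha>" "finite J" "\<And>j. 2 ^ j * \<delta>0 \<le> 1 \<Longrightarrow> j \<in> J"
  shows "D powr (- \<alpha>) \<le> (\<Sum>j\<in>J. (2 ^ j * \<delta>0) powr (- \<alpha>) * of_bool (D < 2 * (2 ^ j * \<delta>0)))"
proof -
  have "\<exists>j. D < 2 * (2 ^ j * \<delta>0)"
  proof -
    obtain j where "D / \<delta>0 < 2 ^ j" using real_arch_pow[of 2] by auto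
    hence "D < 2 ^ j * \<delta>0" using assms(1) by (simp add: pos_divide_less_eq)
    hence "D < 2 * (2 ^ j * \<delta>0)" using assms(1) by (smt (verit) mult_pos_pos zero_less_power)
    thus ?thesis by blast
  qed
  define j where "j = (LEAST j. D < 2 * (2 ^ j * \<delta>0))"
  have j1: "D < 2 * (2 ^ j * \<delta>0)" unfolding j_def by (rule LeastI_ex) fact
  have j2: "2 ^ j * \<delta>0 \<le> D"
  proof (cases j)
    case (Suc i)
    hence "\<not> D < 2 * (2 ^ i * \<delta>0)" unfolding j_def by (intro not_less_Least) simp
    thus ?thesis using Suc by simp
  qed (use assms(2) in simp)
  have jJ: "j \<in> J" using j2 assms(3) by (intro assms(6)) simp
  have "D powr (- \<alpha>) \<le> (2 ^ j * \<delta>0) powr (- \<alpha>) * of_bool (D < 2 * (2 ^ j * \<delta>0))"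
    using j1 j2 assms(1,4) by (simp add: powr_mono2')
  also have "\<dots> \<le> (\<Sum>j\<in>J. (2 ^ j * \<delta>0) powr (- \<alpha>) * of_bool (D < 2 * (2 ^ j * \<delta>0)))"
    by (rule member_le_sum[OF jJ _ assms(5)]) auto
  finally show ?thesis .
qed

text \<open>This limits the number of dyadic scales to about log Q, uniformly in \<delta>.\<close>

lemma dist_int_rational_ge:
  assumes "dist_int (real_of_int k / real Q) \<noteq> 0" "Q > 0"
  shows "1 / real Q \<le> dist_int (real_of_int k / real Q)"
proof -
  define t where "t = real_of_int k / real Q"
  define m where "m = k - round t * int Q"
  have "t - real_of_int (round t) = real_of_int m / real Q"
    using assms(2) by (simp add: m_def t_def field_simps)
  hence D: "dist_int t = \<bar>real_of_int m\<bar> / real Q" by (simp add: dist_int_def)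
  hence "m \<noteq> 0" using assms(1) by (auto simp: t_def)
  hence "1 \<le> \<bar>real_of_int m\<bar>" by linarith
  thus ?thesis using D assms(2) by (simp add: t_def divide_right_mono)
qed

text \<open>At scale x the counting bound yields three terms. The term x^(1 - \<alpha>) q is
  dominated by the scales near 1, and x^(-\<alpha>) r by the smallest scale, which is at least
  \<delta>. The term x^(1/2 - \<alpha>) q^(3/4) is at most q^(3/4) because \<alpha> <= 1/2, and it
  is summed over all scales.\<close>

lemma sum_dist_int_powr_bound:
  fixes lam c d \<alpha> \<epsilon> :: real
  assumes "lam \<in> \<rat>" "lam \<noteq> 0" "c \<le> d" "0 < \<alpha>" "\<alpha> \<le> 1/2"
  shows "\<exists>C\<ge>0. \<forall>(q::nat) (\<delta>::real). 0 < q \<longrightarrow> 0 < \<delta> \<longrightarrow>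
    (\<Sum>a | real_of_int a / real q \<in> {c..d} \<and> dist_int (lam * (real_of_int a)\<^sup>2 / real q) \<ge> \<delta>.
       dist_int (lam * (real_of_int a)\<^sup>2 / real q) powr (- \<alpha>))
    \<le> C * (real q + \<delta> powr (- \<alpha>) * real (max_square_root_divisor q))"
proof -
  obtain u v' where uv': "v' > 0" "lam = real_of_int u / real_of_int v'"
    using Rats_cases'[OF assms(1)] by metis
  define v where "v = nat v'"
  have v: "v > 0" "lam = real_of_int u / real v" using uv' by (simp_all add: v_def)
  \<comment> \<open>With 1/16 in place of \<epsilon> the exponent of q is 3/4; the remaining q^(1/4)
    absorbs the logarithmic number of scales.\<close>
  obtain K where K: "K \<ge> 0" "\<And>q \<delta>. 0 < q \<Longrightarrow> 0 < \<delta> \<Longrightarrow>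
    real (card {a. real_of_int a / real q \<in> {c..d} \<and> dist_int (lam * (real_of_int a)\<^sup>2 / real q) < \<delta>}) \<le>
    K * (\<delta> * real q + real (max_square_root_divisor q) + \<delta> powr (1/2) * real q powr (11/16 + 1/16))"
    using card_near_integer_bound[OF assms(1-3), of "1/16"] by auto
  define t where "t = (2::real) powr (- \<alpha>)"
  have t: "0 \<le> t" "t < 1" using assms(4) powr_less_mono[of "- \<alpha>" 0 2] by (simp_all add: t_def)
  define B where "B = 1 + 4 / ln 2 * real v powr (1/4)"
  have B: "B \<ge> 1" by (simp add: B_def)
  define C where "C = 8 * K + K / (1 - t) + 2 * K * B"
  have "C \<ge> 0" using K(1) t B by (simp add: C_def)
  moreover have "(\<Sum>a | real_of_int a / real q \<in> {c..d} \<and> dist_int (lam * (real_of_int a)\<^sup>2 / real q) \<ge> \<delta>.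
       dist_int (lam * (real_of_int a)\<^sup>2 / real q) powr (- \<alpha>))
    \<le> C * (real q + \<delta> powr (- \<alpha>) * real (max_square_root_divisor q))" if q: "0 < q" and \<delta>: "0 < \<delta>" for q \<delta>
  proof -
    define D where "D a = dist_int (lam * (real_of_int a)\<^sup>2 / real q)" for a :: int
    define I where "I = {a :: int. real_of_int a / real q \<in> {c..d}}"
    define r where "r = real (max_square_root_divisor q)"
    define Q where "Q = v * q"
    \<comment> \<open>Nonzero distances are at least 1 / Q, so there is nothing to count below this
      scale.\<close>
    define \<delta>0 where "\<delta>0 = max \<delta> (1 / real Q)"
    have Q: "Q > 0" using v q by (simp add: Q_def)
    have \<delta>0: "\<delta>0 > 0" "\<delta> \<le> \<delta>0" "1 / real Q \<le> \<delta>0" using \<delta> by (auto simp: \<delta>0_def)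
    have finI: "finite I" unfolding I_def by (rule finite_int_scaled_interval[OF q])
    define J where "J = {j. 2 ^ j * \<delta>0 \<le> 1}"
    have J_le: "real j \<le> log 2 (real Q)" if "j \<in> J" for j
    proof -
      have "2 ^ j * (1 / real Q) \<le> 2 ^ j * \<delta>0" using \<delta>0(3) by (intro mult_left_mono) auto
      also have "\<dots> \<le> 1" using that by (simp add: J_def)
      finally have "2 powr real j \<le> real Q" using Q by (simp add: powr_realpow field_simps)
      thus ?thesis using Q by (simp add: le_log_iff)
    qed
    have logQ: "0 \<le> log 2 (real Q)" using Q by simp
    have J_sub: "J \<subseteq> {..nat \<lfloor>log 2 (real Q)\<rfloor>}"
      using J_le logQ by (auto simp: le_nat_iff le_floor_iff)
    have finJ: "finite J" using J_sub by (rule finite_subset) simp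
    have card_J: "real (card J) \<le> B * real q powr (1/4)"
    proof -
      have "card J \<le> nat \<lfloor>log 2 (real Q)\<rfloor> + 1" using card_mono[OF _ J_sub] by simp
      hence "real (card J) \<le> log 2 (real Q) + 1" using logQ by linarith
      also have "log 2 (real Q) \<le> 4 / ln 2 * real Q powr (1/4)"
      proof -
        have "ln (real Q) \<le> real Q powr (1/4) / (1/4)" using Q by (intro ln_powr_bound) auto
        hence "ln (real Q) / ln 2 \<le> (real Q powr (1/4) / (1/4)) / ln 2" by (intro divide_right_mono) auto
        thus ?thesis by (simp add: log_def mult.commute)
      qed
      also have "4 / ln 2 * real Q powr (1/4) + 1 \<le> 4 / ln 2 * real Q powr (1/4) + real q powr (1/4)"
        using q by (simp add: ge_one_powr_ge_zero)
      also have "\<dots> = B * real q powr (1/4)" by (simp add: B_def Q_def powr_mult algebra_simps)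
      finally show ?thesis by simp
    qed
    have D_ge: "\<delta>0 \<le> D a" if "\<delta> \<le> D a" for a
    proof -
      have eq: "lam * (real_of_int a)\<^sup>2 / real q = real_of_int (u * a ^ 2) / real Q"
        using v by (simp add: Q_def)
      have "1 / real Q \<le> D a" using that \<delta> unfolding D_def eq by (intro dist_int_rational_ge Q) auto
      thus ?thesis using that by (simp add: \<delta>0_def)
    qed
    have "(\<Sum>a | a \<in> I \<and> D a \<ge> \<delta>. D a powr (- \<alpha>)) \<le>
        (\<Sum>a | a \<in> I \<and> D a \<ge> \<delta>. \<Sum>j\<in>J. (2 ^ j * \<delta>0) powr (- \<alpha>) * of_bool (D a < 2 * (2 ^ j * \<delta>0)))"
    proof (intro sum_mono dyadic_powr_le finJ)
      fix a assume a: "a \<in> {a. a \<in> I \<and> D a \<ge> \<delta>}"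
      show "\<delta>0 \<le> D a" using a D_ge by simp
      show "D a \<le> 1" using dist_int_le_half[of "lam * (real_of_int a)\<^sup>2 / real q"] unfolding D_def by linarith
    qed (use \<delta>0 assms(4) in \<open>auto simp: J_def\<close>)
    also have "\<dots> \<le> (\<Sum>a\<in>I. \<Sum>j\<in>J. (2 ^ j * \<delta>0) powr (- \<alpha>) * of_bool (D a < 2 * (2 ^ j * \<delta>0)))"
      using finI by (intro sum_mono2 sum_nonneg) auto
    also have "\<dots> = (\<Sum>j\<in>J. \<Sum>a\<in>I. (2 ^ j * \<delta>0) powr (- \<alpha>) * of_bool (D a < 2 * (2 ^ j * \<delta>0)))"
      by (rule sum.swap)
    also have "\<dots> = (\<Sum>j\<in>J. (2 ^ j * \<delta>0) powr (- \<alpha>) * real (card {a\<in>I. D a < 2 * (2 ^ j * \<delta>0)}))"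
    proof (intro sum.cong refl)
      fix j
      have "(\<Sum>a\<in>I. of_bool (D a < 2 * (2 ^ j * \<delta>0))) = real (card {a\<in>I. D a < 2 * (2 ^ j * \<delta>0)})"
        using finI by (simp add: of_bool_def sum.inter_filter[symmetric])
      thus "(\<Sum>a\<in>I. (2 ^ j * \<delta>0) powr (- \<alpha>) * of_bool (D a < 2 * (2 ^ j * \<delta>0))) =
          (2 ^ j * \<delta>0) powr (- \<alpha>) * real (card {a\<in>I. D a < 2 * (2 ^ j * \<delta>0)})"
        by (simp only: sum_distrib_left[symmetric])
    qed
    also have "\<dots> \<le> (\<Sum>j\<in>J. 2 * K * real q * (sqrt 2 ^ j * sqrt \<delta>0) + K * r * \<delta> powr (- \<alpha>) * t ^ j + 2 * K * real q powr (3/4))"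
    proof (intro sum_mono)
      fix j assume j: "j \<in> J"
      define x where "x = 2 ^ j * \<delta>0"
      have x: "0 < x" "x \<le> 1" using j \<delta>0 by (auto simp: x_def J_def)
      have "real (card {a\<in>I. D a < 2 * x}) \<le> K * (2 * x * real q + r + (2 * x) powr (1/2) * real q powr (3/4))"
        using K(2)[of q "2 * x"] q x by (simp add: I_def D_def r_def)
      hence "x powr (- \<alpha>) * real (card {a\<in>I. D a < 2 * x}) \<le>
          x powr (- \<alpha>) * (K * (2 * x * real q + r + (2 * x) powr (1/2) * real q powr (3/4)))"
        by (intro mult_left_mono) auto
      also have "\<dots> = 2 * K * real q * (x powr (- \<alpha>) * x) + K * r * x powr (- \<alpha>)
          + K * real q powr (3/4) * (x powr (- \<alpha>) * (2 * x) powr (1/2))"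
        by (simp add: algebra_simps)
      also have "\<dots> \<le> 2 * K * real q * (sqrt 2 ^ j * sqrt \<delta>0) + K * r * (\<delta> powr (- \<alpha>) * t ^ j) + K * real q powr (3/4) * 2"
      proof (intro add_mono mult_left_mono)
        have "x powr (- \<alpha>) * x = x powr (1 - \<alpha>)" using x by (simp add: powr_diff powr_minus field_simps)
        \<comment> \<open>As x <= 1 and \<alpha> <= 1/2, this gives a geometric series of ratio sqrt
          2, independent of \<alpha>.\<close>
        also have "\<dots> \<le> x powr (1/2)" using x assms(5) by (intro powr_mono') auto
        also have "\<dots> = sqrt 2 ^ j * sqrt \<delta>0" using x by (simp add: powr_half_sqrt x_def real_sqrt_mult real_sqrt_power)
        finally show "x powr (- \<alpha>) * x \<le> sqrt 2 ^ j * sqrt \<delta>0" .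
        have "x powr (- \<alpha>) = t ^ j * \<delta>0 powr (- \<alpha>)"
          using \<delta>0 by (simp add: x_def powr_mult t_def powr_power powr_powr mult.commute[of \<alpha>] flip: powr_realpow)
        also have "\<dots> \<le> t ^ j * \<delta> powr (- \<alpha>)"
          using \<delta> \<delta>0 assms(4) t by (intro mult_left_mono powr_mono2') auto
        finally show "x powr (- \<alpha>) \<le> \<delta> powr (- \<alpha>) * t ^ j" by (simp add: mult.commute)
        have "x powr (- \<alpha>) * (2 * x) powr (1/2) = 2 powr (1/2) * x powr (1/2 - \<alpha>)"
        proof -
          have "x powr (- \<alpha>) * x powr (1/2) = x powr (1/2 - \<alpha>)" by (simp flip: powr_add)
          thus ?thesis using x by (simp add: powr_mult mult_ac)
        qed
        also have "\<dots> \<le> 2 * 1"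
        proof (rule mult_mono)
          show "2 powr (1/2) \<le> (2::real)" using powr_mono[of "1/2" 1 "2::real"] by simp
          show "x powr (1/2 - \<alpha>) \<le> 1" using x assms(5) by (intro powr_le1) auto
        qed auto
        finally show "x powr (- \<alpha>) * (2 * x) powr (1/2) \<le> 2" by simp
      qed (use K(1) in \<open>auto simp: r_def\<close>)
      finally show "(2 ^ j * \<delta>0) powr (- \<alpha>) * real (card {a\<in>I. D a < 2 * (2 ^ j * \<delta>0)}) \<le>
          2 * K * real q * (sqrt 2 ^ j * sqrt \<delta>0) + K * r * \<delta> powr (- \<alpha>) * t ^ j + 2 * K * real q powr (3/4)"
        by (simp add: x_def mult_ac)
    qed
    also have "\<dots> = 2 * K * real q * (\<Sum>j\<in>J. sqrt 2 ^ j * sqrt \<delta>0) + K * r * \<delta> powr (- \<alpha>) * (\<Sum>j\<in>J. t ^ j)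
        + 2 * K * real q powr (3/4) * real (card J)"
      by (simp add: sum.distrib sum_distrib_left)
    also have "\<dots> \<le> 2 * K * real q * 4 + K * r * \<delta> powr (- \<alpha>) * (1 / (1 - t)) + 2 * K * real q powr (3/4) * (B * real q powr (1/4))"
    proof (intro add_mono mult_left_mono card_J)
      show "(\<Sum>j\<in>J. sqrt 2 ^ j * sqrt \<delta>0) \<le> 4"
      proof (cases "J = {}")
        case False
        define n where "n = Max J"
        have n: "n \<in> J" "J \<subseteq> {..n}" using finJ False by (auto simp: n_def)
        have "(\<Sum>j\<in>J. sqrt 2 ^ j * sqrt \<delta>0) \<le> (\<Sum>j\<le>n. sqrt 2 ^ j * sqrt \<delta>0)"
          using n \<delta>0 by (intro sum_mono2) auto
        also have "\<dots> = (\<Sum>j\<le>n. sqrt 2 ^ j) * sqrt \<delta>0" by (simp add: sum_distrib_right)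
        also have "\<dots> \<le> (4 * sqrt 2 ^ n) * sqrt \<delta>0"
        proof (intro mult_right_mono sum_geometric_le)
          show "4 / 3 \<le> sqrt (2::real)" by (rule real_le_rsqrt) (simp add: power2_eq_square)
        qed (use \<delta>0 in simp)
        also have "\<dots> = 4 * sqrt (2 ^ n * \<delta>0)" by (simp add: real_sqrt_mult real_sqrt_power)
        also have "\<dots> \<le> 4" using n(1) by (simp add: J_def)
        finally show ?thesis .
      qed simp
      have "(\<Sum>j\<in>J. t ^ j) \<le> (\<Sum>j. t ^ j)" using t finJ by (intro sum_le_suminf summable_geometric) auto
      also have "\<dots> = 1 / (1 - t)" using t by (intro suminf_geometric) simp
      finally show "(\<Sum>j\<in>J. t ^ j) \<le> 1 / (1 - t)" .
    qed (use K(1) in \<open>auto simp: r_def\<close>)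
    also have "\<dots> = 8 * K * real q + K / (1 - t) * (\<delta> powr (- \<alpha>) * r) + 2 * K * B * (real q powr (3/4) * real q powr (1/4))"
      by simp
    also have "real q powr (3/4) * real q powr (1/4) = real q" using q by (simp flip: powr_add)
    also have "8 * K * real q + K / (1 - t) * (\<delta> powr (- \<alpha>) * r) + 2 * K * B * real q \<le> C * (real q + \<delta> powr (- \<alpha>) * r)"
    proof -
      have "8 * K + 2 * K * B \<le> C" "K / (1 - t) \<le> C" using K(1) t B by (simp_all add: C_def)
      hence "(8 * K + 2 * K * B) * real q + K / (1 - t) * (\<delta> powr (- \<alpha>) * r) \<le> C * real q + C * (\<delta> powr (- \<alpha>) * r)"
        by (intro add_mono mult_right_mono) (auto simp: r_def)
      thus ?thesis by (simp add: algebra_simps)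
    qed
    finally show ?thesis by (simp add: I_def D_def r_def)
  qed
  ultimately show ?thesis by blast
qed

lemma le_powr_Suc:
  assumes "(n :: nat) \<ge> 1" "\<epsilon> > 0"
  shows "real n \<le> real n powr (1 + \<epsilon>)"
  using powr_mono[of 1 "1 + \<epsilon>" "real n"] assms by simp

text \<open>The first bound is stated for \<open>lam \<noteq> 0\<close> because it fails for
  \<open>lam = 0\<close> and c < d: every a with a / q in [c, d] is then counted, about (d - c) q of
  them for each \<delta>, whereas for squarefree q the right side stays bounded as \<delta> tends to
  0. Both estimates are proved with r itself and weakened to r^(1 + \<epsilon>) here.\<close>

theorem theorem5:
  fixes lam c d \<alpha> \<epsilon> :: real
  assumes "lam \<in> \<rat>" and "c \<le> d" and "0 < \<alpha>" and "\<alpha> \<le> 1/2" and "0 < \<epsilon>"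
  shows "(lam \<noteq> 0 \<longrightarrow>
      (\<exists>C::real. \<forall>(q::nat) (\<delta>::real). 0 < q \<longrightarrow> 0 < \<delta> \<longrightarrow> \<delta> < 1/2 \<longrightarrow>
        (\<Sum>a | real_of_int a / real q \<in> {c..d} \<and>
               dist_int (lam * (real_of_int a)\<^sup>2 / real q) < \<delta>. (1::real))
          \<le> C * (\<delta> * real q
                  + real (max_square_root_divisor q) powr (1 + \<epsilon>)
                  + \<delta> powr (1/2) * real q powr (11/16 + \<epsilon>))))
    \<and> (\<exists>C::real. \<forall>(q::nat) (\<delta>::real). 0 < q \<longrightarrow> 0 < \<delta> \<longrightarrow> \<delta> < 1/2 \<longrightarrow>
        (\<Sum>a | real_of_int a / real q \<in> {c..d} \<and>
               dist_int (lam * (real_of_int a)\<^sup>2 / real q) \<ge> \<delta>.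
            dist_int (lam * (real_of_int a)\<^sup>2 / real q) powr (- \<alpha>))
          \<le> C * (real q + \<delta> powr (- \<alpha>) * real (max_square_root_divisor q) powr (1 + \<epsilon>)))"
proof (intro conjI impI)
  assume "lam \<noteq> 0"
  then obtain K where K: "K \<ge> 0" "\<And>q \<delta>. 0 < q \<Longrightarrow> 0 < \<delta> \<Longrightarrow>
    real (card {a. real_of_int a / real q \<in> {c..d} \<and> dist_int (lam * (real_of_int a)\<^sup>2 / real q) < \<delta>}) \<le>
    K * (\<delta> * real q + real (max_square_root_divisor q) + \<delta> powr (1/2) * real q powr (11/16 + \<epsilon>))"
    using card_near_integer_bound[OF assms(1) _ assms(2,5)] by blast
  show "\<exists>C::real. \<forall>(q::nat) (\<delta>::real). 0 < q \<longrightarrow> 0 < \<delta> \<longrightarrow> \<delta> < 1/2 \<longrightarrow>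
        (\<Sum>a | real_of_int a / real q \<in> {c..d} \<and>
               dist_int (lam * (real_of_int a)\<^sup>2 / real q) < \<delta>. (1::real))
          \<le> C * (\<delta> * real q
                  + real (max_square_root_divisor q) powr (1 + \<epsilon>)
                  + \<delta> powr (1/2) * real q powr (11/16 + \<epsilon>))"
  proof (intro exI[of _ K] allI impI)
    fix q :: nat and \<delta> :: real
    assume q: "0 < q" and \<delta>: "0 < \<delta>"
    note K(2)[OF q \<delta>]
    also have "K * (\<delta> * real q + real (max_square_root_divisor q) + \<delta> powr (1/2) * real q powr (11/16 + \<epsilon>)) \<le>
        K * (\<delta> * real q + real (max_square_root_divisor q) powr (1 + \<epsilon>) + \<delta> powr (1/2) * real q powr (11/16 + \<epsilon>))"
      using K(1) \<delta> by (intro mult_left_mono add_mono le_powr_Suc max_square_root_divisor_pos q assms(5)) auto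
    finally show "(\<Sum>a | real_of_int a / real q \<in> {c..d} \<and>
               dist_int (lam * (real_of_int a)\<^sup>2 / real q) < \<delta>. (1::real))
          \<le> K * (\<delta> * real q
                  + real (max_square_root_divisor q) powr (1 + \<epsilon>)
                  + \<delta> powr (1/2) * real q powr (11/16 + \<epsilon>))" by simp
  qed
next
  show "\<exists>C::real. \<forall>(q::nat) (\<delta>::real). 0 < q \<longrightarrow> 0 < \<delta> \<longrightarrow> \<delta> < 1/2 \<longrightarrow>
        (\<Sum>a | real_of_int a / real q \<in> {c..d} \<and>
               dist_int (lam * (real_of_int a)\<^sup>2 / real q) \<ge> \<delta>.
            dist_int (lam * (real_of_int a)\<^sup>2 / real q) powr (- \<alpha>))
          \<le> C * (real q + \<delta> powr (- \<alpha>) * real (max_square_root_divisor q) powr (1 + \<epsilon>))"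
  proof (cases "lam = 0")
    \<comment> \<open>All distances are 0 < \<delta>, so the sum is empty.\<close>
    case True
    thus ?thesis by (intro exI[of _ 0]) (simp add: dist_int_def)
  next
    case False
    then obtain C where C: "C \<ge> 0" "\<And>q \<delta>. 0 < q \<Longrightarrow> 0 < \<delta> \<Longrightarrow>
      (\<Sum>a | real_of_int a / real q \<in> {c..d} \<and> dist_int (lam * (real_of_int a)\<^sup>2 / real q) \<ge> \<delta>.
         dist_int (lam * (real_of_int a)\<^sup>2 / real q) powr (- \<alpha>))
      \<le> C * (real q + \<delta> powr (- \<alpha>) * real (max_square_root_divisor q))"
      using sum_dist_int_powr_bound[OF assms(1) _ assms(2-4)] by blast
    show ?thesis
    proof (intro exI[of _ C] allI impI)
      fix q :: nat and \<delta> :: real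
      assume q: "0 < q" and \<delta>: "0 < \<delta>"
      note C(2)[OF q \<delta>]
      also have "C * (real q + \<delta> powr (- \<alpha>) * real (max_square_root_divisor q)) \<le>
          C * (real q + \<delta> powr (- \<alpha>) * real (max_square_root_divisor q) powr (1 + \<epsilon>))"
        using C(1) by (intro mult_left_mono add_mono le_powr_Suc max_square_root_divisor_pos q assms(5)) auto
      finally show "(\<Sum>a | real_of_int a / real q \<in> {c..d} \<and>
               dist_int (lam * (real_of_int a)\<^sup>2 / real q) \<ge> \<delta>.
            dist_int (lam * (real_of_int a)\<^sup>2 / real q) powr (- \<alpha>))
          \<le> C * (real q + \<delta> powr (- \<alpha>) * real (max_square_root_divisor q) powr (1 + \<epsilon>))" .
    qed
  qed
qed

end
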